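(* There exists a unique collection of constants $\{c_{\bar\lambda}\}$ from the field $\mathbb F_r$ with $c_{\bar\emptyset}=1$ such that the map $$[\bar\lambda]=[(\lambda^1,\ldots,\lambda^r)]\mapsto c_{\bar\lambda}\cdot|\lambda^1\rangle\otimes\cdots\otimes|\lambda^r\rangle$$ induces an isomorphism $M^r\to F(\chi_1^{-1})\otimes\cdots\otimes F(\chi_r^{-1})$ of $\ddot U_{q_1,q_2,q_3}(\mathfrak{gl}_1)$-representations with $q_i=t_i$.
   Context: (1) Algebra. For $q_1q_2q_3=1$, $q_3=q^2$, $\ddot U_{q_1,q_2,q_3}(\mathfrak{gl}_1)$ is the unital associative algebra generated by $e_i,f_i,\psi_i,\psi_0^{-1}$ ($i\in\mathbb Z$) with, for $e(z)=\sum_{i\in\mathbb Z}e_iz^{-i}$, $f(z)=\sum_{i\in\mathbb Z}f_iz^{-i}$, $\psi^\pm(z)=\psi_0^{\pm1}+\sum_{j>0}\psi_{\pm j}z^{\mp j}$, $\delta(z)=\sum_{i\in\mathbb Z}z^i$ (products over $i=1,2,3$): all $\psi_i$ commute, $\psi_0\psi_0^{-1}=\psi_0^{-1}\psi_0=1$; $e(z)e(w)\prod_i(z-q_iw)=-e(w)e(z)\prod_i(w-q_iz)$; $f(z)f(w)\prod_i(w-q_iz)=-f(w)f(z)\prod_i(z-q_iw)$; $[e(z),f(w)]=\frac{\delta(z/w)}{(1-q_1)(1-q_2)(1-q_3)}(\psi^+(w)-\psi^-(z))$; $\psi^\pm(z)e(w)\prod_i(z-q_iw)=-e(w)\psi^\pm(z)\prod_i(w-q_iz)$;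 $\psi^\pm(z)f(w)\prod_i(w-q_iz)=-f(w)\psi^\pm(z)\prod_i(z-q_iw)$; $\mathrm{Sym}_{\mathfrak S_3}[e_{i_1},[e_{i_2+1},e_{i_3-1}]]=0=\mathrm{Sym}_{\mathfrak S_3}[f_{i_1},[f_{i_2+1},f_{i_3-1}]]$ (sum over permutations of $i_1,i_2,i_3$). Here the base field is $\mathbb F_r=\mathbb C(t_1,t_2,\chi_1,\dots,\chi_r)[t]/(t^2-t_3)$, $t_3=t_1^{-1}t_2^{-1}$, with $q_i=t_i$, $q=t$. $(\cdot)^\pm$ denotes expansion of a rational function in $z^{\mp1}$. (2) The representation $M^r$. $M(r,n)$ is the Gieseker moduli space of framed torsion-free sheaves on $\mathbb P^2$ of rank $r$ with $c_2=n$, equivalently $M(r,n)=\{(B_1,B_2,i,j)\mid[B_1,B_2]+ij=0\}^s/GL_n(\mathbb C)$ with $B_1,B_2\in\mathrm{End}(\mathbb C^n)$, $i\in\mathrm{Hom}(\mathbb C^r,\mathbb C^n)$, $j\in\mathrm{Hom}(\mathbb C^n,\mathbb C^r)$, stable: no proper subspace of $\mathbb C^n$ containing $\mathrm{Im}(i)$ is $B_1,B_2$-invariant. $\mathfrak F_r$ is the tautological rank $n$ bundle. $\mathbb T_r=(\mathbb C^* )^2\times(\mathbb C^* )^r$ (characters $t_1,t_2,\chi_1,\dots,\chi_r$) acts via the action on $\mathbb P^2$ and by rescaling the framing; the fixed points $\xi_{\bar\lambda}$ are labeled by $r$-tuples of Young diagrams $\bar\lambda=(\lambda^1,\dots,\lambda^r)$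 with $|\bar\lambda|=n$. The Hecke correspondence $M(r;n,n+1)$ parametrizes a point of $M(r,n+1)$ together with a line $S\subset\mathrm{Ker}\,j\subset\mathbb C^{n+1}$ invariant under $B_1,B_2$ (the quotient by $S$ gives a point of $M(r,n)$); $L_r$ is its tautological line bundle (fiber $S$), $\mathbf p_r,\mathbf q_r$ its projections to $M(r,n)$ and $M(r,n+1)$. $M^r=\bigoplus_nK^{\mathbb T_r}(M(r,n))\otimes_{K^{\mathbb T_r}(pt)}\mathbb F_r$, with basis $[\bar\lambda]$, the direct images of the structure sheaves of the fixed points. The action is $e_i=\mathbf q_{r*}(L_r^{\otimes i}\otimes\mathbf p_r^* )$, $f_i=(-t)^{r-2}\chi_1^{-1}\cdots\chi_r^{-1}\mathbf p_{r*}(L_r^{\otimes(i-r)}\otimes\mathbf q_r^* )$, $\psi^\pm(z)=\big(\prod_{a=1}^r\frac{t^{-1}-t\chi_a^{-1}/z}{1-\chi_a^{-1}/z}\mathbf c_r(z)\big)^\pm$, where $\mathbf a_r(z)=\sum_{i\ge0}[\Lambda^i\mathfrak F_r](-1/z)^i$ and $\mathbf c_r(z)=\prod_{k=1}^3\mathbf a_r(zt_k)\mathbf a_r(zt_k^{-1})^{-1}$. Conventions are such that explicitly, with $\chi^{(a)}_k:=t_1^{\lambda^a_k-1}t_2^{k-1}\chi_a^{-1}$ and $\square^l_j$ the box added/removed in row $j$ of $\lambda^l$, the coefficient of $[\bar\lambda]$ in $e_p[\bar\lambda-\square^l_j]$ is $\frac{(\chi^{(l)}_j)^p}{1-t_1t_2}\prod_{a=1}^r\prod_{k=1}^\infty\frac{1-t_1t_2\chi^{(a)}_k/\chi^{(l)}_j}{1-t_1\chi^{(a)}_k/\chi^{(l)}_j}$;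 the coefficient of $[\bar\lambda]$ in $f_p[\bar\lambda+\square^l_j]$ is $(-t)^{r-2}\chi_1^{-1}\cdots\chi_r^{-1}\frac{(t_1\chi^{(l)}_j)^{p-r}}{1-t_1t_2}\prod_{a=1}^r\prod_{k=1}^\infty\frac{1-t_1t_2\chi^{(l)}_j/\chi^{(a)}_k}{1-t_1\chi^{(l)}_j/\chi^{(a)}_k}$; all other matrix coefficients of $e_p,f_p$ vanish. The infinite products are taken after telescoping: if $\lambda^a_k=0$ for $k>L$, the tail $\prod_{k>L}$ equals $1/(1-t_1\chi^{(a)}_{L+1}/\chi^{(l)}_j)$ in the first formula and $1-t_1t_2\chi^{(l)}_j/\chi^{(a)}_{L+1}$ in the second ($L\ge j$). The eigenvalue of $\psi^\pm(z)$ on $[\bar\lambda]$ is $\Big(\prod_{a=1}^r\frac{t^{-1}-t\chi_a^{-1}/z}{1-\chi_a^{-1}/z}\prod_{a=1}^r\prod_{\square\in\lambda^a}\prod_{k=1}^3\frac{1-t_k^{-1}\chi(\square)/z}{1-t_k\chi(\square)/z}\Big)^\pm$, where the box in row $j$, column $i$ of $\lambda^a$ has $\chi(\square)=t_1^{i-1}t_2^{j-1}\chi_a^{-1}$. (3) Fock module $F(u)$: basis $|\lambda\rangle$ over Young diagrams, $\lambda\pm i$ = add/remove a box in row $i$, $$e(z)|\lambda\rangle=\sum_{i\ge1}\prod_{j=1}^{i-1}\frac{(1-q_1^{\lambda_i-\lambda_j}q_2^{i-j-1})(1-q_1^{\lambda_i-\lambda_j+1}q_2^{i-j+1})}{(1-q_1^{\lambda_i-\lambda_j}q_2^{i-j})(1-q_1^{\lambda_i-\lambda_j+1}q_2^{i-j})}\frac{\delta(q_1^{\lambda_i}q_2^{i-1}u/z)}{1-q_1}|\lambda+i\rangle,$$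 $$f(z)|\lambda\rangle=q^{-1}\sum_{i\ge1}\frac{1-q_1^{\lambda_{i+1}-\lambda_i}}{1-q_1^{\lambda_{i+1}-\lambda_i+1}q_2}\prod_{j=i+1}^\infty\frac{(1-q_1^{\lambda_j-\lambda_i+1}q_2^{j-i+1})(1-q_1^{\lambda_{j+1}-\lambda_i}q_2^{j-i})}{(1-q_1^{\lambda_{j+1}-\lambda_i+1}q_2^{j-i+1})(1-q_1^{\lambda_j-\lambda_i}q_2^{j-i})}\frac{\delta(q_1^{\lambda_i-1}q_2^{i-1}u/z)}{q_1^{-1}-1}|\lambda-i\rangle,$$ $$\psi^\pm(z)|\lambda\rangle=\gamma_{\lambda,u}(z)^\pm|\lambda\rangle,\quad\gamma_{\lambda,u}(z)=q^{-1}\frac{z-q_1^{\lambda_1-1}q_2^{-1}u}{z-q_1^{\lambda_1}u}\prod_{i\ge1}\frac{(z-q_1^{\lambda_i}q_2^iu)(z-q_1^{\lambda_{i+1}-1}q_2^{i-1}u)}{(z-q_1^{\lambda_{i+1}}q_2^iu)(z-q_1^{\lambda_i-1}q_2^{i-1}u)}.$$ (4) Tensor product $F(u_1)\otimes\cdots\otimes F(u_r)$, defined by the formal coproduct $\Delta(e(z))=e(z)\otimes1+\psi^-(z)\otimes e(z)$, $\Delta(f(z))=f(z)\otimes\psi^+(z)+1\otimes f(z)$, $\Delta(\psi^\pm(z))=\psi^\pm(z)\otimes\psi^\pm(z)$, with the rule $g(z)\delta(a/z)=g(a)\delta(a/z)$ for rational $g$: thus $e(z)$ acts on $|\lambda^1\rangle\otimes\cdots\otimes|\lambda^r\rangle$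 as the sum over $k$ of $e(z)$ acting on the $k$-th factor with each term containing $\delta(\chi/z)$ multiplied by $\prod_{l<k}\gamma_{\lambda^l,u_l}(\chi)$, and $f(z)$ as the sum over $k$ of $f(z)$ acting on the $k$-th factor with each such term multiplied by $\prod_{l>k}\gamma_{\lambda^l,u_l}(\chi)$. *)

theory Defs
  imports
    Complex_Main
    "HOL-Library.Poly_Mapping"
    "HOL-Combinatorics.Permutations"
    "HOL-Computational_Algebra.Formal_Laurent_Series"
begin

section \<open>The base field\<close>

text \<open>
  The index set \<open>{1..r}\<close> is rendered by a nonempty finite linearly ordered type \<open>'r\<close>, so that
  \<open>r = card (UNIV :: 'r set)\<close>; the linear order is the order of the tensor factors.

  The predicate says that \<open>'k\<close>, with the embedding \<open>\<iota>\<close> of the complex numbers and the elements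
  \<open>t1, t2, \<chi> a, t\<close>, is (a copy of) \<open>\<complex>(t1,t2,\<chi>)[t]/(t^2 - t3)\<close> with \<open>t3 = 1/(t1 t2)\<close>: the monomials
  in \<open>t1, t2, \<chi>\<close> are linearly independent over the complex numbers, \<open>t\<close> is a square root of \<open>t3\<close>, and
  everything together generates \<open>'k\<close> as a field.  This determines \<open>'k\<close> up to unique isomorphism,
  because \<open>t3\<close> has no square root in \<open>\<complex>(t1,t2,\<chi>)\<close>.
\<close>

definition base_field ::
    "(complex \<Rightarrow> 'k::field) \<Rightarrow> 'k \<Rightarrow> 'k \<Rightarrow> 'k \<Rightarrow> ('r::finite \<Rightarrow> 'k) \<Rightarrow> bool" where
  "base_field \<iota> t1 t2 t \<chi> \<longleftrightarrow>
     \<iota> 1 = 1 \<and> (\<forall>x y. \<iota> (x + y) = \<iota> x + \<iota> y) \<and> (\<forall>x y. \<iota> (x * y) = \<iota> x * \<iota> y) \<and>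
     (\<forall>(S :: (nat \<times> nat \<times> ('r \<Rightarrow> nat)) set) c.
        finite S \<longrightarrow>
        (\<Sum>(i, j, m)\<in>S. \<iota> (c (i, j, m)) * t1 ^ i * t2 ^ j * (\<Prod>a\<in>UNIV. \<chi> a ^ m a)) = 0 \<longrightarrow>
        (\<forall>s\<in>S. c s = 0)) \<and>
     t ^ 2 = inverse (t1 * t2) \<and>
     (\<forall>K. range \<iota> \<subseteq> K \<and> t1 \<in> K \<and> t2 \<in> K \<and> t \<in> K \<and> range \<chi> \<subseteq> K \<and>
          (\<forall>x\<in>K. \<forall>y\<in>K. x + y \<in> K \<and> x * y \<in> K) \<and> (\<forall>x\<in>K. - x \<in> K \<and> inverse x \<in> K)
          \<longrightarrow> K = UNIV)"


section \<open>Representations of the quantum toroidal algebra\<close>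

datatype toroidal_gen = E int | F int | Psi int | Psi0_inv

text \<open>
  A formal distribution \<open>D(z,w)\<close> is given by its coefficients: \<open>D a b\<close> is the coefficient of
  \<open>z^{-a} w^{-b}\<close>.  The following two functions are multiplication by
  \<open>(z - q1 w)(z - q2 w)(z - q3 w)\<close> and by \<open>(w - q1 z)(w - q2 z)(w - q3 z)\<close>.
\<close>

definition mult_z_minus :: "('k \<Rightarrow> 'v \<Rightarrow> 'v) \<Rightarrow> 'k \<Rightarrow> (int \<Rightarrow> int \<Rightarrow> 'v::ab_group_add) \<Rightarrow> int \<Rightarrow> int \<Rightarrow> 'v" where
  "mult_z_minus scl q D = (\<lambda>a b. D (a + 1) b - scl q (D a (b + 1)))"

definition mult_w_minus :: "('k \<Rightarrow> 'v \<Rightarrow> 'v) \<Rightarrow> 'k \<Rightarrow> (int \<Rightarrow> int \<Rightarrow> 'v::ab_group_add) \<Rightarrow> int \<Rightarrow> int \<Rightarrow> 'v" where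
  "mult_w_minus scl q D = (\<lambda>a b. D a (b + 1) - scl q (D (a + 1) b))"

definition mult_zw :: "('k \<Rightarrow> 'v \<Rightarrow> 'v) \<Rightarrow> 'k \<Rightarrow> 'k \<Rightarrow> 'k \<Rightarrow> (int \<Rightarrow> int \<Rightarrow> 'v::ab_group_add) \<Rightarrow> int \<Rightarrow> int \<Rightarrow> 'v" where
  "mult_zw scl q1 q2 q3 D = mult_z_minus scl q1 (mult_z_minus scl q2 (mult_z_minus scl q3 D))"

definition mult_wz :: "('k \<Rightarrow> 'v \<Rightarrow> 'v) \<Rightarrow> 'k \<Rightarrow> 'k \<Rightarrow> 'k \<Rightarrow> (int \<Rightarrow> int \<Rightarrow> 'v::ab_group_add) \<Rightarrow> int \<Rightarrow> int \<Rightarrow> 'v" where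
  "mult_wz scl q1 q2 q3 D = mult_w_minus scl q1 (mult_w_minus scl q2 (mult_w_minus scl q3 D))"

text \<open>
  \<open>psi_plus \<rho> m\<close> and \<open>psi_minus \<rho> m\<close> are the coefficients of \<open>z^{-m}\<close> in \<open>\<psi>^+(z)\<close> and \<open>\<psi>^-(z)\<close>;
  the constant term of the latter is \<open>\<psi>_0^{-1}\<close>.
\<close>

definition psi_plus :: "(toroidal_gen \<Rightarrow> 'v \<Rightarrow> 'v) \<Rightarrow> int \<Rightarrow> 'v \<Rightarrow> 'v::zero" where
  "psi_plus \<rho> m v = (if m \<ge> 0 then \<rho> (Psi m) v else 0)"

definition psi_minus :: "(toroidal_gen \<Rightarrow> 'v \<Rightarrow> 'v) \<Rightarrow> int \<Rightarrow> 'v \<Rightarrow> 'v::zero" where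
  "psi_minus \<rho> m v = (if m < 0 then \<rho> (Psi m) v else if m = 0 then \<rho> Psi0_inv v else 0)"

definition op_commutator :: "('v \<Rightarrow> 'v) \<Rightarrow> ('v \<Rightarrow> 'v) \<Rightarrow> 'v \<Rightarrow> 'v::ab_group_add" where
  "op_commutator A B v = A (B v) - B (A v)"

text \<open>
  A representation of the algebra presented by the toroidal generators and relations: a vector
  space with a linear operator \<open>\<rho> g\<close> for each generator \<open>g\<close> such that the defining relations hold.
  (By the universal property of the presentation, these are the same as the modules over it.)
\<close>

definition toroidal_rep ::
    "'k \<Rightarrow> 'k \<Rightarrow> 'k \<Rightarrow> ('k::field \<Rightarrow> 'v \<Rightarrow> 'v::ab_group_add) \<Rightarrow> (toroidal_gen \<Rightarrow> 'v \<Rightarrow> 'v) \<Rightarrow> bool" where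
  "toroidal_rep q1 q2 q3 scl \<rho> \<longleftrightarrow>
     vector_space scl \<and> (\<forall>g. Vector_Spaces.linear scl scl (\<rho> g)) \<and>
     \<comment> \<open>the \<open>\<psi>_i\<close> commute, and \<open>\<psi>_0\<close> is invertible\<close>
     (\<forall>i j v. \<rho> (Psi i) (\<rho> (Psi j) v) = \<rho> (Psi j) (\<rho> (Psi i) v)) \<and>
     (\<forall>v. \<rho> (Psi 0) (\<rho> Psi0_inv v) = v \<and> \<rho> Psi0_inv (\<rho> (Psi 0) v) = v) \<and>
     \<comment> \<open>\<open>e\<close>-\<open>e\<close> and \<open>f\<close>-\<open>f\<close>\<close>
     (\<forall>v a b. mult_zw scl q1 q2 q3 (\<lambda>a b. \<rho> (E a) (\<rho> (E b) v)) a b =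
            - mult_wz scl q1 q2 q3 (\<lambda>a b. \<rho> (E b) (\<rho> (E a) v)) a b) \<and>
     (\<forall>v a b. mult_wz scl q1 q2 q3 (\<lambda>a b. \<rho> (F a) (\<rho> (F b) v)) a b =
            - mult_zw scl q1 q2 q3 (\<lambda>a b. \<rho> (F b) (\<rho> (F a) v)) a b) \<and>
     \<comment> \<open>\<open>[e(z), f(w)]\<close>: the coefficient of \<open>z^{-a} w^{-b}\<close> in \<open>\<delta>(z/w) g(z)\<close>, as well as in
         \<open>\<delta>(z/w) g(w)\<close>, is the coefficient of \<open>z^{-(a+b)}\<close> in \<open>g(z)\<close>\<close>
     (\<forall>v a b. op_commutator (\<rho> (E a)) (\<rho> (F b)) v =
              scl (1 / ((1 - q1) * (1 - q2) * (1 - q3))) (psi_plus \<rho> (a + b) v - psi_minus \<rho> (a + b) v)) \<and>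
     \<comment> \<open>\<open>\<psi>\<close>-\<open>e\<close> and \<open>\<psi>\<close>-\<open>f\<close>\<close>
     (\<forall>\<psi>\<in>{psi_plus \<rho>, psi_minus \<rho>}. \<forall>v a b.
        mult_zw scl q1 q2 q3 (\<lambda>a b. \<psi> a (\<rho> (E b) v)) a b =
        - mult_wz scl q1 q2 q3 (\<lambda>a b. \<rho> (E b) (\<psi> a v)) a b) \<and>
     (\<forall>\<psi>\<in>{psi_plus \<rho>, psi_minus \<rho>}. \<forall>v a b.
        mult_wz scl q1 q2 q3 (\<lambda>a b. \<psi> a (\<rho> (F b) v)) a b =
        - mult_zw scl q1 q2 q3 (\<lambda>a b. \<rho> (F b) (\<psi> a v)) a b) \<and>
     \<comment> \<open>cubic relations\<close>
     (\<forall>X\<in>{E, F}. \<forall>(i :: nat \<Rightarrow> int) v.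
        (\<Sum>\<sigma> | \<sigma> permutes {1, 2, 3}.
           op_commutator (\<rho> (X (i (\<sigma> 1))))
             (op_commutator (\<rho> (X (i (\<sigma> 2) + 1))) (\<rho> (X (i (\<sigma> 3) - 1)))) v) = 0)"

definition toroidal_iso ::
    "'k \<Rightarrow> 'k \<Rightarrow> 'k \<Rightarrow> ('k::field \<Rightarrow> 'v \<Rightarrow> 'v::ab_group_add) \<Rightarrow> (toroidal_gen \<Rightarrow> 'v \<Rightarrow> 'v)
      \<Rightarrow> ('k \<Rightarrow> 'w \<Rightarrow> 'w::ab_group_add) \<Rightarrow> (toroidal_gen \<Rightarrow> 'w \<Rightarrow> 'w) \<Rightarrow> ('v \<Rightarrow> 'w) \<Rightarrow> bool" where
  "toroidal_iso q1 q2 q3 sclV \<rho>V sclW \<rho>W \<phi> \<longleftrightarrow>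
     toroidal_rep q1 q2 q3 sclV \<rho>V \<and> toroidal_rep q1 q2 q3 sclW \<rho>W \<and>
     Vector_Spaces.linear sclV sclW \<phi> \<and> bij \<phi> \<and> (\<forall>g v. \<phi> (\<rho>V g v) = \<rho>W g (\<phi> v))"


section \<open>Young diagrams\<close>

text \<open>
  Rows are numbered from \<open>1\<close>, as in the formulas below; the value at \<open>0\<close> is a dummy.
\<close>

definition is_diagram :: "(nat \<Rightarrow> nat) \<Rightarrow> bool" where
  "is_diagram f \<longleftrightarrow> f 0 = 0 \<and> (\<forall>i\<ge>1. f (i + 1) \<le> f i) \<and> (\<exists>L. \<forall>i>L. f i = 0)"

typedef young = "{f. is_diagram f}" morphisms row Abs_young
  by (rule exI [of _ "\<lambda>_. 0"]) (simp add: is_diagram_def)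

definition empty_diagram :: young where
  "empty_diagram = Abs_young (\<lambda>_. 0)"

definition addable :: "young \<Rightarrow> nat \<Rightarrow> bool" where
  "addable \<mu> i \<longleftrightarrow> is_diagram ((row \<mu>)(i := row \<mu> i + 1))"

definition removable :: "young \<Rightarrow> nat \<Rightarrow> bool" where
  "removable \<mu> i \<longleftrightarrow> row \<mu> i \<ge> 1 \<and> is_diagram ((row \<mu>)(i := row \<mu> i - 1))"

definition add_box :: "young \<Rightarrow> nat \<Rightarrow> young" where
  "add_box \<mu> i = Abs_young ((row \<mu>)(i := row \<mu> i + 1))"

definition remove_box :: "young \<Rightarrow> nat \<Rightarrow> young" where
  "remove_box \<mu> i = Abs_young ((row \<mu>)(i := row \<mu> i - 1))"

definition num_rows :: "young \<Rightarrow> nat" where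
  "num_rows \<mu> = (LEAST L. \<forall>k>L. row \<mu> k = 0)"

text \<open>Boxes are pairs (column, row).\<close>

definition boxes :: "young \<Rightarrow> (nat \<times> nat) set" where
  "boxes \<mu> = {(i, j). 1 \<le> j \<and> 1 \<le> i \<and> i \<le> row \<mu> j}"

type_synonym 'r diagrams = "'r \<Rightarrow> young"


section \<open>Vector spaces with a basis of tuples of diagrams\<close>

text \<open>
  Both \<open>M^r\<close> and \<open>F(u_1) \<otimes> \<dots> \<otimes> F(u_r)\<close> have a basis indexed by \<open>r\<close>-tuples of Young diagrams, namely
  \<open>[\<lambda>^1,\<dots>,\<lambda>^r]\<close> and \<open>|\<lambda>^1\<rangle> \<otimes> \<dots> \<otimes> |\<lambda>^r\<rangle>\<close>.  In either space the basis vector is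
  \<open>Poly_Mapping.single \<Lambda> 1\<close>, with \<open>\<Lambda> a = \<lambda>^a\<close>.
\<close>

definition scale :: "'k::field \<Rightarrow> ('b \<Rightarrow>\<^sub>0 'k) \<Rightarrow> ('b \<Rightarrow>\<^sub>0 'k)" where
  "scale c v = Poly_Mapping.map ((*) c) v"

definition lin_ext :: "('b \<Rightarrow> ('b \<Rightarrow>\<^sub>0 'k)) \<Rightarrow> ('b \<Rightarrow>\<^sub>0 'k) \<Rightarrow> ('b \<Rightarrow>\<^sub>0 'k::field)" where
  "lin_ext g v = (\<Sum>b\<in>Poly_Mapping.keys v. scale (Poly_Mapping.lookup v b) (g b))"

definition add_box_at :: "'r diagrams \<Rightarrow> 'r \<Rightarrow> nat \<Rightarrow> 'r diagrams" where
  "add_box_at \<Lambda> l j = \<Lambda>(l := add_box (\<Lambda> l) j)"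

definition remove_box_at :: "'r diagrams \<Rightarrow> 'r \<Rightarrow> nat \<Rightarrow> 'r diagrams" where
  "remove_box_at \<Lambda> l j = \<Lambda>(l := remove_box (\<Lambda> l) j)"

text \<open>
  Rational functions of \<open>z\<close> are written with an embedding \<open>\<epsilon>\<close> of the base field into a further
  field containing \<open>z\<close>.  With \<open>\<epsilon> = id\<close> this is evaluation at a point of the base field.  With
  \<open>\<epsilon> = fls_const\<close> it is an expansion: the expansion in powers of \<open>z\<close> is obtained for \<open>z = fls_X\<close>, and the
  expansion in powers of \<open>z^{-1}\<close> for \<open>z = fls_X_inv\<close>, where \<open>fls_X\<close> then stands for \<open>z^{-1}\<close>.
  The next definition is the eigenvalue of a generator \<open>\<psi>_m\<close> or \<open>\<psi>_0^{-1}\<close> when the one of \<open>\<psi>^\<plusminus>(z)\<close>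
  is \<open>g(z)^\<plusminus>\<close>.
\<close>

definition psi_coeff :: "('k fls \<Rightarrow> 'k fls) \<Rightarrow> int \<Rightarrow> 'k::field" where
  "psi_coeff g m = (if m \<ge> 0 then fls_nth (g fls_X_inv) m else fls_nth (g fls_X) (- m))"

definition psi0_inv_coeff :: "('k fls \<Rightarrow> 'k fls) \<Rightarrow> 'k::field" where
  "psi0_inv_coeff g = fls_nth (g fls_X) 0"


section \<open>The representation on the equivariant K-theory of the Gieseker spaces\<close>

text \<open>
  The action is given by its matrix coefficients in the basis \<open>[\<Lambda>]\<close> of direct images of the structure
  sheaves of the torus fixed points; the K-theory of the moduli spaces and the correspondences
  themselves are not constructed.
\<close>

definition row_weight :: "'k::field \<Rightarrow> 'k \<Rightarrow> ('r \<Rightarrow> 'k) \<Rightarrow> 'r diagrams \<Rightarrow> 'r \<Rightarrow> nat \<Rightarrow> 'k" where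
  "row_weight t1 t2 \<chi> \<Lambda> a k =
     t1 powi (int (row (\<Lambda> a) k) - 1) * t2 powi (int k - 1) * inverse (\<chi> a)"

text \<open>
  The infinite products over the rows are cut off at an \<open>L \<ge> j\<close> beyond which all rows are empty;
  their tails telescope, formally, to the additional factors with index \<open>L + 1\<close>.
\<close>

definition cutoff :: "'r diagrams \<Rightarrow> nat \<Rightarrow> nat" where
  "cutoff \<Lambda> j = (LEAST L. j \<le> L \<and> (\<forall>a. \<forall>k>L. row (\<Lambda> a) k = 0))"

text \<open>The coefficient of \<open>[\<Lambda>]\<close> in \<open>e_p [\<Lambda> - \<box>]\<close>, with \<open>\<box>\<close> in row \<open>j\<close> of the \<open>l\<close>-th diagram:\<close>

definition gieseker_e ::
    "'k::field \<Rightarrow> 'k \<Rightarrow> ('r::finite \<Rightarrow> 'k) \<Rightarrow> int \<Rightarrow> 'r diagrams \<Rightarrow> 'r \<Rightarrow> nat \<Rightarrow> 'k" where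
  "gieseker_e t1 t2 \<chi> p \<Lambda> l j =
     (let w = row_weight t1 t2 \<chi> \<Lambda>; L = cutoff \<Lambda> j in
      w l j powi p / (1 - t1 * t2) *
      (\<Prod>a\<in>UNIV. (\<Prod>k=1..L. (1 - t1 * t2 * w a k / w l j) / (1 - t1 * w a k / w l j)) *
                  (1 / (1 - t1 * w a (L + 1) / w l j))))"

text \<open>The coefficient of \<open>[\<Lambda>]\<close> in \<open>f_p [\<Lambda> + \<box>]\<close>, with \<open>\<box>\<close> in row \<open>j\<close> of the \<open>l\<close>-th diagram:\<close>

definition gieseker_f ::
    "'k::field \<Rightarrow> 'k \<Rightarrow> 'k \<Rightarrow> ('r::finite \<Rightarrow> 'k) \<Rightarrow> int \<Rightarrow> 'r diagrams \<Rightarrow> 'r \<Rightarrow> nat \<Rightarrow> 'k" where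
  "gieseker_f t1 t2 t \<chi> p \<Lambda> l j =
     (let w = row_weight t1 t2 \<chi> \<Lambda>; L = cutoff \<Lambda> j; r = int (card (UNIV :: 'r set)) in
      (- t) powi (r - 2) * (\<Prod>a\<in>UNIV. inverse (\<chi> a)) *
      ((t1 * w l j) powi (p - r) / (1 - t1 * t2)) *
      (\<Prod>a\<in>UNIV. (\<Prod>k=1..L. (1 - t1 * t2 * w l j / w a k) / (1 - t1 * w l j / w a k)) *
                  (1 - t1 * t2 * w l j / w a (L + 1))))"

definition box_weight :: "'k::field \<Rightarrow> 'k \<Rightarrow> 'k \<Rightarrow> nat \<times> nat \<Rightarrow> 'k" where
  "box_weight t1 t2 x = (\<lambda>(i, j). t1 ^ (i - 1) * t2 ^ (j - 1) * inverse x)"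

definition gieseker_psi ::
    "('k \<Rightarrow> 'f) \<Rightarrow> 'k::field \<Rightarrow> 'k \<Rightarrow> 'k \<Rightarrow> ('r::finite \<Rightarrow> 'k) \<Rightarrow> 'r diagrams \<Rightarrow> 'f \<Rightarrow> 'f::field" where
  "gieseker_psi \<epsilon> t1 t2 t \<chi> \<Lambda> z =
     (\<Prod>a\<in>UNIV. (\<epsilon> (inverse t) - \<epsilon> (t * inverse (\<chi> a)) / z) / (1 - \<epsilon> (inverse (\<chi> a)) / z)) *
     (\<Prod>a\<in>UNIV. \<Prod>b\<in>boxes (\<Lambda> a). \<Prod>s\<leftarrow>[t1, t2, inverse (t1 * t2)].
        (1 - \<epsilon> (inverse s * box_weight t1 t2 (\<chi> a) b) / z) /
        (1 - \<epsilon> (s * box_weight t1 t2 (\<chi> a) b) / z))"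

primrec gieseker_basis_action ::
    "'k::field \<Rightarrow> 'k \<Rightarrow> 'k \<Rightarrow> ('r::finite \<Rightarrow> 'k) \<Rightarrow> toroidal_gen \<Rightarrow> 'r diagrams \<Rightarrow> ('r diagrams \<Rightarrow>\<^sub>0 'k)" where
  "gieseker_basis_action t1 t2 t \<chi> (E p) = (\<lambda>\<Lambda>.
     \<Sum>(l, j) | addable (\<Lambda> l) j.
       Poly_Mapping.single (add_box_at \<Lambda> l j) (gieseker_e t1 t2 \<chi> p (add_box_at \<Lambda> l j) l j))"
| "gieseker_basis_action t1 t2 t \<chi> (F p) = (\<lambda>\<Lambda>.
     \<Sum>(l, j) | removable (\<Lambda> l) j.
       Poly_Mapping.single (remove_box_at \<Lambda> l j) (gieseker_f t1 t2 t \<chi> p (remove_box_at \<Lambda> l j) l j))"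
| "gieseker_basis_action t1 t2 t \<chi> (Psi m) = (\<lambda>\<Lambda>.
     Poly_Mapping.single \<Lambda> (psi_coeff (gieseker_psi fls_const t1 t2 t \<chi> \<Lambda>) m))"
| "gieseker_basis_action t1 t2 t \<chi> Psi0_inv = (\<lambda>\<Lambda>.
     Poly_Mapping.single \<Lambda> (psi0_inv_coeff (gieseker_psi fls_const t1 t2 t \<chi> \<Lambda>)))"

definition gieseker_action ::
    "'k::field \<Rightarrow> 'k \<Rightarrow> 'k \<Rightarrow> ('r::finite \<Rightarrow> 'k) \<Rightarrow> toroidal_gen
      \<Rightarrow> ('r diagrams \<Rightarrow>\<^sub>0 'k) \<Rightarrow> ('r diagrams \<Rightarrow>\<^sub>0 'k)" where
  "gieseker_action t1 t2 t \<chi> g = lin_ext (gieseker_basis_action t1 t2 t \<chi> g)"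


section \<open>Fock modules and their tensor products\<close>

text \<open>
  \<open>e(z)\<close> acts on \<open>|\<mu>\<rangle>\<close> in \<open>F(u)\<close> as the sum over \<open>i\<close> of
  \<open>fock_e q1 q2 \<mu> i \<cdot> \<delta>(fock_e_supp q1 q2 u \<mu> i / z)\<close> times \<open>|\<mu> + i\<rangle>\<close>, and similarly for \<open>f(z)\<close>.  In terms of
  components, the coefficient of \<open>z^{-p}\<close> in \<open>\<delta>(x/z)\<close> is \<open>x^p\<close>.  The factors with \<open>j > num_rows \<mu>\<close> in
  the infinite products of \<open>fock_f\<close> and \<open>fock_gamma\<close> are equal to \<open>1\<close> and are omitted.
\<close>

definition fock_e :: "'k::field \<Rightarrow> 'k \<Rightarrow> young \<Rightarrow> nat \<Rightarrow> 'k" where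
  "fock_e q1 q2 \<mu> i =
     (let n = (\<lambda>k. int (row \<mu> k)) in
      (\<Prod>j\<in>{1..<i}.
         (1 - q1 powi (n i - n j) * q2 powi (int i - int j - 1)) *
         (1 - q1 powi (n i - n j + 1) * q2 powi (int i - int j + 1)) /
         ((1 - q1 powi (n i - n j) * q2 powi (int i - int j)) *
          (1 - q1 powi (n i - n j + 1) * q2 powi (int i - int j)))) *
      (1 / (1 - q1)))"

definition fock_e_supp :: "'k::field \<Rightarrow> 'k \<Rightarrow> 'k \<Rightarrow> young \<Rightarrow> nat \<Rightarrow> 'k" where
  "fock_e_supp q1 q2 u \<mu> i = q1 powi (int (row \<mu> i)) * q2 powi (int i - 1) * u"

definition fock_f :: "'k::field \<Rightarrow> 'k \<Rightarrow> 'k \<Rightarrow> young \<Rightarrow> nat \<Rightarrow> 'k" where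
  "fock_f q1 q2 q \<mu> i =
     (let n = (\<lambda>k. int (row \<mu> k)) in
      inverse q *
      ((1 - q1 powi (n (i + 1) - n i)) / (1 - q1 powi (n (i + 1) - n i + 1) * q2)) *
      (\<Prod>j\<in>{i+1..num_rows \<mu>}.
         (1 - q1 powi (n j - n i + 1) * q2 powi (int j - int i + 1)) *
         (1 - q1 powi (n (j + 1) - n i) * q2 powi (int j - int i)) /
         ((1 - q1 powi (n (j + 1) - n i + 1) * q2 powi (int j - int i + 1)) *
          (1 - q1 powi (n j - n i) * q2 powi (int j - int i)))) *
      (1 / (inverse q1 - 1)))"

definition fock_f_supp :: "'k::field \<Rightarrow> 'k \<Rightarrow> 'k \<Rightarrow> young \<Rightarrow> nat \<Rightarrow> 'k" where
  "fock_f_supp q1 q2 u \<mu> i = q1 powi (int (row \<mu> i) - 1) * q2 powi (int i - 1) * u"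

definition fock_gamma ::
    "('k \<Rightarrow> 'f) \<Rightarrow> 'k::field \<Rightarrow> 'k \<Rightarrow> 'k \<Rightarrow> young \<Rightarrow> 'k \<Rightarrow> 'f \<Rightarrow> 'f::field" where
  "fock_gamma \<epsilon> q1 q2 q \<mu> u z =
     (let n = (\<lambda>k. int (row \<mu> k)) in
      \<epsilon> (inverse q) *
      ((z - \<epsilon> (q1 powi (n 1 - 1) * inverse q2 * u)) / (z - \<epsilon> (q1 powi n 1 * u))) *
      (\<Prod>i=1..num_rows \<mu>.
         (z - \<epsilon> (q1 powi n i * q2 powi (int i) * u)) *
         (z - \<epsilon> (q1 powi (n (i + 1) - 1) * q2 powi (int i - 1) * u)) /
         ((z - \<epsilon> (q1 powi n (i + 1) * q2 powi (int i) * u)) *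
          (z - \<epsilon> (q1 powi (n i - 1) * q2 powi (int i - 1) * u)))))"

primrec fock_tensor_basis_action ::
    "'k::field \<Rightarrow> 'k \<Rightarrow> 'k \<Rightarrow> ('r::{finite,linorder} \<Rightarrow> 'k) \<Rightarrow> toroidal_gen
      \<Rightarrow> 'r diagrams \<Rightarrow> ('r diagrams \<Rightarrow>\<^sub>0 'k)" where
  "fock_tensor_basis_action q1 q2 q u (E p) = (\<lambda>\<Lambda>.
     \<Sum>(k, i) | addable (\<Lambda> k) i.
       let x = fock_e_supp q1 q2 (u k) (\<Lambda> k) i in
       Poly_Mapping.single (add_box_at \<Lambda> k i)
         (fock_e q1 q2 (\<Lambda> k) i * x powi p * (\<Prod>l | l < k. fock_gamma id q1 q2 q (\<Lambda> l) (u l) x)))"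
| "fock_tensor_basis_action q1 q2 q u (F p) = (\<lambda>\<Lambda>.
     \<Sum>(k, i) | removable (\<Lambda> k) i.
       let x = fock_f_supp q1 q2 (u k) (\<Lambda> k) i in
       Poly_Mapping.single (remove_box_at \<Lambda> k i)
         (fock_f q1 q2 q (\<Lambda> k) i * x powi p * (\<Prod>l | k < l. fock_gamma id q1 q2 q (\<Lambda> l) (u l) x)))"
| "fock_tensor_basis_action q1 q2 q u (Psi m) = (\<lambda>\<Lambda>.
     Poly_Mapping.single \<Lambda>
       (psi_coeff (\<lambda>z. \<Prod>l\<in>UNIV. fock_gamma fls_const q1 q2 q (\<Lambda> l) (u l) z) m))"
| "fock_tensor_basis_action q1 q2 q u Psi0_inv = (\<lambda>\<Lambda>.
     Poly_Mapping.single \<Lambda>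
       (psi0_inv_coeff (\<lambda>z. \<Prod>l\<in>UNIV. fock_gamma fls_const q1 q2 q (\<Lambda> l) (u l) z)))"

definition fock_tensor_action ::
    "'k::field \<Rightarrow> 'k \<Rightarrow> 'k \<Rightarrow> ('r::{finite,linorder} \<Rightarrow> 'k) \<Rightarrow> toroidal_gen
      \<Rightarrow> ('r diagrams \<Rightarrow>\<^sub>0 'k) \<Rightarrow> ('r diagrams \<Rightarrow>\<^sub>0 'k)" where
  "fock_tensor_action q1 q2 q u g = lin_ext (fock_tensor_basis_action q1 q2 q u g)"

end

theory Submission
  imports Defs
begin

text \<open>
  Both representations have a basis labelled by tuples of Young diagrams on which the currents
  \<open>\<psi>\<^sup>\<plusminus>(z)\<close> are diagonal, with the same eigenvalues (\<open>gieseker_psi_eigenvalue\<close>); the generator \<open>e\<^sub>p\<close> adds a box,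
  \<open>f\<^sub>p\<close> removes one, and in both cases the matrix coefficient depends on \<open>p\<close> only through the \<open>p\<close>-th power of
  the weight \<open>t\<^sub>1\<^sup>i\<^sup>-\<^sup>1 t\<^sub>2\<^sup>j\<^sup>-\<^sup>1 \<chi>\<^sub>a\<^sup>-\<^sup>1\<close> of the box.  Let \<open>C \<Lambda> b\<close> be the coefficient with which \<open>e\<^sub>0\<close> adds \<open>b\<close> to
  \<open>\<Lambda>\<close>, and \<open>D \<Lambda> b\<close> the one with which \<open>f\<^sub>0\<close> takes it off again.  An isomorphism which rescales the basis
  vectors by constants \<open>c \<Lambda>\<close> has to satisfy \<open>c (\<Lambda> + b) * C \<Lambda> b = c \<Lambda> * C' \<Lambda> b\<close>, where \<open>C'\<close> belongs to the
  target.  All \<open>C \<Lambda> b\<close> are nonzero and every tuple arises from the empty one by adding boxes, so this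
  recursion determines \<open>c\<close>, which is the uniqueness.

  For the existence the recursion has to be consistent: its result must not depend on the order in
  which the boxes are added.  Any two orders are connected by exchanges of two consecutive boxes
  (\<open>potential_exists\<close>), so it suffices that \<open>C\<close> and \<open>C'\<close> obey the same exchange rule,
  \<open>C \<Lambda> a * C (\<Lambda> + a) b * P (x\<^sub>b, x\<^sub>a) = - C \<Lambda> b * C (\<Lambda> + b) a * P (x\<^sub>a, x\<^sub>b)\<close> with
  \<open>P (z, w) = (z - t\<^sub>1 w) (z - t\<^sub>2 w) (z - t\<^sub>3 w)\<close>, which is the relation between \<open>e(z) e(w)\<close> and \<open>e(w) e(z)\<close>
  for two boxes that can be added in either order.  Compatibility with \<open>f\<close> comes for free, since
  \<open>C \<Lambda> b * D \<Lambda> b\<close> is in both cases the same multiple of the residue of the eigenvalue of \<open>\<psi>(z)\<close> at \<open>z = x\<^sub>b\<close>.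

  The explicit formulas are thus used for three facts about each side only: the exchange rule,
  \<open>C \<noteq> 0\<close>, and the value of \<open>C * D\<close> (\<open>gieseker_exchange\<close>, \<open>gieseker_C_nonzero\<close>, \<open>gieseker_C_D\<close> and their
  analogues for \<open>F(\<chi>\<^sub>1\<^sup>-\<^sup>1) \<otimes> \<dots> \<otimes> F(\<chi>\<^sub>r\<^sup>-\<^sup>1)\<close>).  All three rest on one principle: the coefficients and the
  eigenvalue are products of factors attached to the rows of the diagrams, and a new box changes the factor of
  its own row alone; for the eigenvalue it does so by the ratio \<open>P (w, z) / P (z, w)\<close> of the defining
  relations, up to sign.

  These facts also imply that both sides are representations at all (\<open>box_module_toroidal_rep\<close>).
  By the consistency just described, \<open>C\<close> may be replaced by any solution of the exchange rule, and there
  is one in which a box contributes a fixed \<open>kernel\<close> for every box already present.  The kernel vanishes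
  if a box is added before one of its predecessors, so that sums over the admissible orders of two or
  three boxes extend to all orders; the quadratic and cubic relations for \<open>e\<close> become identities for
  rational functions.  The relations for \<open>f\<close> follow by transposition.  In \<open>[e(z), f(w)]\<close> the moves of two different
  boxes cancel, and what is left are the residues of the eigenvalue at all of its poles, which by partial
  fractions is the difference of its two expansions.
\<close>

section \<open>Linear maps on a space with a labelled basis\<close>

abbreviation basis_vector :: "'b \<Rightarrow> ('b \<Rightarrow>\<^sub>0 'k::field)" where
  "basis_vector b \<equiv> Poly_Mapping.single b 1"

lemma lookup_scale [simp]: "Poly_Mapping.lookup (scale c v) b = c * Poly_Mapping.lookup v b"
  by (simp add: scale_def map.rep_eq when_def)

lemma scale_single [simp]: "scale c (Poly_Mapping.single b k) = Poly_Mapping.single b (c * k)"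
  by (rule poly_mapping_eqI) (simp add: lookup_single when_def)

lemma scale_scale [simp]: "scale c (scale d v) = scale (c * d) v"
  by (rule poly_mapping_eqI) (simp add: mult.assoc)

lemma scale_zero [simp]: "scale c 0 = 0" "scale 0 v = 0"
  by (rule poly_mapping_eqI, simp)+

lemma scale_add_left: "scale (c + d) v = scale c v + scale d v"
  and scale_add_right: "scale c (v + w) = scale c v + scale c w"
  and scale_diff_left: "scale (c - d) v = scale c v - scale d v"
  and scale_diff_right: "scale c (v - w) = scale c v - scale c w"
  and scale_minus_left: "scale (- c) v = - scale c v"
  and scale_minus_right: "scale c (- v) = - scale c v"
  and scale_one [simp]: "scale 1 v = v"
  by (rule poly_mapping_eqI, simp add: lookup_add lookup_minus algebra_simps)+

lemma scale_sum_right: "scale c (\<Sum>a\<in>S. h a) = (\<Sum>a\<in>S. scale c (h a))"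
  by (rule poly_mapping_eqI) (simp add: lookup_sum sum_distrib_left)

lemma scale_eq_0_iff: "scale c v = 0 \<longleftrightarrow> c = 0 \<or> v = 0"
  by (auto simp: poly_mapping_eq_iff fun_eq_iff)

lemma single_sum: "Poly_Mapping.single b (\<Sum>a\<in>S. h a) = (\<Sum>a\<in>S. Poly_Mapping.single b (h a))"
  by (rule poly_mapping_eqI) (simp add: lookup_sum lookup_single when_def)

lemma vector_space_scale: "vector_space (scale :: 'k::field \<Rightarrow> ('b \<Rightarrow>\<^sub>0 'k) \<Rightarrow> ('b \<Rightarrow>\<^sub>0 'k))"
  by unfold_locales (simp_all add: scale_add_left scale_add_right)

abbreviation lin :: "(('b \<Rightarrow>\<^sub>0 'k::field) \<Rightarrow> ('c \<Rightarrow>\<^sub>0 'k)) \<Rightarrow> bool" where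
  "lin \<equiv> Vector_Spaces.linear scale scale"

lemma lin_iff: "lin f \<longleftrightarrow> (\<forall>v w. f (v + w) = f v + f w) \<and> (\<forall>c v. f (scale c v) = scale c (f v))"
  unfolding Vector_Spaces.linear_def module_hom_def module_hom_axioms_def
  by (auto simp: module_iff_vector_space intro: vector_space_scale)

lemma lin_map_add: "lin f \<Longrightarrow> f (v + w) = f v + f w"
  and lin_map_scale: "lin f \<Longrightarrow> f (scale c v) = scale c (f v)"
  by (simp_all add: lin_iff)

lemma lin_map_diff: "lin f \<Longrightarrow> f (v - w) = f v - f w"
  by (metis add_diff_cancel_right' diff_add_cancel lin_map_add)

lemma lin_map_0: "lin f \<Longrightarrow> f 0 = 0"
  by (metis lin_map_scale scale_zero(2))

lemma lin_map_sum: "lin f \<Longrightarrow> f (\<Sum>a\<in>S. h a) = (\<Sum>a\<in>S. f (h a))"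
  by (induction S rule: infinite_finite_induct) (simp_all add: lin_map_0 lin_map_add)

lemma lin_map_single: "lin f \<Longrightarrow> f (Poly_Mapping.single b k) = scale k (f (basis_vector b))"
  by (metis lin_map_scale mult.right_neutral scale_single)

lemma lin_intros:
  shows lin_zero: "lin (\<lambda>v. 0)"
    and lin_ident: "lin (\<lambda>v. v)"
    and lin_comp: "lin f' \<Longrightarrow> lin g' \<Longrightarrow> lin (\<lambda>v. f' (g' v))"
    and lin_plus: "lin f \<Longrightarrow> lin g \<Longrightarrow> lin (\<lambda>v. f v + g v)"
    and lin_diff: "lin f \<Longrightarrow> lin g \<Longrightarrow> lin (\<lambda>v. f v - g v)"
    and lin_neg: "lin f \<Longrightarrow> lin (\<lambda>v. - f v)"
    and lin_scale: "lin f \<Longrightarrow> lin (\<lambda>v. scale c (f v))"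
  by (auto simp: lin_iff scale_add_right scale_diff_right scale_minus_right mult.commute)

lemma lin_sum: "(\<And>a. a \<in> S \<Longrightarrow> lin (h a)) \<Longrightarrow> lin (\<lambda>v. \<Sum>a\<in>S. h a v)"
  by (induction S rule: infinite_finite_induct) (simp_all add: lin_zero lin_plus)

lemma poly_mapping_expansion:
  assumes "finite B" "Poly_Mapping.keys v \<subseteq> B"
  shows "v = (\<Sum>b\<in>B. Poly_Mapping.single b (Poly_Mapping.lookup v b))"
proof (rule poly_mapping_eqI)
  fix c
  show "Poly_Mapping.lookup v c =
      Poly_Mapping.lookup (\<Sum>b\<in>B. Poly_Mapping.single b (Poly_Mapping.lookup v b)) c"
    using assms
    by (cases "c \<in> B") (auto simp: lookup_sum lookup_single when_def sum.delta in_keys_iff)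
qed

lemma lin_eqI:
  assumes "lin f" "lin g" "\<And>b. f (basis_vector b) = g (basis_vector b)"
  shows "f v = g v"
proof -
  let ?e = "\<Sum>b\<in>Poly_Mapping.keys v. Poly_Mapping.single b (Poly_Mapping.lookup v b)"
  have "f ?e = g ?e"
    unfolding lin_map_sum[OF assms(1)] lin_map_sum[OF assms(2)]
    by (rule sum.cong[OF refl]) (metis assms lin_map_single)
  moreover have "v = ?e"
    by (rule poly_mapping_expansion) auto
  ultimately show ?thesis by simp
qed

lemma lin_ext_single [simp]: "lin_ext g (Poly_Mapping.single b k) = scale k (g b)"
  by (simp add: lin_ext_def)

lemma lin_lin_ext: "lin (lin_ext g)"
proof -
  have eq: "lin_ext g v = (\<Sum>b\<in>B. scale (Poly_Mapping.lookup v b) (g b))"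
    if "finite B" "Poly_Mapping.keys v \<subseteq> B" for v B
    unfolding lin_ext_def using that
    by (intro sum.mono_neutral_left) (auto simp: in_keys_iff)
  have "lin_ext g (v + w) = lin_ext g v + lin_ext g w" for v w
    using eq[of "Poly_Mapping.keys v \<union> Poly_Mapping.keys w" "v + w"]
      eq[of "Poly_Mapping.keys v \<union> Poly_Mapping.keys w" v]
      eq[of "Poly_Mapping.keys v \<union> Poly_Mapping.keys w" w] Poly_Mapping.keys_add[of v w]
    by (simp add: lookup_add scale_add_left sum.distrib)
  moreover have "lin_ext g (scale c v) = scale c (lin_ext g v)" for c v
  proof -
    have "Poly_Mapping.keys (scale c v) \<subseteq> Poly_Mapping.keys v" by (auto simp: in_keys_iff)
    from eq[OF finite_keys this] show ?thesis
      by (simp add: lin_ext_def scale_sum_right)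
  qed
  ultimately show ?thesis by (simp add: lin_iff)
qed


section \<open>Tuples of diagrams as finite downsets of cells\<close>

text \<open>
  A cell \<open>(l, i, j)\<close> is the box in column \<open>i\<close> and row \<open>j\<close> of the \<open>l\<close>-th diagram.  In contrast to
  the end of a row, a cell is a position that does not move when other boxes are added, so its
  weight is independent of the diagram; this makes orders of adding boxes comparable.
\<close>

type_synonym 'r cell = "'r \<times> nat \<times> nat"

definition in_quadrant :: "'r cell \<Rightarrow> bool" where
  "in_quadrant = (\<lambda>(l, i, j). 1 \<le> i \<and> 1 \<le> j)"

definition precedes :: "'r cell \<Rightarrow> 'r cell \<Rightarrow> bool" where
  "precedes = (\<lambda>(l, i, j) (l', i', j'). l = l' \<and> (i' = i + 1 \<and> j' = j \<or> i' = i \<and> j' = j + 1))"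

definition downset :: "'r cell set \<Rightarrow> bool" where
  "downset S \<longleftrightarrow> finite S \<and>
     (\<forall>b\<in>S. in_quadrant b \<and> (\<forall>c. in_quadrant c \<longrightarrow> precedes c b \<longrightarrow> c \<in> S))"

definition cells :: "'r diagrams \<Rightarrow> 'r cell set" where
  "cells \<Lambda> = {(l, i, j). 1 \<le> i \<and> 1 \<le> j \<and> i \<le> row (\<Lambda> l) j}"

lemma downset_finite: "downset S \<Longrightarrow> finite S"
  and downset_quadrant: "downset S \<Longrightarrow> b \<in> S \<Longrightarrow> in_quadrant b"
  and downset_pred: "downset S \<Longrightarrow> b \<in> S \<Longrightarrow> in_quadrant c \<Longrightarrow> precedes c b \<Longrightarrow> c \<in> S"
  unfolding downset_def by blast+

lemma mem_cells: "(l, i, j) \<in> cells \<Lambda> \<longleftrightarrow> 1 \<le> i \<and> 1 \<le> j \<and> i \<le> row (\<Lambda> l) j"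
  by (simp add: cells_def)

lemma is_diagram_row: "is_diagram (row \<mu>)"
  using row by blast

lemma row_0 [simp]: "row \<mu> 0 = 0"
  using is_diagram_row by (auto simp: is_diagram_def)

lemma row_Suc_le: "1 \<le> j \<Longrightarrow> row \<mu> (Suc j) \<le> row \<mu> j"
  using is_diagram_row by (auto simp: is_diagram_def)

lemma row_antimono: "1 \<le> j \<Longrightarrow> j \<le> k \<Longrightarrow> row \<mu> k \<le> row \<mu> j"
  by (rotate_tac, induction k rule: dec_induct) (auto intro: order_trans[OF row_Suc_le])

lemma row_bound: "\<exists>L. \<forall>k>L. row \<mu> k = 0"
  using is_diagram_row by (auto simp: is_diagram_def)

lemma rows_bound:
  fixes \<Lambda> :: "'r::finite diagrams"
  shows "\<exists>L. \<forall>a. \<forall>k>L. row (\<Lambda> a) k = 0"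
proof -
  have "\<forall>a. \<exists>L. \<forall>k>L. row (\<Lambda> a) k = 0" using row_bound by blast
  then obtain L where L: "\<And>a k. k > L a \<Longrightarrow> row (\<Lambda> a) k = 0"
    by (auto dest!: choice)
  have "L a \<le> Max (range L)" for a by simp
  with L show ?thesis by (meson le_less_trans)
qed

lemma row_Abs_young: "is_diagram f \<Longrightarrow> row (Abs_young f) = f"
  by (simp add: Abs_young_inverse)

lemma downset_cells: "downset (cells (\<Lambda> :: 'r::finite diagrams))"
proof -
  obtain L where L: "\<forall>a. \<forall>k>L. row (\<Lambda> a) k = 0"
    using rows_bound by blast
  have "i \<le> row (\<Lambda> l) 1 \<and> j \<le> L" if "(l, i, j) \<in> cells \<Lambda>" for l i j
  proof -
    have "1 \<le> i" "1 \<le> j" "i \<le> row (\<Lambda> l) j" using that by (auto simp: mem_cells)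
    moreover from this have "\<not> j > L" using L by fastforce
    ultimately show ?thesis
      using row_antimono[of 1 j "\<Lambda> l"] by linarith
  qed
  moreover have "row (\<Lambda> l) 1 \<le> Max (range (\<lambda>l. row (\<Lambda> l) 1))" for l by simp
  ultimately have "i \<le> Max (range (\<lambda>l. row (\<Lambda> l) 1)) \<and> j \<le> L" if "(l, i, j) \<in> cells \<Lambda>" for l i j
    using that le_trans by meson
  then have "cells \<Lambda> \<subseteq> UNIV \<times> {..Max (range (\<lambda>l. row (\<Lambda> l) 1))} \<times> {..L}"
    by auto
  then have "finite (cells \<Lambda>)"
    by (rule finite_subset) auto
  moreover have "c \<in> cells \<Lambda>" if "b \<in> cells \<Lambda>" "in_quadrant c" "precedes c b" for b c
  proof -
    obtain l i j l' i' j' where [simp]: "b = (l, i, j)" "c = (l', i', j')"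
      by (cases b, cases c) auto
    show ?thesis
      using that row_Suc_le[of j' "\<Lambda> l'"] by (auto simp: mem_cells in_quadrant_def precedes_def)
  qed
  ultimately show ?thesis
    by (auto simp: downset_def in_quadrant_def cells_def)
qed

lemma finite_cells [simp]: "finite (cells (\<Lambda> :: 'r::finite diagrams))"
  using downset_cells by (auto simp: downset_def)

lemma cells_inject: "cells \<Lambda> = cells M \<longleftrightarrow> \<Lambda> = M"
proof
  assume eq: "cells \<Lambda> = cells M"
  have "row (\<Lambda> l) j = row (M l) j" for l j
  proof (cases "j = 0")
    case False
    then have "i \<le> row (\<Lambda> l) j \<longleftrightarrow> i \<le> row (M l) j" if "1 \<le> i" for i
      using arg_cong[OF eq, of "\<lambda>S. (l, i, j) \<in> S"] that by (simp add: mem_cells)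
    from this[of "row (\<Lambda> l) j"] this[of "row (M l) j"] show ?thesis
      by linarith
  qed simp
  then show "\<Lambda> = M"
    by (metis ext row_inject)
qed simp

lemma initial_segment_eq:
  fixes A :: "nat set"
  assumes "finite A" "0 \<notin> A" "\<And>i. Suc i \<in> A \<Longrightarrow> 1 \<le> i \<Longrightarrow> i \<in> A"
  shows "A = {1..card A}"
proof (cases "A = {}")
  case False
  have "i \<in> A" if "1 \<le> i" "i \<le> Max A" for i
    using that(2,1)
  proof (induction i rule: inc_induct)
    case base
    show ?case using assms(1) False by (rule Max_in)
  next
    case (step i)
    then have "Suc i \<in> A" by linarith
    then show ?case using step.prems by (rule assms(3))
  qed
  moreover have "1 \<le> i \<and> i \<le> Max A" if "i \<in> A" for i
    using that assms Max_ge[OF assms(1) that] by (cases i) auto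
  ultimately have "A = {1..Max A}" using atLeastAtMost_iff by blast
  then show ?thesis
    using card_atLeastAtMost[of 1 "Max A"] by simp
qed simp

lemma downset_obtains_cells:
  fixes S :: "'r::finite cell set"
  assumes S: "downset S"
  obtains \<Lambda> where "cells \<Lambda> = S"
proof -
  define A where "A l j = {i. (l, i, j) \<in> S}" for l j
  have fin: "finite S" and pred: "\<And>b c. b \<in> S \<Longrightarrow> in_quadrant c \<Longrightarrow> precedes c b \<Longrightarrow> c \<in> S"
    and quad: "\<And>b. b \<in> S \<Longrightarrow> in_quadrant b"
    using S by (auto simp: downset_def)
  have finA: "finite (A l j)" for l j
    by (rule finite_subset[of _ "(fst \<circ> snd) ` S"]) (use fin in \<open>force simp: A_def\<close>)+
  have A: "A l j = {1..card (A l j)}" for l j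
  proof (rule initial_segment_eq[OF finA])
    show "0 \<notin> A l j" using quad by (force simp: A_def in_quadrant_def)
    show "i \<in> A l j" if "Suc i \<in> A l j" "1 \<le> i" for i
      using that pred[of "(l, Suc i, j)" "(l, i, j)"] quad[of "(l, Suc i, j)"]
      by (auto simp: A_def in_quadrant_def precedes_def)
  qed
  have memA: "i \<in> A l j \<longleftrightarrow> 1 \<le> i \<and> i \<le> card (A l j)" for l i j
    using arg_cong[OF A[of l j], of "\<lambda>X. i \<in> X"] unfolding atLeastAtMost_iff .
  have A0: "A l 0 = {}" for l
    using quad by (force simp: A_def in_quadrant_def)
  have dia: "is_diagram (\<lambda>j. card (A l j))" for l
    unfolding is_diagram_def
  proof (intro conjI allI impI)
    show "card (A l 0) = 0" by (simp add: A0)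
    show "card (A l (j + 1)) \<le> card (A l j)" if "1 \<le> j" for j
    proof (rule card_mono[OF finA], rule)
      fix i assume "i \<in> A l (j + 1)"
      then show "i \<in> A l j"
        using that pred[of "(l, i, j + 1)" "(l, i, j)"] quad[of "(l, i, j + 1)"]
        by (auto simp: A_def in_quadrant_def precedes_def)
    qed
    have "finite ((snd \<circ> snd) ` S)" using fin by simp
    then obtain L where L: "\<And>j. j \<in> (snd \<circ> snd) ` S \<Longrightarrow> j \<le> L"
      by (meson finite_nat_set_iff_bounded_le)
    have "A l j = {}" if "L < j" for j
      using L[of j] that by (force simp: A_def image_iff)
    then show "\<exists>L. \<forall>j>L. card (A l j) = 0"
      by (metis card.empty)
  qed
  have "cells (\<lambda>l. Abs_young (\<lambda>j. card (A l j))) = S"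
  proof (intro set_eqI iffI)
    fix b assume "b \<in> cells (\<lambda>l. Abs_young (\<lambda>j. card (A l j)))"
    then obtain l i j where b: "b = (l, i, j)" "1 \<le> i" "i \<le> card (A l j)"
      by (auto simp: cells_def row_Abs_young dia)
    then have "i \<in> A l j" unfolding memA by simp
    then show "b \<in> S" by (simp add: b A_def)
  next
    fix b assume b: "b \<in> S"
    obtain l i j where [simp]: "b = (l, i, j)" by (cases b) auto
    have "i \<in> A l j" using b by (simp add: A_def)
    then have "1 \<le> i \<and> i \<le> card (A l j)" unfolding memA .
    then show "b \<in> cells (\<lambda>l. Abs_young (\<lambda>j. card (A l j)))"
      using quad[OF b] by (simp add: mem_cells row_Abs_young dia in_quadrant_def)
  qed
  then show thesis by (rule that)
qed

definition shape :: "'r cell set \<Rightarrow> 'r diagrams" where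
  "shape S = (THE \<Lambda>. cells \<Lambda> = S)"

lemma shape_cells [simp]: "shape (cells \<Lambda>) = \<Lambda>"
  by (simp add: shape_def cells_inject)

lemma cells_shape: "downset S \<Longrightarrow> cells (shape S) = (S :: 'r::finite cell set)"
  by (metis downset_obtains_cells shape_cells)

definition addables :: "'r diagrams \<Rightarrow> 'r cell set" where
  "addables \<Lambda> = {b. b \<notin> cells \<Lambda> \<and> downset (insert b (cells \<Lambda>))}"

definition removables :: "'r diagrams \<Rightarrow> 'r cell set" where
  "removables \<Lambda> = {b \<in> cells \<Lambda>. downset (cells \<Lambda> - {b})}"

definition plus_cell :: "'r diagrams \<Rightarrow> 'r cell \<Rightarrow> 'r diagrams" where
  "plus_cell \<Lambda> b = shape (insert b (cells \<Lambda>))"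

definition minus_cell :: "'r diagrams \<Rightarrow> 'r cell \<Rightarrow> 'r diagrams" where
  "minus_cell \<Lambda> b = shape (cells \<Lambda> - {b})"

lemma cells_plus_cell [simp]:
  "b \<in> addables \<Lambda> \<Longrightarrow> cells (plus_cell \<Lambda> b) = insert b (cells (\<Lambda> :: 'r::finite diagrams))"
  by (simp add: addables_def plus_cell_def cells_shape)

lemma cells_minus_cell [simp]:
  "b \<in> removables \<Lambda> \<Longrightarrow> cells (minus_cell \<Lambda> b) = cells (\<Lambda> :: 'r::finite diagrams) - {b}"
  by (simp add: removables_def minus_cell_def cells_shape)

lemma removables_plus_cell:
  "b \<in> addables \<Lambda> \<Longrightarrow> b \<in> removables (plus_cell (\<Lambda> :: 'r::finite diagrams) b)"
  using downset_cells[of \<Lambda>] by (auto simp: removables_def addables_def plus_cell_def cells_shape)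

lemma addables_minus_cell:
  "b \<in> removables \<Lambda> \<Longrightarrow> b \<in> addables (minus_cell (\<Lambda> :: 'r::finite diagrams) b)"
  using downset_cells[of \<Lambda>]
  by (auto simp: removables_def addables_def minus_cell_def cells_shape insert_absorb)

lemma minus_plus_cell [simp]: "b \<in> addables \<Lambda> \<Longrightarrow> minus_cell (plus_cell \<Lambda> b) b = (\<Lambda> :: 'r::finite diagrams)"
  by (subst cells_inject[symmetric])
    (use removables_plus_cell[of b \<Lambda>] in \<open>auto simp: addables_def\<close>)

lemma plus_minus_cell [simp]: "b \<in> removables \<Lambda> \<Longrightarrow> plus_cell (minus_cell \<Lambda> b) b = (\<Lambda> :: 'r::finite diagrams)"
  by (subst cells_inject[symmetric])
    (use addables_minus_cell[of b \<Lambda>] in \<open>auto simp: removables_def\<close>)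

lemma plus_cell_inject:
  "b \<in> addables \<Lambda> \<Longrightarrow> c \<in> addables \<Lambda> \<Longrightarrow> plus_cell \<Lambda> b = plus_cell \<Lambda> c \<longleftrightarrow> b = (c :: 'r::finite cell)"
proof
  assume b: "b \<in> addables \<Lambda>" and c: "c \<in> addables \<Lambda>" and "plus_cell \<Lambda> b = plus_cell \<Lambda> c"
  then have "insert b (cells \<Lambda>) = insert c (cells \<Lambda>)"
    by (metis cells_plus_cell)
  then show "b = c" using b by (auto simp: addables_def)
qed simp

subsection \<open>Added boxes as row ends\<close>

lemma is_diagram_fun_upd:
  assumes "is_diagram f" "1 \<le> j" "1 < j \<Longrightarrow> n \<le> f (j - 1)" "f (j + 1) \<le> n"
  shows "is_diagram (f(j := n))"
  unfolding is_diagram_def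
proof (intro conjI allI impI)
  show "(f(j := n)) 0 = 0" using assms(1,2) by (auto simp: is_diagram_def)
  show "(f(j := n)) (i + 1) \<le> (f(j := n)) i" if "1 \<le> i" for i
  proof (cases "i + 1 = j")
    case True
    then have "j - 1 = i" "1 < j" using that by linarith+
    with assms(3) True show ?thesis by auto
  next
    case False
    have "f (i + 1) \<le> f i" using assms(1) that by (auto simp: is_diagram_def)
    with False assms(4) show ?thesis by auto
  qed
  obtain L where "\<forall>i>L. f i = 0" using assms(1) by (auto simp: is_diagram_def)
  then have "\<forall>i>max L j. (f(j := n)) i = 0" by auto
  then show "\<exists>L. \<forall>i>L. (f(j := n)) i = 0" by blast
qed

lemma cells_add_box_at:
  assumes "addable (\<Lambda> l) j"
  shows "cells (add_box_at \<Lambda> l j) = insert (l, row (\<Lambda> l) j + 1, j) (cells \<Lambda>)"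
proof -
  have "j \<noteq> 0"
    using assms by (intro notI) (auto simp: addable_def is_diagram_def)
  then show ?thesis
    using assms
    by (auto simp: cells_def add_box_at_def add_box_def addable_def row_Abs_young split: if_splits)
qed

lemma cells_remove_box_at:
  assumes "removable (\<Lambda> l) j"
  shows "cells (remove_box_at \<Lambda> l j) = cells \<Lambda> - {(l, row (\<Lambda> l) j, j)}"
  using assms
  by (auto simp: cells_def remove_box_at_def remove_box_def removable_def row_Abs_young split: if_splits)

lemma addables_iff:
  fixes \<Lambda> :: "'r::finite diagrams"
  shows "(l, i, j) \<in> addables \<Lambda> \<longleftrightarrow> i = row (\<Lambda> l) j + 1 \<and> addable (\<Lambda> l) j"
proof
  assume b: "(l, i, j) \<in> addables \<Lambda>"
  then have new: "(l, i, j) \<notin> cells \<Lambda>" and d: "downset (insert (l, i, j) (cells \<Lambda>))"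
    by (auto simp: addables_def)
  have ij: "1 \<le> i" "1 \<le> j"
    using d by (auto simp: downset_def in_quadrant_def)
  have pred: "c \<in> cells \<Lambda>" if "in_quadrant c" "precedes c (l, i, j)" for c
    using d that by (auto simp: downset_def precedes_def)
  have i: "i = row (\<Lambda> l) j + 1"
  proof (rule ccontr)
    assume "i \<noteq> row (\<Lambda> l) j + 1"
    then have "row (\<Lambda> l) j + 1 < i" using new ij by (simp add: mem_cells)
    moreover from this have "(l, i - 1, j) \<in> cells \<Lambda>"
      using pred[of "(l, i - 1, j)"] ij by (auto simp: precedes_def in_quadrant_def)
    ultimately show False unfolding mem_cells by linarith
  qed
  have "row (\<Lambda> l) j + 1 \<le> row (\<Lambda> l) (j - 1)" if "1 < j"
    using pred[of "(l, i, j - 1)"] ij that i by (auto simp: precedes_def in_quadrant_def mem_cells)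
  moreover have "row (\<Lambda> l) (j + 1) \<le> row (\<Lambda> l) j + 1"
    using row_Suc_le[OF ij(2), of "\<Lambda> l"] by simp
  ultimately have "is_diagram ((row (\<Lambda> l))(j := row (\<Lambda> l) j + 1))"
    using ij by (intro is_diagram_fun_upd is_diagram_row)
  then show "i = row (\<Lambda> l) j + 1 \<and> addable (\<Lambda> l) j"
    using i by (simp add: addable_def)
next
  assume "i = row (\<Lambda> l) j + 1 \<and> addable (\<Lambda> l) j"
  then show "(l, i, j) \<in> addables \<Lambda>"
    using cells_add_box_at[of \<Lambda> l j] downset_cells[of "add_box_at \<Lambda> l j"]
    by (auto simp: addables_def mem_cells)
qed

lemma removables_iff:
  fixes \<Lambda> :: "'r::finite diagrams"
  shows "(l, i, j) \<in> removables \<Lambda> \<longleftrightarrow> i = row (\<Lambda> l) j \<and> removable (\<Lambda> l) j"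
proof
  assume b: "(l, i, j) \<in> removables \<Lambda>"
  then have old: "(l, i, j) \<in> cells \<Lambda>" and d: "downset (cells \<Lambda> - {(l, i, j)})"
    by (auto simp: removables_def)
  have ij: "1 \<le> i" "1 \<le> j" "i \<le> row (\<Lambda> l) j"
    using old by (auto simp: mem_cells)
  have succ: "c \<notin> cells \<Lambda>" if "precedes (l, i, j) c" for c
  proof
    assume "c \<in> cells \<Lambda>"
    then have "c \<in> cells \<Lambda> - {(l, i, j)}"
      using that by (auto simp: precedes_def)
    from downset_pred[OF d this _ that] show False
      using ij by (simp add: in_quadrant_def)
  qed
  have i: "i = row (\<Lambda> l) j"
    using succ[of "(l, i + 1, j)"] ij by (auto simp: precedes_def mem_cells)
  have "row (\<Lambda> l) (j + 1) \<le> row (\<Lambda> l) j - 1"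
    using succ[of "(l, i, j + 1)"] ij i by (auto simp: precedes_def mem_cells)
  moreover have "row (\<Lambda> l) j - 1 \<le> row (\<Lambda> l) (j - 1)" if "1 < j"
    using that row_antimono[of "j - 1" j "\<Lambda> l"] by linarith
  ultimately have "is_diagram ((row (\<Lambda> l))(j := row (\<Lambda> l) j - 1))"
    using ij by (intro is_diagram_fun_upd is_diagram_row)
  then show "i = row (\<Lambda> l) j \<and> removable (\<Lambda> l) j"
    using i ij by (simp add: removable_def)
next
  assume a: "i = row (\<Lambda> l) j \<and> removable (\<Lambda> l) j"
  then have "1 \<le> j" by (cases j) (auto simp: removable_def)
  with a show "(l, i, j) \<in> removables \<Lambda>"
    using cells_remove_box_at[of \<Lambda> l j] downset_cells[of "remove_box_at \<Lambda> l j"]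
    by (auto simp: removables_def mem_cells removable_def)
qed

lemma plus_cell_eq: "addable (\<Lambda> l) j \<Longrightarrow> plus_cell \<Lambda> (l, row (\<Lambda> l) j + 1, j) = add_box_at \<Lambda> l j"
  by (metis cells_add_box_at plus_cell_def shape_cells)

lemma minus_cell_eq: "removable (\<Lambda> l) j \<Longrightarrow> minus_cell \<Lambda> (l, row (\<Lambda> l) j, j) = remove_box_at \<Lambda> l j"
  by (metis cells_remove_box_at minus_cell_def shape_cells)

lemma row_plus_cell:
  assumes "(l, i, j) \<in> addables (\<Lambda> :: 'r::finite diagrams)"
  shows "row (plus_cell \<Lambda> (l, i, j) a) k = (if a = l \<and> k = j then row (\<Lambda> l) j + 1 else row (\<Lambda> a) k)"
proof -
  have i: "i = row (\<Lambda> l) j + 1" "addable (\<Lambda> l) j" using assms by (auto simp: addables_iff)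
  then show ?thesis
    unfolding i(1) plus_cell_eq[of \<Lambda> l j, OF i(2)]
    by (auto simp: add_box_at_def add_box_def addable_def row_Abs_young)
qed

lemma sum_addables:
  fixes \<Lambda> :: "'r::finite diagrams"
  shows "(\<Sum>(l, j) | addable (\<Lambda> l) j. h l j) = (\<Sum>(l, i, j)\<in>addables \<Lambda>. h l j)"
  by (rule sum.reindex_bij_witness[where i = "\<lambda>(l, i, j). (l, j)" and j = "\<lambda>(l, j). (l, row (\<Lambda> l) j + 1, j)"])
    (auto simp: addables_iff)

lemma sum_removables:
  fixes \<Lambda> :: "'r::finite diagrams"
  shows "(\<Sum>(l, j) | removable (\<Lambda> l) j. h l j) = (\<Sum>(l, i, j)\<in>removables \<Lambda>. h l j)"
  by (rule sum.reindex_bij_witness[where i = "\<lambda>(l, i, j). (l, j)" and j = "\<lambda>(l, j). (l, row (\<Lambda> l) j, j)"])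
    (auto simp: removables_iff)

lemma finite_removables [simp]: "finite (removables (\<Lambda> :: 'r::finite diagrams))"
  by (simp add: removables_def)

lemma addable_le:
  assumes "addable \<mu> j" and L: "\<forall>k>L. row \<mu> k = 0"
  shows "j \<le> L + 1"
proof (rule ccontr)
  assume j: "\<not> j \<le> L + 1"
  define m where "m = j - 1"
  have m: "j = m + 1" "L < m" using j by (auto simp: m_def)
  have "is_diagram ((row \<mu>)(j := row \<mu> j + 1))" using assms(1) by (simp add: addable_def)
  then have "row \<mu> j + 1 \<le> row \<mu> m"
    using m unfolding is_diagram_def by (auto dest!: spec[of _ m] split: if_splits)
  then show False using L m by simp
qed

lemma finite_addables [simp]: "finite (addables (\<Lambda> :: 'r::finite diagrams))"
proof -
  obtain L where L: "\<forall>a. \<forall>k>L. row (\<Lambda> a) k = 0"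
    using rows_bound by blast
  have "addables \<Lambda> \<subseteq> (\<lambda>(l, j). (l, row (\<Lambda> l) j + 1, j)) ` (UNIV \<times> {..L + 1})"
    using addable_le L by (fastforce simp: addables_iff image_iff)
  then show ?thesis by (rule finite_subset) auto
qed

section \<open>Induction on diagrams\<close>

lemma downset_Un: "downset S \<Longrightarrow> downset T \<Longrightarrow> downset (S \<union> T)"
  unfolding downset_def by blast

lemma downset_Int: "downset S \<Longrightarrow> downset T \<Longrightarrow> downset (S \<inter> T)"
  unfolding downset_def by blast

lemma cells_empty [simp]: "cells (\<lambda>_. empty_diagram) = {}"
  by (auto simp: cells_def empty_diagram_def row_Abs_young is_diagram_def)

lemma cells_eq_empty_iff: "cells \<Lambda> = {} \<longleftrightarrow> \<Lambda> = (\<lambda>_. empty_diagram)"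
  using cells_inject[of \<Lambda> "\<lambda>_. empty_diagram"] by simp

lemma addables_notin: "b \<in> addables \<Lambda> \<Longrightarrow> b \<notin> cells \<Lambda>"
  by (simp add: addables_def)

lemma removables_in: "b \<in> removables \<Lambda> \<Longrightarrow> b \<in> cells \<Lambda>"
  by (simp add: removables_def)

lemma addables_quadrant: "b \<in> addables \<Lambda> \<Longrightarrow> in_quadrant b"
  by (auto simp: addables_def downset_def)

lemma cells_quadrant: "b \<in> cells \<Lambda> \<Longrightarrow> in_quadrant b"
  by (auto simp: cells_def in_quadrant_def)

lemma addables_plus_cell:
  fixes \<Lambda> :: "'r::finite diagrams"
  assumes "a \<in> addables \<Lambda>" "b \<in> addables \<Lambda>" "a \<noteq> b"
  shows "b \<in> addables (plus_cell \<Lambda> a)"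
proof -
  have "downset (insert a (cells \<Lambda>) \<union> insert b (cells \<Lambda>))"
    using assms by (intro downset_Un) (auto simp: addables_def)
  also have "insert a (cells \<Lambda>) \<union> insert b (cells \<Lambda>) = insert b (insert a (cells \<Lambda>))" by blast
  finally show ?thesis
    using assms by (simp add: addables_def[of "plus_cell \<Lambda> a"] addables_notin)
qed

lemma plus_cell_commute:
  fixes \<Lambda> :: "'r::finite diagrams"
  assumes "a \<in> addables \<Lambda>" "b \<in> addables \<Lambda>" "a \<noteq> b"
  shows "plus_cell (plus_cell \<Lambda> a) b = plus_cell (plus_cell \<Lambda> b) a"
  using assms addables_plus_cell[of a \<Lambda> b] addables_plus_cell[of b \<Lambda> a]
  by (subst cells_inject[symmetric]) (simp add: insert_commute)

lemma removables_minus_cell: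
  fixes \<Lambda> :: "'r::finite diagrams"
  assumes "a \<in> removables \<Lambda>" "b \<in> removables \<Lambda>" "a \<noteq> b"
  shows "b \<in> removables (minus_cell \<Lambda> a)"
proof -
  have "downset ((cells \<Lambda> - {a}) \<inter> (cells \<Lambda> - {b}))"
    using assms by (intro downset_Int) (auto simp: removables_def)
  also have "(cells \<Lambda> - {a}) \<inter> (cells \<Lambda> - {b}) = cells \<Lambda> - {a} - {b}" by blast
  finally show ?thesis
    using assms by (simp add: removables_def[of "minus_cell \<Lambda> a"] removables_in)
qed

lemma ex_removable:
  fixes \<Lambda> :: "'r::finite diagrams"
  assumes "cells \<Lambda> \<noteq> {}"
  obtains b where "b \<in> removables \<Lambda>"
proof -
  define h where "h = (\<lambda>(l :: 'r, i :: nat, j :: nat). i + j)"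
  have "Max (h ` cells \<Lambda>) \<in> h ` cells \<Lambda>" using assms by (intro Max_in) auto
  then obtain b where b: "b \<in> cells \<Lambda>" "h b = Max (h ` cells \<Lambda>)"
    by force
  have "h c \<le> h b" if "c \<in> cells \<Lambda>" for c
    using that b by simp
  moreover have "h c < h d" if "precedes c d" for c d
    using that by (auto simp: precedes_def h_def split: prod.splits)
  ultimately have "\<not> precedes b c" if "c \<in> cells \<Lambda>" for c
    using that by (meson linorder_not_le)
  then have "downset (cells \<Lambda> - {b})"
    using downset_cells[of \<Lambda>] unfolding downset_def by blast
  then show thesis using b that by (simp add: removables_def)
qed

lemma diagrams_induct [case_names empty plus]:
  fixes \<Lambda> :: "'r::finite diagrams"
  assumes "Q (\<lambda>_. empty_diagram)"
    and "\<And>\<Lambda> b. b \<in> addables \<Lambda> \<Longrightarrow> Q \<Lambda> \<Longrightarrow> Q (plus_cell \<Lambda> b)"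
  shows "Q \<Lambda>"
proof (induction "card (cells \<Lambda>)" arbitrary: \<Lambda>)
  case 0
  then have "cells \<Lambda> = {}" by simp
  then show ?case using assms(1) by (simp add: cells_eq_empty_iff)
next
  case (Suc n)
  then have "cells \<Lambda> \<noteq> {}" by auto
  then obtain b where b: "b \<in> removables \<Lambda>" by (rule ex_removable)
  have "card (cells (minus_cell \<Lambda> b)) = n"
    using Suc(2) b removables_in[OF b] by simp
  then have "Q (minus_cell \<Lambda> b)" using Suc(1) by blast
  from assms(2)[OF addables_minus_cell[OF b] this] show ?case
    using b by simp
qed

text \<open>
  A function on the edges of the graph of diagrams is multiplicatively exact as soon as it is
  exact on the squares \<open>\<Lambda> \<subset> \<Lambda>+a, \<Lambda>+b \<subset> \<Lambda>+a+b\<close>: two boxes that can be removed from a diagram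
  can be removed in either order, so that any two ways of building up a diagram are connected
  through such squares.
\<close>

inductive path_product :: "('r diagrams \<Rightarrow> 'r cell \<Rightarrow> 'k::field) \<Rightarrow> 'r diagrams \<Rightarrow> 'k \<Rightarrow> bool" for R where
  path_empty: "path_product R (\<lambda>_. empty_diagram) 1"
| path_plus: "path_product R \<Lambda> x \<Longrightarrow> b \<in> addables \<Lambda> \<Longrightarrow> path_product R (plus_cell \<Lambda> b) (x * R \<Lambda> b)"

lemma path_product_ex: "\<exists>x. path_product R (\<Lambda> :: 'r::finite diagrams) x"
  by (induction \<Lambda> rule: diagrams_induct) (blast intro: path_product.intros)+

lemma path_product_unique:
  fixes \<Lambda> :: "'r::finite diagrams"
  assumes square: "\<And>\<Lambda> a b. a \<in> addables \<Lambda> \<Longrightarrow> b \<in> addables \<Lambda> \<Longrightarrow> a \<noteq> b \<Longrightarrow>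
      R \<Lambda> a * R (plus_cell \<Lambda> a) b = R \<Lambda> b * R (plus_cell \<Lambda> b) a"
  assumes "path_product R \<Lambda> x" "path_product R \<Lambda> y"
  shows "x = y"
  using assms(2,3)
proof (induction "card (cells \<Lambda>)" arbitrary: \<Lambda> x y rule: less_induct)
  case less
  from less.prems(1) show ?case
  proof cases
    case path_empty
    from less.prems(2) show ?thesis
      by cases (use path_empty in \<open>auto simp: cells_inject[symmetric]\<close>)
  next
    case x: (path_plus M x' a)
    from less.prems(2) show ?thesis
    proof cases
      case path_empty
      then show ?thesis using x by (auto simp: cells_inject[symmetric])
    next
      case y: (path_plus N y' b)
      have a: "a \<in> removables \<Lambda>" "minus_cell \<Lambda> a = M" and b: "b \<in> removables \<Lambda>" "minus_cell \<Lambda> b = N"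
        using removables_plus_cell[OF x(4)] removables_plus_cell[OF y(4)]
          minus_plus_cell[OF x(4)] minus_plus_cell[OF y(4)] x(1) y(1) by simp_all
      have smaller: "card (cells M) < card (cells \<Lambda>)" "card (cells N) < card (cells \<Lambda>)"
        using cells_minus_cell[OF a(1)] cells_minus_cell[OF b(1)] removables_in[OF a(1)]
          removables_in[OF b(1)] card_Diff1_less[OF finite_cells, of a \<Lambda>]
          card_Diff1_less[OF finite_cells, of b \<Lambda>] unfolding a(2) b(2) by auto
      show ?thesis
      proof (cases "a = b")
        case True
        then have "M = N" using a b by simp
        then show ?thesis
          using less.hyps[OF smaller(1)] x(2,3) y(2,3) True by blast
      next
        case False
        have bM: "b \<in> removables M" and aN: "a \<in> removables N"
          using removables_minus_cell[OF a(1) b(1)] removables_minus_cell[OF b(1) a(1)] a b False by auto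
        define K where "K = minus_cell M b"
        have K: "K = minus_cell N a"
          by (subst cells_inject[symmetric], unfold K_def) (use a b bM aN in auto)
        have "b \<in> addables K" "plus_cell K b = M" "a \<in> addables K" "plus_cell K a = N"
          using addables_minus_cell[OF bM] addables_minus_cell[OF aN] plus_minus_cell[OF bM]
            plus_minus_cell[OF aN] unfolding K[symmetric] K_def[symmetric] by simp_all
        note K = this
        obtain w where w: "path_product R K w" using path_product_ex by blast
        have "x' = w * R K b" "y' = w * R K a"
          using less.hyps[OF smaller(1) x(3)] less.hyps[OF smaller(2) y(3)]
            path_plus[OF w K(1)] path_plus[OF w K(3)] K by auto
        then show ?thesis
          using square[OF K(1) K(3)] False K x y by (simp add: mult.assoc)
      qed
    qed
  qed
qed

lemma potential_exists:
  fixes R :: "'r::finite diagrams \<Rightarrow> 'r cell \<Rightarrow> 'k::field"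
  assumes "\<And>\<Lambda> a b. a \<in> addables \<Lambda> \<Longrightarrow> b \<in> addables \<Lambda> \<Longrightarrow> a \<noteq> b \<Longrightarrow>
      R \<Lambda> a * R (plus_cell \<Lambda> a) b = R \<Lambda> b * R (plus_cell \<Lambda> b) a"
    and nz: "\<And>\<Lambda> b. b \<in> addables \<Lambda> \<Longrightarrow> R \<Lambda> b \<noteq> 0"
  obtains c where "c (\<lambda>_. empty_diagram) = 1" "\<And>\<Lambda>. c \<Lambda> \<noteq> 0"
    "\<And>\<Lambda> b. b \<in> addables \<Lambda> \<Longrightarrow> c (plus_cell \<Lambda> b) = c \<Lambda> * R \<Lambda> b"
proof -
  obtain c where c: "\<And>\<Lambda>. path_product R \<Lambda> (c \<Lambda>)"
    using path_product_ex by metis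
  have unique: "x = y" if "path_product R \<Lambda> x" "path_product R \<Lambda> y" for \<Lambda> x y
    using path_product_unique[where R = R, OF _ that] assms(1) by blast
  have 1: "c (\<lambda>_. empty_diagram) = 1"
    by (rule unique[OF c path_product.path_empty])
  have 2: "c (plus_cell \<Lambda> b) = c \<Lambda> * R \<Lambda> b" if "b \<in> addables \<Lambda>" for \<Lambda> b
    by (rule unique[OF c path_product.path_plus[OF c that]])
  have 3: "c \<Lambda> \<noteq> 0" for \<Lambda>
    by (induction \<Lambda> rule: diagrams_induct) (simp_all add: 1 2 nz)
  show thesis using that 1 2 3 by blast
qed

text \<open>
  The two cells on the way from \<open>(l, i, j)\<close> to \<open>(l, i + 1, j + 1)\<close> have to be added between
  these.  So a cell and its diagonal neighbour are never among three consecutively added cells.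
\<close>

definition diagonal :: "'r cell \<Rightarrow> 'r cell \<Rightarrow> bool" where
  "diagonal = (\<lambda>(l, i, j) (l', i', j'). l' = l \<and> i' = i + 1 \<and> j' = j + 1)"

lemma skew_diagonal_card:
  assumes S: "downset S" "downset (S \<union> D)" "S \<inter> D = {}"
    and cb: "c \<in> D" "b \<in> D" "diagonal c b"
  shows "4 \<le> card D"
proof -
  obtain l i j where [simp]: "c = (l, i, j)" "b = (l, i + 1, j + 1)"
    using cb(3) by (cases c, cases b) (auto simp: diagonal_def)
  have q: "1 \<le> i" "1 \<le> j"
    using downset_quadrant[OF S(2), of c] cb by (auto simp: in_quadrant_def)
  let ?m = "(l, i + 1, j)" and ?n = "(l, i, j + 1)"
  have "?m \<in> S \<union> D" "?n \<in> S \<union> D"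
    using cb(2) q downset_pred[OF S(2), of b ?m] downset_pred[OF S(2), of b ?n]
    by (auto simp: in_quadrant_def precedes_def)
  moreover have "c \<notin> S" using S(3) cb by blast
  then have "?m \<notin> S" "?n \<notin> S"
    using downset_pred[OF S(1), of _ c] q by (auto simp: in_quadrant_def precedes_def)
  ultimately have "{c, b, ?m, ?n} \<subseteq> D" using cb by blast
  moreover have "finite D" using downset_finite[OF S(2)] by simp
  ultimately have "card {c, b, ?m, ?n} \<le> card D" by (rule card_mono[rotated])
  then show ?thesis by simp
qed


section \<open>Weights and the exchange kernel\<close>

locale toroidal_parameters =
  fixes t1 t2 t :: "'k::field" and \<chi> :: "'r::{finite,linorder} \<Rightarrow> 'k"
  assumes t1_nonzero [simp]: "t1 \<noteq> 0" and t2_nonzero [simp]: "t2 \<noteq> 0" and t_nonzero [simp]: "t \<noteq> 0"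
    and chi_nonzero [simp]: "\<chi> a \<noteq> 0"
    and t_square: "t ^ 2 = inverse (t1 * t2)"
    and monomials_distinct:
      "t1 powi i * t2 powi j * inverse (\<chi> a) = t1 powi i' * t2 powi j' * inverse (\<chi> a') \<Longrightarrow>
         i = i' \<and> j = j' \<and> a = a'"
    and six_nonzero: "(6 :: 'k) \<noteq> 0"
begin

definition mon :: "int \<Rightarrow> int \<Rightarrow> 'r \<Rightarrow> 'k" where
  "mon i j a = t1 powi i * t2 powi j * inverse (\<chi> a)"

lemma mon_eq_iff [simp]: "mon i j a = mon i' j' a' \<longleftrightarrow> i = i' \<and> j = j' \<and> a = a'"
  using monomials_distinct by (auto simp: mon_def)

lemma mon_nonzero [simp]: "mon i j a \<noteq> 0"
  by (simp add: mon_def)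

lemma t1_mon: "t1 * mon i j a = mon (i + 1) j a"
  and t2_mon: "t2 * mon i j a = mon i (j + 1) a"
  by (simp_all add: mon_def power_int_add)

definition t3 :: 'k where "t3 = inverse (t1 * t2)"

lemma t3_nonzero [simp]: "t3 \<noteq> 0"
  by (simp add: t3_def)

lemma t_product: "t1 * t2 * t3 = 1"
  by (simp add: t3_def field_simps)

lemma t3_mon: "t3 * mon i j a = mon (i - 1) (j - 1) a"
  by (simp add: mon_def power_int_diff t3_def field_simps)

definition weight :: "'r cell \<Rightarrow> 'k" where
  "weight = (\<lambda>(l, i, j). mon (int i - 1) (int j - 1) l)"

lemma weight_nonzero [simp]: "weight b \<noteq> 0"
  by (simp add: weight_def split: prod.splits)

lemma weight_eq_iff [simp]: "weight b = weight c \<longleftrightarrow> b = c"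
  by (auto simp: weight_def split: prod.splits)

lemma weight_precedes: "precedes c b \<longleftrightarrow> weight b = t1 * weight c \<or> weight b = t2 * weight c"
  by (auto simp: weight_def precedes_def t1_mon t2_mon split: prod.splits)

lemma weight_diagonal: "weight c = t3 * weight b \<longleftrightarrow> diagonal c b"
  by (auto simp: weight_def diagonal_def t3_mon split: prod.splits)

text \<open>The polynomial of the quadratic relations.\<close>

definition zw_poly :: "'k \<Rightarrow> 'k \<Rightarrow> 'k" where
  "zw_poly z w = (z - t1 * w) * (z - t2 * w) * (z - t3 * w)"

text \<open>
  Up to a symmetric factor this is \<open>zw_poly x y / (x - y)\<close>, which is why exchanging its arguments
  produces the ratio of the quadratic relations.  The symmetric factor is chosen such that the
  kernel has neither zero nor pole when the cell of weight \<open>x\<close> lies in a diagram to which the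
  cell of weight \<open>y\<close> can be added; the zeros then are exactly the wrong orders of adjacent cells.
\<close>

definition kernel :: "'k \<Rightarrow> 'k \<Rightarrow> 'k" where
  "kernel x y = (x - t1 * y) * (x - t2 * y) / ((x - y) * (y - t3 * x))"

lemma kernel_exchange:
  assumes "x \<noteq> y" "x \<noteq> t3 * y" "y \<noteq> t3 * x"
  shows "kernel x y * zw_poly y x = - (kernel y x * zw_poly x y)"
proof -
  have "x - y \<noteq> 0" "y - x \<noteq> 0" "x - t3 * y \<noteq> 0" "y - t3 * x \<noteq> 0"
    using assms by auto
  moreover have "a / (p * r) * (b * r) = - (b / (q * s) * (a * s))"
    if "p \<noteq> 0" "q = - p" "r \<noteq> 0" "s \<noteq> 0" for a b p q r s :: 'k
    using that by (simp add: field_simps)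
  ultimately show ?thesis
    unfolding kernel_def zw_poly_def
    by (metis minus_diff_eq)
qed

text \<open>
  A solution of the exchange rule in which adding a cell is governed by its interactions with the
  single cells already present.
\<close>

definition free_coeff :: "'r diagrams \<Rightarrow> 'r cell \<Rightarrow> 'k" where
  "free_coeff \<Lambda> b = (\<Prod>c\<in>cells \<Lambda>. kernel (weight c) (weight b))"

lemma free_coeff_plus:
  "a \<in> addables \<Lambda> \<Longrightarrow> free_coeff (plus_cell \<Lambda> a) b = kernel (weight a) (weight b) * free_coeff \<Lambda> b"
  by (simp add: free_coeff_def addables_notin)

lemma kernel_eq_0_iff:
  assumes "b \<noteq> c" "\<not> diagonal c b"
  shows "kernel (weight b) (weight c) = 0 \<longleftrightarrow> precedes c b"
  using assms by (auto simp: kernel_def weight_precedes weight_diagonal)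

lemma addable_not_precedes:
  assumes "b \<in> addables \<Lambda>" "c \<in> cells (\<Lambda> :: 'r diagrams)"
  shows "\<not> precedes b c" "\<not> diagonal b c"
proof -
  have d: "downset (cells \<Lambda>)" by (rule downset_cells)
  have q: "in_quadrant b" and b: "b \<notin> cells \<Lambda>"
    using assms by (auto simp: addables_quadrant addables_notin)
  have p: "\<not> precedes b c" if "c \<in> cells \<Lambda>" for c
    using downset_pred[OF d that q] b by blast
  then show "\<not> precedes b c" using assms(2) .
  show "\<not> diagonal b c"
  proof
    assume "diagonal b c"
    then obtain l i j where bc: "b = (l, i, j)" "c = (l, i + 1, j + 1)"
      by (cases c, cases b) (auto simp: diagonal_def)
    then have "(l, i + 1, j) \<in> cells \<Lambda>"
      using downset_pred[OF d assms(2), of "(l, i + 1, j)"] q by (auto simp: in_quadrant_def precedes_def)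
    then show False using p[of "(l, i + 1, j)"] bc by (auto simp: precedes_def)
  qed
qed

lemma free_coeff_nonzero:
  assumes "b \<in> addables \<Lambda>"
  shows "free_coeff \<Lambda> b \<noteq> 0"
proof -
  have "kernel (weight c) (weight b) \<noteq> 0" if c: "c \<in> cells \<Lambda>" for c
    using kernel_eq_0_iff[of c b] addable_not_precedes[OF assms c] addables_notin[OF assms] c by auto
  then show ?thesis by (auto simp: free_coeff_def)
qed

lemma two_addables:
  fixes \<Lambda> :: "'r diagrams"
  assumes "a \<in> addables \<Lambda>" "b \<in> addables \<Lambda>" "a \<noteq> b"
  shows "\<not> precedes a b" "\<not> diagonal a b"
  using addable_not_precedes[OF addables_plus_cell[OF assms(2,1)], of b] assms
  by simp_all

text \<open>
  This is what the relation between \<open>e(z) e(w)\<close> and \<open>e(w) e(z)\<close> demands of the coefficients on the way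
  from \<open>\<Lambda>\<close> to \<open>\<Lambda> + a + b\<close>, if both orders of adding are possible.
\<close>

definition exchange :: "('r diagrams \<Rightarrow> 'r cell \<Rightarrow> 'k) \<Rightarrow> bool" where
  "exchange C \<longleftrightarrow> (\<forall>\<Lambda>. \<forall>a\<in>addables \<Lambda>. \<forall>b\<in>addables \<Lambda>. a \<noteq> b \<longrightarrow>
     C \<Lambda> a * C (plus_cell \<Lambda> a) b * zw_poly (weight b) (weight a) =
     - (C \<Lambda> b * C (plus_cell \<Lambda> b) a * zw_poly (weight a) (weight b)))"

lemma exchangeD:
  assumes "exchange C" "a \<in> addables \<Lambda>" "b \<in> addables \<Lambda>" "a \<noteq> b"
  shows "C \<Lambda> a * C (plus_cell \<Lambda> a) b * zw_poly (weight b) (weight a) =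
     - (C \<Lambda> b * C (plus_cell \<Lambda> b) a * zw_poly (weight a) (weight b))"
  using assms unfolding exchange_def by blast

lemma zw_poly_nonzero:
  fixes \<Lambda> :: "'r diagrams"
  assumes "a \<in> addables \<Lambda>" "b \<in> addables \<Lambda>" "a \<noteq> b"
  shows "zw_poly (weight b) (weight a) \<noteq> 0"
  using two_addables[OF assms] two_addables[of b \<Lambda> a] assms
  by (auto simp: zw_poly_def weight_precedes weight_diagonal)

lemma exchange_free_coeff: "exchange free_coeff"
  unfolding exchange_def
proof (intro allI ballI impI)
  fix \<Lambda> :: "'r diagrams" and a b assume ab: "a \<in> addables \<Lambda>" "b \<in> addables \<Lambda>" "a \<noteq> b"
  have "kernel (weight a) (weight b) * zw_poly (weight b) (weight a) =
      - (kernel (weight b) (weight a) * zw_poly (weight a) (weight b))"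
    using two_addables[OF ab] two_addables[of b \<Lambda> a] ab
    by (intro kernel_exchange) (auto simp: weight_diagonal)
  then show "free_coeff \<Lambda> a * free_coeff (plus_cell \<Lambda> a) b * zw_poly (weight b) (weight a) =
     - (free_coeff \<Lambda> b * free_coeff (plus_cell \<Lambda> b) a * zw_poly (weight a) (weight b))"
    unfolding free_coeff_plus[OF ab(1)] free_coeff_plus[OF ab(2)] by algebra
qed

text \<open>
  The ratio of two solutions of the exchange rule is a function on the edges of the graph of diagrams,
  and on the squares of this graph the two polynomials cancel from it.  So the ratio is exact, and two
  solutions differ by a rescaling of the basis.
\<close>

lemma exchange_gauge_equivalent:
  assumes C: "exchange C" "\<And>\<Lambda> b. b \<in> addables \<Lambda> \<Longrightarrow> C \<Lambda> b \<noteq> 0"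
    and D: "exchange D" "\<And>\<Lambda> b. b \<in> addables \<Lambda> \<Longrightarrow> D \<Lambda> b \<noteq> 0"
  obtains g where "g (\<lambda>_. empty_diagram) = 1" "\<And>\<Lambda>. g \<Lambda> \<noteq> 0"
    "\<And>\<Lambda> b. b \<in> addables \<Lambda> \<Longrightarrow> g (plus_cell \<Lambda> b) * C \<Lambda> b = g \<Lambda> * D \<Lambda> b"
proof -
  have ratio_eq: "d / c = d' / c'"
    if "d * z = - (d' * w)" "c * z = - (c' * w)" "c \<noteq> 0" "c' \<noteq> 0" "z \<noteq> 0" "w \<noteq> 0" for c c' d d' z w :: 'k
  proof -
    have "(d * c') * (z * w) = (d' * c) * (z * w)"
      using that(1,2) by algebra
    then show ?thesis using that(3-) by (simp add: frac_eq_eq)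
  qed
  have eq: "D \<Lambda> a / C \<Lambda> a * (D (plus_cell \<Lambda> a) b / C (plus_cell \<Lambda> a) b) =
      D \<Lambda> b / C \<Lambda> b * (D (plus_cell \<Lambda> b) a / C (plus_cell \<Lambda> b) a)"
    if ab: "a \<in> addables \<Lambda>" "b \<in> addables \<Lambda>" "a \<noteq> b" for \<Lambda> a b
  proof -
    let ?z = "zw_poly (weight b) (weight a)" and ?w = "zw_poly (weight a) (weight b)"
    have z: "?z \<noteq> 0" and w: "?w \<noteq> 0"
      using zw_poly_nonzero[OF ab] zw_poly_nonzero[of b \<Lambda> a] ab by auto
    have b: "b \<in> addables (plus_cell \<Lambda> a)" and a: "a \<in> addables (plus_cell \<Lambda> b)"
      using addables_plus_cell[of a \<Lambda> b] addables_plus_cell[of b \<Lambda> a] ab by auto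
    have "D \<Lambda> a * D (plus_cell \<Lambda> a) b * ?z = - (D \<Lambda> b * D (plus_cell \<Lambda> b) a * ?w)"
      "C \<Lambda> a * C (plus_cell \<Lambda> a) b * ?z = - (C \<Lambda> b * C (plus_cell \<Lambda> b) a * ?w)"
      by (rule exchangeD[OF D(1) ab], rule exchangeD[OF C(1) ab])
    moreover have "C \<Lambda> a * C (plus_cell \<Lambda> a) b \<noteq> 0" "C \<Lambda> b * C (plus_cell \<Lambda> b) a \<noteq> 0"
      using C(2) ab a b by auto
    ultimately have "(D \<Lambda> a * D (plus_cell \<Lambda> a) b) / (C \<Lambda> a * C (plus_cell \<Lambda> a) b)
        = (D \<Lambda> b * D (plus_cell \<Lambda> b) a) / (C \<Lambda> b * C (plus_cell \<Lambda> b) a)"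
      using z w by (intro ratio_eq)
    then show ?thesis by simp
  qed
  have nz: "D \<Lambda> b / C \<Lambda> b \<noteq> 0" if "b \<in> addables \<Lambda>" for \<Lambda> b
    using C(2) D(2) that by simp
  from potential_exists[of "\<lambda>\<Lambda> b. D \<Lambda> b / C \<Lambda> b", OF eq nz]
  obtain g where g: "g (\<lambda>_. empty_diagram) = 1" "\<And>\<Lambda>. g \<Lambda> \<noteq> 0"
    "\<And>\<Lambda> b. b \<in> addables \<Lambda> \<Longrightarrow> g (plus_cell \<Lambda> b) = g \<Lambda> * (D \<Lambda> b / C \<Lambda> b)"
    by blast
  show thesis
    using g C(2) by (intro that[of g]) auto
qed

text \<open>
  In the product of the coefficients along a chain of diagrams the factors \<open>g\<close> cancel up to those of the
  two ends, and the order of the cells enters through kernels only.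
\<close>

lemma exchange_path_form:
  assumes "exchange C" "\<And>\<Lambda> b. b \<in> addables \<Lambda> \<Longrightarrow> C \<Lambda> b \<noteq> 0"
  obtains g where "\<And>\<Lambda>. g \<Lambda> \<noteq> 0"
    "\<And>\<Lambda> b. b \<in> addables \<Lambda> \<Longrightarrow> C \<Lambda> b = g (plus_cell \<Lambda> b) / g \<Lambda> * free_coeff \<Lambda> b"
proof -
  obtain g where g: "\<And>\<Lambda>. g \<Lambda> \<noteq> 0"
    "\<And>\<Lambda> b. b \<in> addables \<Lambda> \<Longrightarrow> g (plus_cell \<Lambda> b) * free_coeff \<Lambda> b = g \<Lambda> * C \<Lambda> b"
    using exchange_gauge_equivalent[OF exchange_free_coeff free_coeff_nonzero assms] by metis
  show thesis
  proof (rule that[OF g(1)])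
    show "C \<Lambda> b = g (plus_cell \<Lambda> b) / g \<Lambda> * free_coeff \<Lambda> b" if "b \<in> addables \<Lambda>" for \<Lambda> b
      using g(2)[OF that] g(1)[of \<Lambda>] by (simp add: field_simps)
  qed
qed


subsection \<open>The cubic identity\<close>

text \<open>
  With the elementary symmetric functions of \<open>t\<^sub>1, t\<^sub>2, t\<^sub>3\<close> for \<open>a\<close> and \<open>b\<close>, where the product is \<open>1\<close>, the polynomial \<open>p\<close> is
  \<open>zw_poly\<close>.  The identity is the cubic relation over a common denominator, \<open>n u v w / (u * v * w)\<close> being
  the factor that arises from the double commutator.
\<close>

lemma cubic_polynomial_identity:
  fixes x y z a b :: "'f::field"
  defines "p \<equiv> \<lambda>u v. u ^ 3 - a * u ^ 2 * v + b * u * v ^ 2 - v ^ 3"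
  defines "n \<equiv> \<lambda>u v w. v * v * w - u * u * w - w * w * u + v * v * u"
  shows "n x y z * p x y * p x z * p y z - n y x z * p y x * p y z * p x z
   - n x z y * p x z * p x y * p z y + n y z x * p y z * p y x * p z x
   + n z x y * p z x * p z y * p x y - n z y x * p z y * p z x * p y x = 0"
  unfolding p_def n_def by algebra

text \<open>
  The shifts by \<open>1\<close> and \<open>-1\<close> of two of the modes in the double commutator produce ratios of weights.  When
  cells of weights \<open>x, y, z\<close> are added in this order, the four terms of the commutator leave this factor
  after symmetrisation in the modes.
\<close>

definition cubic_factor :: "'k \<Rightarrow> 'k \<Rightarrow> 'k \<Rightarrow> 'k" where
  "cubic_factor x y z = y / x - x / y - z / y + y / z"

definition cubic_kernel :: "'k \<Rightarrow> 'k \<Rightarrow> 'k \<Rightarrow> 'k" where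
  "cubic_kernel x y z = kernel x y * kernel x z * kernel y z"

lemma zw_poly_expand: "zw_poly u v = u ^ 3 - (t1 + t2 + t3) * u ^ 2 * v
    + (t1 * t2 + t1 * t3 + t2 * t3) * u * v ^ 2 - v ^ 3"
  using t_product unfolding zw_poly_def by algebra

text \<open>
  The kernels of all orders have the same denominator up to the sign of the Vandermonde factor, and the
  numerator is the preceding polynomial.
\<close>

lemma cubic_identity:
  assumes "x \<noteq> 0" "y \<noteq> 0" "z \<noteq> 0" "x \<noteq> y" "x \<noteq> z" "y \<noteq> z"
    and "x \<noteq> t3 * y" "y \<noteq> t3 * x" "x \<noteq> t3 * z" "z \<noteq> t3 * x" "y \<noteq> t3 * z" "z \<noteq> t3 * y"
  shows "cubic_factor x y z * cubic_kernel x y z + cubic_factor y x z * cubic_kernel y x z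
    + cubic_factor x z y * cubic_kernel x z y + cubic_factor y z x * cubic_kernel y z x
    + cubic_factor z x y * cubic_kernel z x y + cubic_factor z y x * cubic_kernel z y x = 0"
proof -
  define n where "n u v w = v * v * w - u * u * w - w * w * u + v * v * u" for u v w :: 'k
  define s where "s u v = (u - t3 * v) * (v - t3 * u)" for u v
  have s_sym: "s u v = s v u" for u v by (simp add: s_def)
  have kernel: "kernel u v = zw_poly u v / ((u - v) * s u v)" if "u \<noteq> t3 * v" for u v
    using that by (simp add: kernel_def zw_poly_def s_def)
  have factor: "cubic_factor u v w = n u v w / (u * v * w)" if "u \<noteq> 0" "v \<noteq> 0" "w \<noteq> 0" for u v w
    using that by (simp add: cubic_factor_def n_def field_simps)
  define d where "d = x * y * z * (x - y) * (x - z) * (y - z) * s x y * s x z * s y z"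
  have d: "d \<noteq> 0" using assms by (simp add: d_def s_def)
  note sgn = minus_diff_eq[of y x, symmetric] minus_diff_eq[of z x, symmetric] minus_diff_eq[of z y, symmetric]
  have 1: "cubic_factor x y z * cubic_kernel x y z = n x y z * zw_poly x y * zw_poly x z * zw_poly y z / d"
    and 2: "cubic_factor y x z * cubic_kernel y x z = - (n y x z * zw_poly y x * zw_poly y z * zw_poly x z) / d"
    and 3: "cubic_factor x z y * cubic_kernel x z y = - (n x z y * zw_poly x z * zw_poly x y * zw_poly z y) / d"
    and 4: "cubic_factor y z x * cubic_kernel y z x = n y z x * zw_poly y z * zw_poly y x * zw_poly z x / d"
    and 5: "cubic_factor z x y * cubic_kernel z x y = n z x y * zw_poly z x * zw_poly z y * zw_poly x y / d"
    and 6: "cubic_factor z y x * cubic_kernel z y x = - (n z y x * zw_poly z y * zw_poly z x * zw_poly y x) / d"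
    using assms unfolding cubic_kernel_def d_def
    by (simp_all add: factor kernel s_sym[of y x] s_sym[of z x] s_sym[of z y] sgn(1) sgn(2) sgn(3)
        del: minus_diff_eq) (simp_all add: mult_ac)
  show ?thesis
    unfolding 1 2 3 4 5 6
    unfolding add_divide_distrib[symmetric]
    using cubic_polynomial_identity[of x y z "t1 + t2 + t3" "t1 * t2 + t1 * t3 + t2 * t3"]
    unfolding n_def[symmetric] zw_poly_expand[symmetric] by (simp add: algebra_simps)
qed

end

section \<open>Quadratic and cubic relations for operators that move between basis vectors\<close>

text \<open>
  In the applications \<open>op p\<close> is a current generator \<open>e\<^sub>p\<close>, and \<open>mv s b\<close> arises from the tuple of diagrams \<open>s\<close>
  by adding the cell \<open>b\<close> of weight \<open>w b\<close>.  The mode \<open>p\<close> only enters through the power of the weight.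
\<close>

locale move_operators =
  fixes op :: "int \<Rightarrow> ('s \<Rightarrow>\<^sub>0 'k::field) \<Rightarrow> ('s \<Rightarrow>\<^sub>0 'k)"
    and St :: "'s \<Rightarrow> 'b set" and mv :: "'s \<Rightarrow> 'b \<Rightarrow> 's" and K :: "'s \<Rightarrow> 'b \<Rightarrow> 'k" and w :: "'b \<Rightarrow> 'k"
  assumes lin_op: "lin (op p)"
    and finite_St: "finite (St s)"
    and w_nonzero: "w b \<noteq> 0"
    and op_basis: "op p (basis_vector s) = (\<Sum>b\<in>St s. Poly_Mapping.single (mv s b) (K s b * w b powi p))"
begin

definition chains2 :: "'s \<Rightarrow> ('b \<times> 'b) set" where
  "chains2 s = (SIGMA a:St s. St (mv s a))"

definition chains3 :: "'s \<Rightarrow> ('b \<times> 'b \<times> 'b) set" where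
  "chains3 s = (SIGMA a:St s. chains2 (mv s a))"

lemma finite_chains2: "finite (chains2 s)"
  by (simp add: chains2_def finite_St)

lemma finite_chains3: "finite (chains3 s)"
  by (simp add: chains3_def finite_chains2 finite_St)

lemma op_single: "op p (Poly_Mapping.single s x) =
    (\<Sum>b\<in>St s. Poly_Mapping.single (mv s b) (x * (K s b * w b powi p)))"
  by (subst lin_map_single[OF lin_op]) (simp add: op_basis scale_sum_right)

lemma op_basis_scale: "op p (basis_vector s) = (\<Sum>b\<in>St s. scale (K s b * w b powi p) (basis_vector (mv s b)))"
  by (simp add: op_basis)

lemma op_op_basis: "op p (op q (basis_vector s)) =
    (\<Sum>(a, b)\<in>chains2 s. Poly_Mapping.single (mv (mv s a) b)
       (K s a * K (mv s a) b * (w b powi p * w a powi q)))"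
  unfolding chains2_def
  by (subst sum.Sigma[symmetric])
    (auto simp: finite_St op_basis lin_map_sum[OF lin_op] op_single mult_ac intro!: sum.cong)

lemma op_op_op_basis: "op p (op q (op r (basis_vector s))) =
    (\<Sum>(a, b, c)\<in>chains3 s. Poly_Mapping.single (mv (mv (mv s a) b) c)
       (K s a * K (mv s a) b * K (mv (mv s a) b) c * (w c powi p * w b powi q * w a powi r)))"
proof -
  have "op p (op q (op r (basis_vector s))) =
      (\<Sum>a\<in>St s. scale (K s a * w a powi r) (op p (op q (basis_vector (mv s a)))))"
    by (subst op_basis_scale) (simp only: lin_map_sum[OF lin_op] lin_map_scale[OF lin_op])
  also have "\<dots> = (\<Sum>a\<in>St s. \<Sum>(b, c)\<in>chains2 (mv s a). Poly_Mapping.single (mv (mv (mv s a) b) c)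
       (K s a * K (mv s a) b * K (mv (mv s a) b) c * (w c powi p * w b powi q * w a powi r)))"
    unfolding op_op_basis scale_sum_right by (auto simp: mult_ac intro!: sum.cong)
  also have "\<dots> = (\<Sum>(a, b, c)\<in>chains3 s. Poly_Mapping.single (mv (mv (mv s a) b) c)
       (K s a * K (mv s a) b * K (mv (mv s a) b) c * (w c powi p * w b powi q * w a powi r)))"
    unfolding chains3_def by (subst sum.Sigma) (auto simp: finite_St finite_chains2)
  finally show ?thesis .
qed

text \<open>
  The sums over chains are extended to all orders of the moves, at the cost of vanishing
  coefficients \<open>cf\<close>.  Then they can be reordered.
\<close>

lemma sum_chains2_antisym:
  assumes ord: "finite W" "chains2 s \<subseteq> W" "\<And>a b. (a, b) \<in> W \<Longrightarrow> (b, a) \<in> W"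
    and target: "\<And>a b. (a, b) \<in> chains2 s \<Longrightarrow> mv (mv s a) b = target a b"
      "\<And>a b. (a, b) \<in> W \<Longrightarrow> target a b = target b a"
    and cf: "\<And>a b. (a, b) \<in> chains2 s \<Longrightarrow> K s a * K (mv s a) b = cf a b"
      "\<And>a b. (a, b) \<in> W - chains2 s \<Longrightarrow> cf a b = 0"
    and antisym: "\<And>a b. (a, b) \<in> W \<Longrightarrow> cf a b * p (w b) (w a) = - (cf b a * p (w a) (w b))"
  shows "(\<Sum>(a, b)\<in>chains2 s. Poly_Mapping.single (mv (mv s a) b)
           (K s a * K (mv s a) b * p (w b) (w a) * (w b powi m * w a powi n))) =
       - (\<Sum>(a, b)\<in>chains2 s. Poly_Mapping.single (mv (mv s a) b)
           (K s a * K (mv s a) b * p (w b) (w a) * (w a powi m * w b powi n)))"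
proof -
  have ext: "(\<Sum>(a, b)\<in>chains2 s. Poly_Mapping.single (mv (mv s a) b)
      (K s a * K (mv s a) b * p (w b) (w a) * h a b)) =
      (\<Sum>(a, b)\<in>W. Poly_Mapping.single (target a b) (cf a b * p (w b) (w a) * h a b))" for h
    by (rule sum.mono_neutral_cong_left) (use ord(1,2) target(1) cf in auto)
  have "(\<Sum>(a, b)\<in>W. Poly_Mapping.single (target a b) (cf a b * p (w b) (w a) * (w b powi m * w a powi n))) =
      (\<Sum>(a, b)\<in>W. Poly_Mapping.single (target b a) (cf b a * p (w a) (w b) * (w a powi m * w b powi n)))"
    by (rule sum.reindex_bij_witness[where i = "\<lambda>(a, b). (b, a)" and j = "\<lambda>(a, b). (b, a)"])
      (use ord(3) in auto)
  also have "\<dots> = (\<Sum>(a, b)\<in>W. - Poly_Mapping.single (target a b) (cf a b * p (w b) (w a) * (w a powi m * w b powi n)))"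
  proof (rule sum.cong[OF refl], clarify)
    fix a b assume ab: "(a, b) \<in> W"
    show "Poly_Mapping.single (target b a) (cf b a * p (w a) (w b) * (w a powi m * w b powi n)) =
        - Poly_Mapping.single (target a b) (cf a b * p (w b) (w a) * (w a powi m * w b powi n))"
      unfolding antisym[OF ab] target(2)[OF ab] by (simp add: single_uminus)
  qed
  finally show ?thesis
    unfolding ext by (simp add: case_prod_unfold sum_negf)
qed

text \<open>
  Each of the six reorderings leaves the total sum invariant, so six times the sum is the sum of the
  expressions assumed to vanish.
\<close>

lemma sum_chains3_eq_0:
  assumes ord: "finite W" "chains3 s \<subseteq> W"
      "\<And>a b c. (a, b, c) \<in> W \<Longrightarrow> (b, a, c) \<in> W" "\<And>a b c. (a, b, c) \<in> W \<Longrightarrow> (a, c, b) \<in> W"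
    and target: "\<And>a b c. (a, b, c) \<in> chains3 s \<Longrightarrow> mv (mv (mv s a) b) c = target a b c"
      "\<And>a b c. target a b c = target b a c" "\<And>a b c. target a b c = target a c b"
    and cf: "\<And>a b c. (a, b, c) \<in> chains3 s \<Longrightarrow> K s a * K (mv s a) b * K (mv (mv s a) b) c = cf a b c"
      "\<And>a b c. (a, b, c) \<in> W - chains3 s \<Longrightarrow> cf a b c = 0"
    and h: "\<And>a b c. h a b c = h b a c" "\<And>a b c. h a b c = h a c b"
    and six: "(6 :: 'k) \<noteq> 0"
    and vanish: "\<And>a b c. (a, b, c) \<in> W \<Longrightarrow> cf a b c * k a b c + cf b a c * k b a c + cf a c b * k a c b
      + cf b c a * k b c a + cf c a b * k c a b + cf c b a * k c b a = 0"
  shows "(\<Sum>(a, b, c)\<in>chains3 s. Poly_Mapping.single (mv (mv (mv s a) b) c)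
           (K s a * K (mv s a) b * K (mv (mv s a) b) c * (h a b c * k a b c))) = (0 :: 's \<Rightarrow>\<^sub>0 'k)"
proof -
  define g where "g a b c = Poly_Mapping.single (target a b c) (cf a b c * (h a b c * k a b c))" for a b c
  let ?S = "\<lambda>g. \<Sum>(a, b, c)\<in>W. (g a b c :: 's \<Rightarrow>\<^sub>0 'k)"
  have ext: "(\<Sum>(a, b, c)\<in>chains3 s. Poly_Mapping.single (mv (mv (mv s a) b) c)
           (K s a * K (mv s a) b * K (mv (mv s a) b) c * (h a b c * k a b c))) = ?S g"
    unfolding g_def by (rule sum.mono_neutral_cong_left) (use ord(1,2) target(1) cf in auto)
  have swap1: "?S (\<lambda>a b c. f b a c) = ?S f" for f
    by (rule sum.reindex_bij_witness[where i = "\<lambda>(a, b, c). (b, a, c)" and j = "\<lambda>(a, b, c). (b, a, c)"])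
      (use ord(3) in auto)
  have swap2: "?S (\<lambda>a b c. f a c b) = ?S f" for f
    by (rule sum.reindex_bij_witness[where i = "\<lambda>(a, b, c). (a, c, b)" and j = "\<lambda>(a, b, c). (a, c, b)"])
      (use ord(4) in auto)
  have "?S (\<lambda>a b c. g b c a) = ?S g" "?S (\<lambda>a b c. g c a b) = ?S g" "?S (\<lambda>a b c. g c b a) = ?S g"
    by (rule swap1[of "\<lambda>a b c. g a c b", THEN trans, OF swap2]
        swap2[of "\<lambda>a b c. g b a c", THEN trans, OF swap1]
        swap1[of "\<lambda>a b c. g c a b", THEN trans, OF swap2[of "\<lambda>a b c. g b a c", THEN trans, OF swap1]])+
  then have "?S g + ?S g + ?S g + ?S g + ?S g + ?S g =
      ?S g + ?S (\<lambda>a b c. g b a c) + ?S (\<lambda>a b c. g a c b) + ?S (\<lambda>a b c. g b c a)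
      + ?S (\<lambda>a b c. g c a b) + ?S (\<lambda>a b c. g c b a)"
    by (simp only: swap1[of g] swap2[of g])
  also have "\<dots> = (\<Sum>(a, b, c)\<in>W. g a b c + g b a c + g a c b + g b c a + g c a b + g c b a)"
    by (simp add: sum.distrib case_prod_unfold)
  also have "\<dots> = (\<Sum>(a, b, c)\<in>W. 0)"
  proof (rule sum.cong[OF refl], clarify)
    fix a b c assume abc: "(a, b, c) \<in> W"
    let ?t = "target a b c" and ?h = "h a b c"
    have sym: "target b a c = ?t" "target a c b = ?t" "target b c a = ?t" "target c a b = ?t" "target c b a = ?t"
      "h b a c = ?h" "h a c b = ?h" "h b c a = ?h" "h c a b = ?h" "h c b a = ?h"
    proof -
      show 1: "target b a c = ?t" "target a c b = ?t" "h b a c = ?h" "h a c b = ?h"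
        by (rule target(2)[symmetric] target(3)[symmetric] h(1)[symmetric] h(2)[symmetric])+
      show 2: "target b c a = ?t" "target c a b = ?t" "h b c a = ?h" "h c a b = ?h"
        using 1 target(3)[of b a c] target(2)[of a c b] h(2)[of b a c] h(1)[of a c b] by simp_all
      show "target c b a = ?t" "h c b a = ?h"
        using 2 target(2)[of b c a] h(1)[of b c a] by simp_all
    qed
    have "g a b c + g b a c + g a c b + g b c a + g c a b + g c b a =
        Poly_Mapping.single ?t (?h * (cf a b c * k a b c + cf b a c * k b a c + cf a c b * k a c b
      + cf b c a * k b c a + cf c a b * k c a b + cf c b a * k c b a))"
      unfolding g_def sym single_add[symmetric] by (simp add: algebra_simps)
    then show "g a b c + g b a c + g a c b + g b c a + g c a b + g c b a = 0"
      unfolding vanish[OF abc] by simp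
  qed
  finally have "scale 6 (?S g) = 0"
    by (simp add: poly_mapping_eq_iff fun_eq_iff lookup_add)
  then show ?thesis
    unfolding ext using six by (simp add: scale_eq_0_iff)
qed

lemma triple_commutator_basis:
  "op_commutator (op p) (op_commutator (op (q + 1)) (op (r - 1))) (basis_vector s) =
    (\<Sum>(a, b, c)\<in>chains3 s. Poly_Mapping.single (mv (mv (mv s a) b) c)
       (K s a * K (mv s a) b * K (mv (mv s a) b) c *
         (w b / w a * (w c powi p * w b powi q * w a powi r)
        - w a / w b * (w c powi p * w b powi r * w a powi q)
        - w c / w b * (w c powi q * w b powi r * w a powi p)
        + w b / w c * (w c powi r * w b powi q * w a powi p))))"
proof -
  have expand: "op_commutator (op p) (op_commutator (op (q + 1)) (op (r - 1))) (basis_vector s) =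
      op p (op (q + 1) (op (r - 1) (basis_vector s))) - op p (op (r - 1) (op (q + 1) (basis_vector s)))
      - op (q + 1) (op (r - 1) (op p (basis_vector s))) + op (r - 1) (op (q + 1) (op p (basis_vector s)))"
    by (simp add: op_commutator_def lin_map_diff[OF lin_op])
  show ?thesis
    unfolding expand op_op_op_basis case_prod_unfold sum_subtractf[symmetric] sum.distrib[symmetric]
      single_diff[symmetric] single_add[symmetric]
    by (intro sum.cong refl arg_cong2[where f = Poly_Mapping.single])
      (simp add: power_int_add power_int_diff w_nonzero field_simps)
qed

end

lemma sum_permutations_3:
  fixes h :: "'a \<Rightarrow> 'a \<Rightarrow> 'a \<Rightarrow> 'b::comm_monoid_add" and i :: "nat \<Rightarrow> 'a"
  shows "(\<Sum>\<sigma> | \<sigma> permutes {1, 2, 3}. h (i (\<sigma> 1)) (i (\<sigma> 2)) (i (\<sigma> 3))) =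
    h (i 1) (i 2) (i 3) + h (i 1) (i 3) (i 2) + h (i 2) (i 1) (i 3) + h (i 2) (i 3) (i 1)
    + h (i 3) (i 1) (i 2) + h (i 3) (i 2) (i 1)"
proof -
  have f: "finite {2::nat, 3}" "1 \<notin> {2::nat, 3}" "finite {3::nat}" "2 \<notin> {3::nat}"
    "finite ({} :: nat set)" "3 \<notin> ({} :: nat set)"
    by auto
  show ?thesis
    unfolding sum_over_permutations_insert[OF f(1,2)] sum_over_permutations_insert[OF f(3,4)]
      sum_over_permutations_insert[OF f(5,6)]
    by (simp add: permutes_empty transpose_def add_ac)
qed

text \<open>
  After summation over the permutations of \<open>p, q, r\<close>, the four monomials of a triple commutator
  all contribute the same symmetric function.
\<close>

definition monomial_sym :: "(nat \<Rightarrow> int) \<Rightarrow> 'k \<Rightarrow> 'k \<Rightarrow> 'k \<Rightarrow> 'k::field" where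
  "monomial_sym i x y z = (\<Sum>\<sigma> | \<sigma> permutes {1, 2, 3}. z powi i (\<sigma> 1) * y powi i (\<sigma> 2) * x powi i (\<sigma> 3))"

lemma monomial_sym_expand: "monomial_sym i x y z =
    z powi i 1 * y powi i 2 * x powi i 3 + z powi i 1 * y powi i 3 * x powi i 2
    + z powi i 2 * y powi i 1 * x powi i 3 + z powi i 2 * y powi i 3 * x powi i 1
    + z powi i 3 * y powi i 1 * x powi i 2 + z powi i 3 * y powi i 2 * x powi i 1"
  unfolding monomial_sym_def by (rule sum_permutations_3[where h = "\<lambda>p q r. z powi p * y powi q * x powi r"])

lemma monomial_sym_swap: "monomial_sym i x y z = monomial_sym i y x z" "monomial_sym i x y z = monomial_sym i x z y"
  by (simp_all add: monomial_sym_expand algebra_simps)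

context toroidal_parameters
begin

lemma sum_permutations_cubic:
  "(\<Sum>\<sigma> | \<sigma> permutes {1, 2, 3}.
      y / x * (z powi i (\<sigma> 1) * y powi i (\<sigma> 2) * x powi i (\<sigma> 3))
    - x / y * (z powi i (\<sigma> 1) * y powi i (\<sigma> 3) * x powi i (\<sigma> 2))
    - z / y * (z powi i (\<sigma> 2) * y powi i (\<sigma> 3) * x powi i (\<sigma> 1))
    + y / z * (z powi i (\<sigma> 3) * y powi i (\<sigma> 2) * x powi i (\<sigma> 1)))
    = monomial_sym i x y z * cubic_factor x y z"
proof -
  have "(\<Sum>\<sigma> | \<sigma> permutes {1, 2, 3}. z powi i (\<sigma> 1) * y powi i (\<sigma> 2) * x powi i (\<sigma> 3)) = monomial_sym i x y z"
    "(\<Sum>\<sigma> | \<sigma> permutes {1, 2, 3}. z powi i (\<sigma> 1) * y powi i (\<sigma> 3) * x powi i (\<sigma> 2)) = monomial_sym i x y z"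
    "(\<Sum>\<sigma> | \<sigma> permutes {1, 2, 3}. z powi i (\<sigma> 2) * y powi i (\<sigma> 3) * x powi i (\<sigma> 1)) = monomial_sym i x y z"
    "(\<Sum>\<sigma> | \<sigma> permutes {1, 2, 3}. z powi i (\<sigma> 3) * y powi i (\<sigma> 2) * x powi i (\<sigma> 1)) = monomial_sym i x y z"
    unfolding monomial_sym_expand
    by (subst sum_permutations_3[where h = "\<lambda>p q r. z powi p * y powi q * x powi r"]
        sum_permutations_3[where h = "\<lambda>p q r. z powi p * y powi r * x powi q"]
        sum_permutations_3[where h = "\<lambda>p q r. z powi q * y powi r * x powi p"]
        sum_permutations_3[where h = "\<lambda>p q r. z powi r * y powi q * x powi p"], simp only: add_ac)+
  note sums = this
  show ?thesis
    unfolding sum.distrib sum_subtractf sum_distrib_left[symmetric] sums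
    by (simp only: cubic_factor_def ring_distribs mult.commute)
qed

lemma mult_minus_sum:
  assumes "\<And>\<tau>. \<tau> \<in> T \<Longrightarrow> u \<tau> \<noteq> 0" "\<And>\<tau>. \<tau> \<in> T \<Longrightarrow> v \<tau> \<noteq> 0"
  shows mult_z_minus_sum:
    "mult_z_minus scale q (\<lambda>a b. \<Sum>\<tau>\<in>T. Poly_Mapping.single (B \<tau>) (k \<tau> * (u \<tau> powi a * v \<tau> powi b))) =
      (\<lambda>a b. \<Sum>\<tau>\<in>T. Poly_Mapping.single (B \<tau>) (k \<tau> * (u \<tau> - q * v \<tau>) * (u \<tau> powi a * v \<tau> powi b)))"
    and mult_w_minus_sum:
    "mult_w_minus scale q (\<lambda>a b. \<Sum>\<tau>\<in>T. Poly_Mapping.single (B \<tau>) (k \<tau> * (u \<tau> powi a * v \<tau> powi b))) =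
      (\<lambda>a b. \<Sum>\<tau>\<in>T. Poly_Mapping.single (B \<tau>) (k \<tau> * (v \<tau> - q * u \<tau>) * (u \<tau> powi a * v \<tau> powi b)))"
  using assms
  by (intro ext; simp add: mult_z_minus_def mult_w_minus_def scale_sum_right sum_subtractf[symmetric]
      single_diff[symmetric] power_int_add algebra_simps cong: sum.cong)+

lemma mult_zw_sum:
  assumes "\<And>\<tau>. \<tau> \<in> T \<Longrightarrow> u \<tau> \<noteq> 0" "\<And>\<tau>. \<tau> \<in> T \<Longrightarrow> v \<tau> \<noteq> 0"
  shows "mult_zw scale t1 t2 t3 (\<lambda>a b. \<Sum>\<tau>\<in>T. Poly_Mapping.single (B \<tau>) (k \<tau> * (u \<tau> powi a * v \<tau> powi b))) a b =
      (\<Sum>\<tau>\<in>T. Poly_Mapping.single (B \<tau>) (k \<tau> * zw_poly (u \<tau>) (v \<tau>) * (u \<tau> powi a * v \<tau> powi b)))"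
    and "mult_wz scale t1 t2 t3 (\<lambda>a b. \<Sum>\<tau>\<in>T. Poly_Mapping.single (B \<tau>) (k \<tau> * (u \<tau> powi a * v \<tau> powi b))) a b =
      (\<Sum>\<tau>\<in>T. Poly_Mapping.single (B \<tau>) (k \<tau> * zw_poly (v \<tau>) (u \<tau>) * (u \<tau> powi a * v \<tau> powi b)))"
  unfolding mult_zw_def mult_wz_def
  by (subst mult_z_minus_sum[OF assms], assumption+, subst mult_z_minus_sum[OF assms], assumption+,
      subst mult_z_minus_sum[OF assms], assumption+, simp add: zw_poly_def mult_ac)
    (subst mult_w_minus_sum[OF assms], assumption+, subst mult_w_minus_sum[OF assms], assumption+,
      subst mult_w_minus_sum[OF assms], assumption+, simp add: zw_poly_def mult_ac)

text \<open>
  The coefficients of \<open>op m (op n s)\<close> and \<open>op n (op m s)\<close> are sums over the same chains, so the two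
  multiplications by cubic polynomials insert \<open>zw_poly\<close> with its arguments in opposite orders.
\<close>

lemma quadratic_relation:
  fixes s :: 's
  assumes "move_operators op St mv K w"
  defines "ch \<equiv> move_operators.chains2 St mv s"
  assumes ord: "finite W" "ch \<subseteq> W" "\<And>a b. (a, b) \<in> W \<Longrightarrow> (b, a) \<in> W"
    and target: "\<And>a b. (a, b) \<in> ch \<Longrightarrow> mv (mv s a) b = target a b"
      "\<And>a b. (a, b) \<in> W \<Longrightarrow> target a b = target b a"
    and cf: "\<And>a b. (a, b) \<in> ch \<Longrightarrow> K s a * K (mv s a) b = cf a b"
      "\<And>a b. (a, b) \<in> W - ch \<Longrightarrow> cf a b = 0"
    and antisym: "\<And>a b. (a, b) \<in> W \<Longrightarrow> cf a b * zw_poly (w b) (w a) = - (cf b a * zw_poly (w a) (w b))"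
  shows "mult_zw scale t1 t2 t3 (\<lambda>m n. op m (op n (basis_vector s))) m n =
      - mult_wz scale t1 t2 t3 (\<lambda>m n. op n (op m (basis_vector s))) m n"
proof -
  interpret move_operators op St mv K w by fact
  let ?B = "\<lambda>\<tau>. mv (mv s (fst \<tau>)) (snd \<tau>)" and ?k = "\<lambda>\<tau>. K s (fst \<tau>) * K (mv s (fst \<tau>)) (snd \<tau>)"
    and ?u = "\<lambda>\<tau>. w (fst \<tau>)" and ?v = "\<lambda>\<tau>. w (snd \<tau>)"
  have 1: "(\<lambda>m n. op m (op n (basis_vector s))) =
      (\<lambda>m n. \<Sum>\<tau>\<in>ch. Poly_Mapping.single (?B \<tau>) (?k \<tau> * (?v \<tau> powi m * ?u \<tau> powi n)))"
    unfolding op_op_basis ch_def by (simp add: case_prod_unfold)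
  have 2: "(\<lambda>m n. op n (op m (basis_vector s))) =
      (\<lambda>m n. \<Sum>\<tau>\<in>ch. Poly_Mapping.single (?B \<tau>) (?k \<tau> * (?u \<tau> powi m * ?v \<tau> powi n)))"
    unfolding op_op_basis ch_def by (simp add: case_prod_unfold mult_ac)
  note main = sum_chains2_antisym[where W = W and s = s and target = target and cf = cf and m = m and n = n,
      folded ch_def, OF ord target cf, unfolded case_prod_unfold]
  show ?thesis
    unfolding 1 2 mult_zw_sum(1)[of ch ?v ?u ?B ?k, OF w_nonzero w_nonzero]
      mult_zw_sum(2)[of ch ?u ?v ?B ?k, OF w_nonzero w_nonzero]
    by (rule main[where p = zw_poly]) (use antisym in auto)
qed

lemma cubic_relation:
  fixes s :: 's and i :: "nat \<Rightarrow> int"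
  assumes "move_operators op St mv K w"
  defines "ch \<equiv> move_operators.chains3 St mv s"
  assumes ord: "finite W" "ch \<subseteq> W"
      "\<And>a b c. (a, b, c) \<in> W \<Longrightarrow> (b, a, c) \<in> W" "\<And>a b c. (a, b, c) \<in> W \<Longrightarrow> (a, c, b) \<in> W"
    and target: "\<And>a b c. (a, b, c) \<in> ch \<Longrightarrow> mv (mv (mv s a) b) c = target a b c"
      "\<And>a b c. target a b c = target b a c" "\<And>a b c. target a b c = target a c b"
    and cf: "\<And>a b c. (a, b, c) \<in> ch \<Longrightarrow> K s a * K (mv s a) b * K (mv (mv s a) b) c = cf a b c"
      "\<And>a b c. (a, b, c) \<in> W - ch \<Longrightarrow> cf a b c = 0"
    and vanish: "\<And>a b c. (a, b, c) \<in> W \<Longrightarrow>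
      cf a b c * cubic_factor (w a) (w b) (w c) + cf b a c * cubic_factor (w b) (w a) (w c)
      + cf a c b * cubic_factor (w a) (w c) (w b) + cf b c a * cubic_factor (w b) (w c) (w a)
      + cf c a b * cubic_factor (w c) (w a) (w b) + cf c b a * cubic_factor (w c) (w b) (w a) = 0"
  shows "(\<Sum>\<sigma> | \<sigma> permutes {1, 2, 3}. op_commutator (op (i (\<sigma> 1)))
      (op_commutator (op (i (\<sigma> 2) + 1)) (op (i (\<sigma> 3) - 1))) (basis_vector s)) = 0"
proof -
  interpret move_operators op St mv K w by fact
  note main = sum_chains3_eq_0[where W = W and s = s and target = target and cf = cf
      and h = "\<lambda>a b c. monomial_sym i (w a) (w b) (w c)"
      and k = "\<lambda>a b c. cubic_factor (w a) (w b) (w c)",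
      folded ch_def, OF ord target cf _ _ six_nonzero vanish]
  show ?thesis
    unfolding triple_commutator_basis
  proof (subst sum.swap, unfold case_prod_unfold single_sum[symmetric] sum_distrib_left[symmetric]
      sum_permutations_cubic)
    show "(\<Sum>\<tau>\<in>chains3 s. Poly_Mapping.single (mv (mv (mv s (fst \<tau>)) (fst (snd \<tau>))) (snd (snd \<tau>)))
        (K s (fst \<tau>) * K (mv s (fst \<tau>)) (fst (snd \<tau>)) * K (mv (mv s (fst \<tau>)) (fst (snd \<tau>))) (snd (snd \<tau>)) *
          (monomial_sym i (w (fst \<tau>)) (w (fst (snd \<tau>))) (w (snd (snd \<tau>))) *
            cubic_factor (w (fst \<tau>)) (w (fst (snd \<tau>))) (w (snd (snd \<tau>)))))) = 0"
      unfolding ch_def[symmetric] by (rule main[unfolded case_prod_unfold]) (auto intro: monomial_sym_swap)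
  qed
qed

end

section \<open>The relations among the e's and among the f's\<close>

context toroidal_parameters
begin

text \<open>
  The cubic relation adds three cells, and three are too few for a cell together with its diagonal
  neighbour, where the kernel may have a pole.
\<close>

definition skew :: "'r cell set \<Rightarrow> 'r cell set \<Rightarrow> bool" where
  "skew S D \<longleftrightarrow> downset S \<and> downset (S \<union> D) \<and> S \<inter> D = {} \<and> card D \<le> 3"

lemma skew_not_diagonal: "skew S D \<Longrightarrow> a \<in> D \<Longrightarrow> b \<in> D \<Longrightarrow> weight a \<noteq> t3 * weight b"
  using skew_diagonal_card[of S D a b] by (auto simp: skew_def weight_diagonal)

lemma skew_kernel_exchange:
  assumes "skew S {a, b}" "a \<noteq> b"
  shows "kernel (weight a) (weight b) * zw_poly (weight b) (weight a) =
    - (kernel (weight b) (weight a) * zw_poly (weight a) (weight b))"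
  using skew_not_diagonal[OF assms(1)] assms(2) by (intro kernel_exchange) auto

lemma skew_cubic_identity:
  assumes "skew S {a, b, c}" "a \<noteq> b" "a \<noteq> c" "b \<noteq> c"
  defines "K \<equiv> \<lambda>x y z. cubic_factor (weight x) (weight y) (weight z) * cubic_kernel (weight x) (weight y) (weight z)"
  shows "K a b c + K b a c + K a c b + K b c a + K c a b + K c b a = 0"
  unfolding K_def using skew_not_diagonal[OF assms(1)] assms(2-4) by (intro cubic_identity) auto

text \<open>
  Adding the cells of a skew shape in an order which leaves the realm of diagrams means adding
  some cell before one of its predecessors.  The kernel vanishes for this pair.
\<close>

lemma blocked_by_predecessor:
  assumes "downset S" "downset (S \<union> D)" "D' \<subseteq> D" "\<not> downset (S \<union> D')"
  obtains x y where "x \<in> D'" "y \<in> D - D'" "precedes y x"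
proof -
  have fin: "finite (S \<union> D')"
    using assms(2,3) by (auto simp: downset_def intro: finite_subset)
  have "\<exists>x\<in>S \<union> D'. \<not> (in_quadrant x \<and> (\<forall>y. in_quadrant y \<longrightarrow> precedes y x \<longrightarrow> y \<in> S \<union> D'))"
    using assms(4) fin unfolding downset_def by blast
  then obtain x where x: "x \<in> S \<union> D'" "\<not> (in_quadrant x \<and> (\<forall>y. in_quadrant y \<longrightarrow> precedes y x \<longrightarrow> y \<in> S \<union> D'))"
    by blast
  have "x \<in> S \<union> D" using x(1) assms(3) by blast
  then have "in_quadrant x" by (rule downset_quadrant[OF assms(2)])
  then obtain y where y: "in_quadrant y" "precedes y x" "y \<notin> S \<union> D'"
    using x(2) by blast
  have "y \<in> S \<union> D" using downset_pred[OF assms(2) \<open>x \<in> S \<union> D\<close> y(1,2)] .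
  moreover have "x \<notin> S" using downset_pred[OF assms(1) _ y(1,2)] y(3) by blast
  ultimately show thesis using x(1) y that by blast
qed

lemma skew_kernel_0:
  assumes "skew S D" "x \<in> D" "y \<in> D" "precedes y x"
  shows "kernel (weight x) (weight y) = 0"
proof -
  have "\<not> diagonal y x" using skew_not_diagonal[OF assms(1,3,2)] by (simp add: weight_diagonal)
  moreover have "x \<noteq> y" using assms(4) by (auto simp: precedes_def)
  ultimately show ?thesis using kernel_eq_0_iff[of x y] assms(4) by blast
qed

lemma skew_order2:
  assumes "skew S {a, b}" "\<not> downset (insert a S)"
  shows "kernel (weight a) (weight b) = 0"
proof -
  obtain x y where "x \<in> {a}" "y \<in> {a, b} - {a}" "precedes y x"
    using blocked_by_predecessor[of S "{a, b}" "{a}"] assms by (auto simp: skew_def)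
  then show ?thesis using skew_kernel_0[OF assms(1)] by auto
qed

lemma skew_order3:
  assumes "skew S {a, b, c}" "\<not> (downset (insert a S) \<and> downset (insert b (insert a S)))"
  shows "cubic_kernel (weight a) (weight b) (weight c) = 0"
proof (cases "downset (insert a S)")
  case False
  have d: "downset S" "downset (S \<union> {a, b, c})" "\<not> downset (S \<union> {a})"
    using False assms(1) by (simp_all add: skew_def)
  obtain x y where "x \<in> {a}" "y \<in> {a, b, c} - {a}" "precedes y x"
    by (rule blocked_by_predecessor[OF d(1,2) _ d(3)]) auto
  then show ?thesis using skew_kernel_0[OF assms(1), of a y] by (auto simp: cubic_kernel_def)
next
  case True
  then have "\<not> downset (insert a S \<union> {b})" "downset (insert a S \<union> {b, c})"
    using assms by (auto simp: skew_def insert_commute)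
  note d = this
  obtain x y where "x \<in> {b}" "y \<in> {b, c} - {b}" "precedes y x"
    by (rule blocked_by_predecessor[OF True d(2) _ d(1)]) auto
  then show ?thesis using skew_kernel_0[OF assms(1), of b y] by (auto simp: cubic_kernel_def)
qed

text \<open>
  The product of the coefficients of a chain is replaced by an expression in the added cells that is
  symmetric except for the kernels.  It makes sense for every order of these cells, and is zero for those
  that do not form a chain.  So the sums run over all orders, and the exchange rule and the cubic identity
  for the kernel apply.
\<close>

lemma adding_relations:
  fixes C :: "'r diagrams \<Rightarrow> 'r cell \<Rightarrow> 'k" and i :: "nat \<Rightarrow> int"
  assumes lin: "\<And>p. lin (op p)"
    and op: "\<And>p \<Lambda>. op p (basis_vector \<Lambda>) =
      (\<Sum>b\<in>addables \<Lambda>. Poly_Mapping.single (plus_cell \<Lambda> b) (C \<Lambda> b * weight b powi p))"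
    and C: "exchange C" "\<And>\<Lambda> b. b \<in> addables \<Lambda> \<Longrightarrow> C \<Lambda> b \<noteq> 0"
  shows "mult_zw scale t1 t2 t3 (\<lambda>m n. op m (op n (basis_vector \<Lambda>))) m n =
      - mult_wz scale t1 t2 t3 (\<lambda>m n. op n (op m (basis_vector \<Lambda>))) m n" (is ?quadratic)
    and "(\<Sum>\<sigma> | \<sigma> permutes {1, 2, 3}. op_commutator (op (i (\<sigma> 1)))
      (op_commutator (op (i (\<sigma> 2) + 1)) (op (i (\<sigma> 3) - 1))) (basis_vector \<Lambda>)) = 0" (is ?cubic)
proof -
  have mo: "move_operators op addables plus_cell C weight"
    by (intro move_operators.intro lin op) simp_all
  interpret move_operators op addables plus_cell C weight by (rule mo)
  obtain g where g: "\<And>\<Lambda>. g \<Lambda> \<noteq> 0"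
    "\<And>\<Lambda> b. b \<in> addables \<Lambda> \<Longrightarrow> C \<Lambda> b = g (plus_cell \<Lambda> b) / g \<Lambda> * free_coeff \<Lambda> b"
    using exchange_path_form[OF C] by metis
  define S where "S = cells \<Lambda>"
  have S: "downset S" by (simp add: S_def downset_cells)
  have step: "a \<in> addables M \<longleftrightarrow> a \<notin> cells M \<and> downset (insert a (cells M))" for a and M :: "'r diagrams"
    by (simp add: addables_def)
  show ?quadratic
  proof (rule quadratic_relation[OF mo,
        where target = "\<lambda>a b. shape (S \<union> {a, b})"
        and cf = "\<lambda>a b. g (shape (S \<union> {a, b})) / g \<Lambda> * free_coeff \<Lambda> a * free_coeff \<Lambda> b * kernel (weight a) (weight b)"])
    define B where "B = fst ` chains2 \<Lambda> \<union> snd ` chains2 \<Lambda>"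
    define W where "W = {(a, b) \<in> B \<times> B. a \<noteq> b \<and> skew S {a, b}}"
    show "finite W"
      by (rule finite_subset[of _ "B \<times> B"]) (auto simp: W_def B_def finite_chains2)
    have ch: "(a, b) \<in> chains2 \<Lambda> \<longleftrightarrow> a \<in> addables \<Lambda> \<and> b \<in> addables (plus_cell \<Lambda> a)" for a b
      by (simp add: chains2_def)
    have cells2: "cells (plus_cell (plus_cell \<Lambda> a) b) = S \<union> {a, b}" "a \<noteq> b" "a \<notin> S" "b \<notin> S"
      if "(a, b) \<in> chains2 \<Lambda>" for a b
      using that by (auto simp: ch S_def dest: addables_notin)
    show "chains2 \<Lambda> \<subseteq> W"
    proof clarify
      fix a b assume ab: "(a, b) \<in> chains2 \<Lambda>"
      have "downset (S \<union> {a, b})" unfolding cells2(1)[OF ab, symmetric] by (rule downset_cells)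
      then show "(a, b) \<in> W"
        using ab cells2[OF ab] S by (force simp: W_def B_def skew_def)
    qed
    show "(b, a) \<in> W" if "(a, b) \<in> W" for a b
      using that by (auto simp: W_def insert_commute)
    show target: "plus_cell (plus_cell \<Lambda> a) b = shape (S \<union> {a, b})" if "(a, b) \<in> chains2 \<Lambda>" for a b
      unfolding cells2(1)[OF that, symmetric] by simp
    show "shape (S \<union> {a, b}) = shape (S \<union> {b, a})" for a b
      by (simp add: insert_commute)
    show "C \<Lambda> a * C (plus_cell \<Lambda> a) b =
        g (shape (S \<union> {a, b})) / g \<Lambda> * free_coeff \<Lambda> a * free_coeff \<Lambda> b * kernel (weight a) (weight b)"
      if "(a, b) \<in> chains2 \<Lambda>" for a b
      using that g(1)[of "plus_cell \<Lambda> a"] unfolding target[OF that, symmetric]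
      by (auto simp: ch g(2) free_coeff_plus)
    show "g (shape (S \<union> {a, b})) / g \<Lambda> * free_coeff \<Lambda> a * free_coeff \<Lambda> b * kernel (weight a) (weight b) = 0"
      if "(a, b) \<in> W - chains2 \<Lambda>" for a b
    proof -
      have "\<not> downset (insert a S)"
      proof
        assume "downset (insert a S)"
        then have "a \<in> addables \<Lambda>" using that by (auto simp: step W_def skew_def S_def)
        moreover from this have "b \<in> addables (plus_cell \<Lambda> a)"
          using that by (auto simp: step[of b] W_def skew_def S_def insert_commute)
        ultimately show False using that by (auto simp: ch)
      qed
      then show ?thesis using skew_order2[of S a b] that by (auto simp: W_def)
    qed
    show "g (shape (S \<union> {a, b})) / g \<Lambda> * free_coeff \<Lambda> a * free_coeff \<Lambda> b * kernel (weight a) (weight b)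
          * zw_poly (weight b) (weight a) =
        - (g (shape (S \<union> {b, a})) / g \<Lambda> * free_coeff \<Lambda> b * free_coeff \<Lambda> a * kernel (weight b) (weight a)
          * zw_poly (weight a) (weight b))" if "(a, b) \<in> W" for a b
      using skew_kernel_exchange[of S a b] that
      by (simp add: W_def insert_commute[of b a] mult.assoc)
  qed
  show ?cubic
  proof (rule cubic_relation[OF mo,
        where target = "\<lambda>a b c. shape (S \<union> {a, b, c})"
        and cf = "\<lambda>a b c. g (shape (S \<union> {a, b, c})) / g \<Lambda> * free_coeff \<Lambda> a * free_coeff \<Lambda> b * free_coeff \<Lambda> c
            * cubic_kernel (weight a) (weight b) (weight c)"])
    define B where "B = fst ` chains3 \<Lambda> \<union> (fst \<circ> snd) ` chains3 \<Lambda> \<union> (snd \<circ> snd) ` chains3 \<Lambda>"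
    define W where "W = {(a, b, c) \<in> B \<times> B \<times> B. a \<noteq> b \<and> a \<noteq> c \<and> b \<noteq> c \<and> skew S {a, b, c}}"
    have "finite B" by (simp add: B_def finite_chains3)
    then show "finite W"
      by (intro finite_subset[of W "B \<times> B \<times> B"]) (auto simp: W_def)
    have ch: "(a, b, c) \<in> chains3 \<Lambda> \<longleftrightarrow> a \<in> addables \<Lambda> \<and> b \<in> addables (plus_cell \<Lambda> a)
        \<and> c \<in> addables (plus_cell (plus_cell \<Lambda> a) b)" for a b c
      by (auto simp: chains3_def chains2_def)
    have cells3: "cells (plus_cell (plus_cell (plus_cell \<Lambda> a) b) c) = S \<union> {a, b, c}"
        "a \<noteq> b" "a \<noteq> c" "b \<noteq> c" "a \<notin> S" "b \<notin> S" "c \<notin> S"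
      if "(a, b, c) \<in> chains3 \<Lambda>" for a b c
      using that addables_notin[of a \<Lambda>] addables_notin[of b "plus_cell \<Lambda> a"]
        addables_notin[of c "plus_cell (plus_cell \<Lambda> a) b"] by (auto simp: ch S_def)
    show "chains3 \<Lambda> \<subseteq> W"
    proof clarify
      fix a b c assume abc: "(a, b, c) \<in> chains3 \<Lambda>"
      have "downset (S \<union> {a, b, c})" unfolding cells3(1)[OF abc, symmetric] by (rule downset_cells)
      then have "skew S {a, b, c}" using cells3[OF abc] S by (auto simp: skew_def card_insert_if)
      moreover have "a \<in> B" "b \<in> B" "c \<in> B" using abc by (force simp: B_def)+
      ultimately show "(a, b, c) \<in> W"
        using cells3[OF abc] by (simp add: W_def)
    qed
    show "(b, a, c) \<in> W" "(a, c, b) \<in> W" if "(a, b, c) \<in> W" for a b c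
      using that by (auto simp: W_def insert_commute)
    show target: "plus_cell (plus_cell (plus_cell \<Lambda> a) b) c = shape (S \<union> {a, b, c})"
      if "(a, b, c) \<in> chains3 \<Lambda>" for a b c
      unfolding cells3(1)[OF that, symmetric] by simp
    show "shape (S \<union> {a, b, c}) = shape (S \<union> {b, a, c})" "shape (S \<union> {a, b, c}) = shape (S \<union> {a, c, b})" for a b c
      by (simp_all add: insert_commute)
    show "C \<Lambda> a * C (plus_cell \<Lambda> a) b * C (plus_cell (plus_cell \<Lambda> a) b) c =
        g (shape (S \<union> {a, b, c})) / g \<Lambda> * free_coeff \<Lambda> a * free_coeff \<Lambda> b * free_coeff \<Lambda> c
            * cubic_kernel (weight a) (weight b) (weight c)"
      if "(a, b, c) \<in> chains3 \<Lambda>" for a b c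
      using that g(1)[of "plus_cell \<Lambda> a"] g(1)[of "plus_cell (plus_cell \<Lambda> a) b"]
      unfolding target[OF that, symmetric]
      by (auto simp: ch g(2) free_coeff_plus cubic_kernel_def)
    show "g (shape (S \<union> {a, b, c})) / g \<Lambda> * free_coeff \<Lambda> a * free_coeff \<Lambda> b * free_coeff \<Lambda> c
            * cubic_kernel (weight a) (weight b) (weight c) = 0"
      if "(a, b, c) \<in> W - chains3 \<Lambda>" for a b c
    proof -
      have "\<not> (downset (insert a S) \<and> downset (insert b (insert a S)))"
      proof
        assume d: "downset (insert a S) \<and> downset (insert b (insert a S))"
        then have "a \<in> addables \<Lambda>" using that by (auto simp: step W_def skew_def S_def)
        moreover from this have "b \<in> addables (plus_cell \<Lambda> a)"
          using that d by (auto simp: step[of b] W_def skew_def S_def)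
        moreover from this calculation have "c \<in> addables (plus_cell (plus_cell \<Lambda> a) b)"
          using that by (auto simp: step[of c] W_def skew_def S_def insert_commute)
        ultimately show False using that by (auto simp: ch)
      qed
      then show ?thesis using skew_order3[of S a b c] that by (auto simp: W_def)
    qed
    let ?K = "\<lambda>x y z. cubic_factor (weight x) (weight y) (weight z) * cubic_kernel (weight x) (weight y) (weight z)"
    let ?G = "\<lambda>a b c. g (shape (S \<union> {a, b, c})) / g \<Lambda> * free_coeff \<Lambda> a * free_coeff \<Lambda> b * free_coeff \<Lambda> c"
    let ?cf = "\<lambda>a b c. ?G a b c * cubic_kernel (weight a) (weight b) (weight c)
        * cubic_factor (weight a) (weight b) (weight c)"
    show "?cf a b c + ?cf b a c + ?cf a c b + ?cf b c a + ?cf c a b + ?cf c b a = 0"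
      if "(a, b, c) \<in> W" for a b c
    proof -
      have sym: "?G b a c = ?G a b c" "?G a c b = ?G a b c" "?G b c a = ?G a b c" "?G c a b = ?G a b c" "?G c b a = ?G a b c"
        by (simp_all add: insert_commute mult_ac)
      have "?cf a b c + ?cf b a c + ?cf a c b + ?cf b c a + ?cf c a b + ?cf c b a =
          ?G a b c * (?K a b c + ?K b a c + ?K a c b + ?K b c a + ?K c a b + ?K c b a)"
        unfolding sym by (simp only: distrib_left mult_ac)
      also have "\<dots> = 0"
        using skew_cubic_identity[of S a b c] that by (simp add: W_def)
      finally show ?thesis .
    qed
  qed
qed

text \<open>
  An operator that removes cells is the transpose of one that adds them, with respect to the pairing that
  makes the labelled basis orthonormal.  Transposition reverses products; hence it interchanges the two sides of
  the quadratic relation, while the signs from the two nested commutators cancel.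
\<close>

definition transposed :: "(('b \<Rightarrow>\<^sub>0 'c::field) \<Rightarrow> ('b \<Rightarrow>\<^sub>0 'c)) \<Rightarrow> (('b \<Rightarrow>\<^sub>0 'c) \<Rightarrow> ('b \<Rightarrow>\<^sub>0 'c)) \<Rightarrow> bool" where
  "transposed f f' \<longleftrightarrow>
    (\<forall>a b. Poly_Mapping.lookup (f (basis_vector a)) b = Poly_Mapping.lookup (f' (basis_vector b)) a)"

lemma transposedD:
  "transposed f f' \<Longrightarrow> Poly_Mapping.lookup (f (basis_vector a)) b = Poly_Mapping.lookup (f' (basis_vector b)) a"
  by (simp add: transposed_def)

lemma lin_map_lookup:
  assumes "lin f" "finite B" "Poly_Mapping.keys v \<subseteq> B"
  shows "Poly_Mapping.lookup (f v) b = (\<Sum>c\<in>B. Poly_Mapping.lookup v c * Poly_Mapping.lookup (f (basis_vector c)) b)"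
proof -
  have "f v = f (\<Sum>c\<in>B. Poly_Mapping.single c (Poly_Mapping.lookup v c))"
    by (rule arg_cong[OF poly_mapping_expansion[OF assms(2,3)]])
  also have "\<dots> = (\<Sum>c\<in>B. scale (Poly_Mapping.lookup v c) (f (basis_vector c)))"
    unfolding lin_map_sum[OF assms(1)] by (intro sum.cong refl lin_map_single[OF assms(1)])
  finally show ?thesis by (simp add: lookup_sum)
qed

lemma transposed_comp:
  assumes lin: "lin f" "lin g'" and tr: "transposed f f'" "transposed g g'"
  shows "transposed (\<lambda>v. f (g v)) (\<lambda>v. g' (f' v))"
  unfolding transposed_def
proof (intro allI)
  fix a b
  let ?B = "Poly_Mapping.keys (g (basis_vector a)) \<union> Poly_Mapping.keys (f' (basis_vector b))"
  show "Poly_Mapping.lookup (f (g (basis_vector a))) b = Poly_Mapping.lookup (g' (f' (basis_vector b))) a"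
    unfolding lin_map_lookup[where B = ?B, OF lin(1) finite_UnI[OF finite_keys finite_keys] Un_upper1]
      lin_map_lookup[where B = ?B, OF lin(2) finite_UnI[OF finite_keys finite_keys] Un_upper2]
      transposedD[OF tr(1)] transposedD[OF tr(2)] by (simp only: mult.commute)
qed

lemma lin_op_commutator:
  assumes "lin f" "lin g"
  shows "lin (op_commutator f g)"
proof -
  have "op_commutator f g = (\<lambda>v. f (g v) - g (f v))"
    by (simp add: fun_eq_iff op_commutator_def)
  then show ?thesis
    using lin_diff[OF lin_comp[OF assms] lin_comp[OF assms(2,1)]] by simp
qed

lemma transposed_commutator:
  assumes "lin f" "lin g" "lin f'" "lin g'" "transposed f f'" "transposed g g'"
  shows "transposed (op_commutator f g) (op_commutator g' f')"
  using transposed_comp[of f g' f' g] transposed_comp[of g f' g' f] assms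
  by (simp add: transposed_def op_commutator_def lookup_minus)

lemma lookup_mult_zw:
  "Poly_Mapping.lookup (mult_zw scale q1 q2 q3 h m n) b =
    mult_zw (*) q1 q2 q3 (\<lambda>m n. Poly_Mapping.lookup (h m n) b) m n"
  "Poly_Mapping.lookup (mult_wz scale q1 q2 q3 h m n) b =
    mult_wz (*) q1 q2 q3 (\<lambda>m n. Poly_Mapping.lookup (h m n) b) m n"
  by (simp_all add: mult_zw_def mult_wz_def mult_z_minus_def mult_w_minus_def lookup_minus)

lemma transposed_exchange_relation:
  assumes lin: "\<And>m. lin (f m)" "\<And>m. lin (f' m)" "\<And>m. lin (g m)" "\<And>m. lin (g' m)"
    and tr: "\<And>m. transposed (f m) (f' m)" "\<And>m. transposed (g m) (g' m)"
    and rel: "\<And>b. mult_zw scale q1 q2 q3 (\<lambda>m n. f' m (g' n (basis_vector b))) m n =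
      - mult_wz scale q1 q2 q3 (\<lambda>m n. g' n (f' m (basis_vector b))) m n"
  shows "mult_wz scale q1 q2 q3 (\<lambda>m n. f m (g n (basis_vector a))) m n =
    - mult_zw scale q1 q2 q3 (\<lambda>m n. g n (f m (basis_vector a))) m n"
proof (rule poly_mapping_eqI)
  fix b
  have fg: "Poly_Mapping.lookup (f m (g n (basis_vector a))) b = Poly_Mapping.lookup (g' n (f' m (basis_vector b))) a"
    and gf: "Poly_Mapping.lookup (g n (f m (basis_vector a))) b = Poly_Mapping.lookup (f' m (g' n (basis_vector b))) a" for m n
    using transposed_comp[of "f m" "g' n" "f' m" "g n"] transposed_comp[of "g n" "f' m" "g' n" "f m"] lin tr
    by (simp_all add: transposed_def)
  have "Poly_Mapping.lookup (mult_zw scale q1 q2 q3 (\<lambda>m n. f' m (g' n (basis_vector b))) m n) a =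
      - Poly_Mapping.lookup (mult_wz scale q1 q2 q3 (\<lambda>m n. g' n (f' m (basis_vector b))) m n) a"
    unfolding rel by simp
  then show "Poly_Mapping.lookup (mult_wz scale q1 q2 q3 (\<lambda>m n. f m (g n (basis_vector a))) m n) b =
    Poly_Mapping.lookup (- mult_zw scale q1 q2 q3 (\<lambda>m n. g n (f m (basis_vector a))) m n) b"
    by (simp add: lookup_mult_zw fg gf)
qed

definition adding_op :: "('r diagrams \<Rightarrow> 'r cell \<Rightarrow> 'k) \<Rightarrow> int \<Rightarrow> ('r diagrams \<Rightarrow>\<^sub>0 'k) \<Rightarrow> ('r diagrams \<Rightarrow>\<^sub>0 'k)" where
  "adding_op C p = lin_ext (\<lambda>\<Lambda>. \<Sum>b\<in>addables \<Lambda>. Poly_Mapping.single (plus_cell \<Lambda> b) (C \<Lambda> b * weight b powi p))"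

lemma adding_op_basis: "adding_op C p (basis_vector \<Lambda>) =
    (\<Sum>b\<in>addables \<Lambda>. Poly_Mapping.single (plus_cell \<Lambda> b) (C \<Lambda> b * weight b powi p))"
  by (simp add: adding_op_def)

lemma lin_adding_op: "lin (adding_op C p)"
  by (simp add: adding_op_def lin_lin_ext)

text \<open>
  Taking \<open>b\<close> off \<open>\<Lambda>\<close> gives \<open>M\<close> exactly if adding \<open>b\<close> to \<open>M\<close> gives \<open>\<Lambda>\<close>.
\<close>

lemma transposed_removing:
  assumes op: "\<And>\<Lambda>. op (basis_vector \<Lambda>) =
      (\<Sum>b\<in>removables \<Lambda>. Poly_Mapping.single (minus_cell \<Lambda> b) (C (minus_cell \<Lambda> b) b * weight b powi p))"
  shows "transposed op (adding_op C p)"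
  unfolding transposed_def op adding_op_basis
proof (intro allI)
  fix \<Lambda> M :: "'r diagrams"
  let ?c = "\<lambda>b. C M b * weight b powi p"
  let ?A = "{b \<in> addables M. plus_cell M b = \<Lambda>}" and ?R = "{b \<in> removables \<Lambda>. minus_cell \<Lambda> b = M}"
  have "?A = ?R"
    using removables_plus_cell addables_minus_cell minus_plus_cell plus_minus_cell by blast
  moreover have "Poly_Mapping.lookup (\<Sum>b\<in>addables M. Poly_Mapping.single (plus_cell M b) (?c b)) \<Lambda> = sum ?c ?A"
    by (simp add: lookup_sum lookup_single when_def sum.inter_filter)
  moreover have "Poly_Mapping.lookup (\<Sum>b\<in>removables \<Lambda>. Poly_Mapping.single (minus_cell \<Lambda> b)
      (C (minus_cell \<Lambda> b) b * weight b powi p)) M = sum ?c ?R"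
    unfolding lookup_sum lookup_single when_def sum.inter_filter[OF finite_removables]
    by (rule sum.cong) auto
  ultimately show "Poly_Mapping.lookup (\<Sum>b\<in>removables \<Lambda>. Poly_Mapping.single (minus_cell \<Lambda> b)
      (C (minus_cell \<Lambda> b) b * weight b powi p)) M =
    Poly_Mapping.lookup (\<Sum>b\<in>addables M. Poly_Mapping.single (plus_cell M b) (?c b)) \<Lambda>"
    by simp
qed

lemma removing_relations:
  fixes C :: "'r diagrams \<Rightarrow> 'r cell \<Rightarrow> 'k" and i :: "nat \<Rightarrow> int"
  assumes lin: "\<And>p. lin (op p)"
    and op: "\<And>p \<Lambda>. op p (basis_vector \<Lambda>) =
      (\<Sum>b\<in>removables \<Lambda>. Poly_Mapping.single (minus_cell \<Lambda> b) (C (minus_cell \<Lambda> b) b * weight b powi p))"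
    and C: "exchange C" "\<And>\<Lambda> b. b \<in> addables \<Lambda> \<Longrightarrow> C \<Lambda> b \<noteq> 0"
  shows "mult_wz scale t1 t2 t3 (\<lambda>m n. op m (op n (basis_vector \<Lambda>))) m n =
      - mult_zw scale t1 t2 t3 (\<lambda>m n. op n (op m (basis_vector \<Lambda>))) m n"
    and "(\<Sum>\<sigma> | \<sigma> permutes {1, 2, 3}. op_commutator (op (i (\<sigma> 1)))
      (op_commutator (op (i (\<sigma> 2) + 1)) (op (i (\<sigma> 3) - 1))) (basis_vector \<Lambda>)) = 0"
proof -
  let ?e = "adding_op C"
  note add = adding_relations[of ?e C, OF lin_adding_op adding_op_basis C]
  have tr: "transposed (op p) (?e p)" for p
    by (rule transposed_removing[OF op])
  show "mult_wz scale t1 t2 t3 (\<lambda>m n. op m (op n (basis_vector \<Lambda>))) m n =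
      - mult_zw scale t1 t2 t3 (\<lambda>m n. op n (op m (basis_vector \<Lambda>))) m n"
    by (rule transposed_exchange_relation[OF lin lin_adding_op lin lin_adding_op tr tr add(1)])
  have double: "op_commutator (op_commutator (?e r) (?e q)) (?e p) v = op_commutator (?e p) (op_commutator (?e q) (?e r)) v" for p q r v
    using lin_adding_op by (simp add: op_commutator_def lin_iff lin_map_diff)
  have "transposed (op_commutator (op p) (op_commutator (op q) (op r)))
      (op_commutator (?e p) (op_commutator (?e q) (?e r)))" for p q r
    using transposed_commutator[OF lin lin_op_commutator[OF lin lin] lin_adding_op lin_op_commutator[OF lin_adding_op lin_adding_op]
        tr transposed_commutator[OF lin lin lin_adding_op lin_adding_op tr tr], of p q r]
    by (simp add: transposed_def double)
  note tr3 = transposedD[OF this]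
  show "(\<Sum>\<sigma> | \<sigma> permutes {1, 2, 3}. op_commutator (op (i (\<sigma> 1)))
      (op_commutator (op (i (\<sigma> 2) + 1)) (op (i (\<sigma> 3) - 1))) (basis_vector \<Lambda>)) = 0"
  proof (rule poly_mapping_eqI)
    fix M
    show "Poly_Mapping.lookup (\<Sum>\<sigma> | \<sigma> permutes {1, 2, 3}. op_commutator (op (i (\<sigma> 1)))
        (op_commutator (op (i (\<sigma> 2) + 1)) (op (i (\<sigma> 3) - 1))) (basis_vector \<Lambda>)) M = Poly_Mapping.lookup 0 M"
      unfolding lookup_sum tr3 unfolding lookup_sum[symmetric] using add(2)[where i = i and \<Lambda> = M] by (simp only: lookup_zero)
  qed
qed

end

section \<open>Partial fractions and expansions\<close>

text \<open>The residue at \<open>\<beta> i\<close> of the product of the \<open>(z - \<alpha> j) / (z - \<beta> j)\<close>.\<close>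

definition residue :: "('i \<Rightarrow> 'f::field) \<Rightarrow> ('i \<Rightarrow> 'f) \<Rightarrow> 'i set \<Rightarrow> 'i \<Rightarrow> 'f" where
  "residue \<alpha> \<beta> I i = (\<beta> i - \<alpha> i) * (\<Prod>j\<in>I - {i}. (\<beta> i - \<alpha> j) / (\<beta> i - \<beta> j))"

text \<open>
  By induction on the set of poles: in the product with one more factor, the residue at an old pole is
  multiplied by the value of the new factor there.
\<close>

lemma partial_fractions:
  fixes \<alpha> \<beta> :: "'i \<Rightarrow> 'f::field"
  assumes "finite I" "inj_on \<beta> I" "z \<notin> \<beta> ` I"
  shows "(\<Prod>i\<in>I. (z - \<alpha> i) / (z - \<beta> i)) = 1 + (\<Sum>i\<in>I. residue \<alpha> \<beta> I i / (z - \<beta> i))"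
  using assms
proof (induction I arbitrary: z rule: finite_induct)
  case (insert n I)
  define x where "x = \<beta> n"
  define G where "G z = (\<Prod>i\<in>I. (z - \<alpha> i) / (z - \<beta> i))" for z
  have inj: "inj_on \<beta> I" and x: "x \<notin> \<beta> ` I" and zx: "z - x \<noteq> 0" and zI: "z \<notin> \<beta> ` I"
    using insert.prems insert.hyps by (auto simp: x_def)
  have Gz: "G z = 1 + (\<Sum>i\<in>I. residue \<alpha> \<beta> I i / (z - \<beta> i))"
    and Gx: "G x = 1 + (\<Sum>i\<in>I. residue \<alpha> \<beta> I i / (x - \<beta> i))"
    unfolding G_def by (rule insert.IH[OF inj zI], rule insert.IH[OF inj x])
  have step: "residue \<alpha> \<beta> (insert n I) i / (z - \<beta> i) =
      residue \<alpha> \<beta> I i / (z - \<beta> i) + (x - \<alpha> n) / (z - x) * (residue \<alpha> \<beta> I i / (z - \<beta> i) - residue \<alpha> \<beta> I i / (x - \<beta> i))"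
    if i: "i \<in> I" for i
  proof -
    have nz: "z - \<beta> i \<noteq> 0" "x - \<beta> i \<noteq> 0" "\<beta> i - x \<noteq> 0"
      using zI x i by auto
    have "insert n I - {i} = insert n (I - {i})" using insert.hyps i by auto
    then have "residue \<alpha> \<beta> (insert n I) i = residue \<alpha> \<beta> I i * ((\<beta> i - \<alpha> n) / (\<beta> i - x))"
      using insert.hyps by (simp add: residue_def x_def)
    also have "\<dots> / (z - \<beta> i) = residue \<alpha> \<beta> I i * ((\<beta> i - \<alpha> n) / (\<beta> i - x) / (z - \<beta> i))"
      by simp
    also have "(\<beta> i - \<alpha> n) / (\<beta> i - x) / (z - \<beta> i) =
        1 / (z - \<beta> i) + (x - \<alpha> n) / (z - x) * (1 / (z - \<beta> i) - 1 / (x - \<beta> i))"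
      using nz zx by (simp add: divide_simps) (simp add: algebra_simps)
    finally show ?thesis by (simp add: algebra_simps)
  qed
  have "residue \<alpha> \<beta> (insert n I) n = (x - \<alpha> n) * G x"
    using insert.hyps by (simp add: residue_def x_def G_def)
  then have "(\<Sum>i\<in>insert n I. residue \<alpha> \<beta> (insert n I) i / (z - \<beta> i)) =
      (x - \<alpha> n) * G x / (z - x) + (\<Sum>i\<in>I. residue \<alpha> \<beta> (insert n I) i / (z - \<beta> i))"
    using insert.hyps by (simp add: x_def)
  also have "(\<Sum>i\<in>I. residue \<alpha> \<beta> (insert n I) i / (z - \<beta> i)) = (\<Sum>i\<in>I. residue \<alpha> \<beta> I i / (z - \<beta> i)
      + (x - \<alpha> n) / (z - x) * (residue \<alpha> \<beta> I i / (z - \<beta> i) - residue \<alpha> \<beta> I i / (x - \<beta> i)))"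
    by (rule sum.cong[OF refl step])
  also have "\<dots> = (G z - 1) + (x - \<alpha> n) / (z - x) * (G z - G x)"
    unfolding Gz Gx by (simp only: sum.distrib sum_subtractf sum_distrib_left[symmetric]) simp
  finally have "1 + (\<Sum>i\<in>insert n I. residue \<alpha> \<beta> (insert n I) i / (z - \<beta> i)) = G z * ((z - \<alpha> n) / (z - x))"
    using zx by (simp add: divide_simps) algebra
  then show ?case
    using insert.hyps by (simp add: G_def x_def)
qed simp

lemma fls_simple_pole_at_infinity:
  fixes b :: "'k::field"
  shows "fls_nth (1 / (fls_X_inv - fls_const b)) m = (if m \<ge> 1 then b ^ nat (m - 1) else 0)"
proof -
  define G where "G = Abs_fps (\<lambda>n. b ^ n)"
  have "(1 - fps_const b * fps_X) * G = 1"
    by (rule fps_ext) (simp add: G_def left_diff_distrib mult.assoc power_eq_if)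
  then have "fps_to_fls ((1 - fps_const b * fps_X) * G) = 1" by simp
  then have G: "(1 - fls_const b * fls_X) * fps_to_fls G = 1"
    by (simp only: fls_times_fps_to_fls fps_to_fls_minus fps_one_to_fls fps_const_to_fls fps_X_to_fls)
  have "(fls_X_inv - fls_const b) * (fls_X * fps_to_fls G) = (fls_X_inv * fls_X - fls_const b * fls_X) * fps_to_fls G"
    by (simp add: algebra_simps)
  also have "fls_X_inv * fls_X = (1 :: 'k fls)"
    by (metis fls_inverse_X fls_X_nonzero left_inverse)
  finally have "1 / (fls_X_inv - fls_const b) = fls_X * fps_to_fls G"
    unfolding G by (metis divide_eq_eq mult.commute mult_zero_left zero_neq_one)
  then show ?thesis
    by (simp add: fls_X_times_conv_shift G_def)
qed

lemma fls_simple_pole_at_zero: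
  fixes b :: "'k::field"
  assumes "b \<noteq> 0"
  shows "fls_nth (1 / (fls_X - fls_const b)) m = (if m \<ge> 0 then - ((1 / b) ^ (nat m + 1)) else 0)"
proof -
  define G where "G = Abs_fps (\<lambda>n. - ((1 / b) ^ (n + 1)))"
  have "(fps_X - fps_const b) * G = 1"
    using assms by (intro fps_ext) (simp add: G_def left_diff_distrib power_eq_if)
  then have "fps_to_fls ((fps_X - fps_const b) * G) = 1" by simp
  then have "(fls_X - fls_const b) * fps_to_fls G = 1"
    by (simp only: fls_times_fps_to_fls fps_to_fls_minus fps_const_to_fls fps_X_to_fls)
  then have "1 / (fls_X - fls_const b) = fps_to_fls G"
    by (metis divide_eq_eq mult.commute mult_zero_left zero_neq_one)
  then show ?thesis
    by (simp add: G_def)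
qed

lemma fls_simple_pole_jump:
  fixes b :: "'k::field"
  assumes "b \<noteq> 0"
  shows "fls_nth (1 / (fls_X_inv - fls_const b)) m - fls_nth (1 / (fls_X - fls_const b)) (- m) = b powi (m - 1)"
proof (cases "m \<ge> 1")
  case True
  then show ?thesis
    by (simp add: fls_simple_pole_at_infinity fls_simple_pole_at_zero[OF assms] power_int_def)
next
  case False
  then have "b powi (m - 1) = inverse b ^ nat (1 - m)"
    by (simp add: power_int_def)
  moreover have "nat (1 - m) = nat (- m) + 1" using False by simp
  ultimately show ?thesis
    using False by (simp add: fls_simple_pole_at_infinity fls_simple_pole_at_zero[OF assms] inverse_eq_divide)
qed

lemma fls_X_neq_const: "fls_X \<noteq> fls_const (b :: 'a::field)" "fls_X_inv \<noteq> fls_const (b :: 'a::field)"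
proof
  assume "fls_X = fls_const b"
  then have "fls_nth (fls_X :: 'a fls) 1 = fls_nth (fls_const b) 1" by simp
  then show False by simp
next
  show "fls_X_inv \<noteq> fls_const b"
  proof
    assume "fls_X_inv = fls_const b"
    then have "fls_nth (fls_X_inv :: 'a fls) (-1) = fls_nth (fls_const b) (-1)" by simp
    then show False by simp
  qed
qed

lemma fls_const_diff: "fls_const (a - b) = fls_const a - fls_const (b :: 'k::field)"
  by (rule fls_eqI) simp

lemma fls_const_prod: "fls_const (\<Prod>i\<in>I. h i :: 'k::field) = (\<Prod>i\<in>I. fls_const (h i))"
  by (induction I rule: infinite_finite_induct) (simp_all flip: fls_const_mult_const)

text \<open>
  The difference of the two expansions of a rational function of degree zero with simple poles is
  a combination of delta functions supported at the poles, with the residues as coefficients.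
\<close>

lemma expansions_of_product:
  fixes \<alpha> \<beta> :: "'i \<Rightarrow> 'k::field" and k :: 'k
  assumes I: "finite I" "inj_on \<beta> I" "\<And>i. i \<in> I \<Longrightarrow> \<beta> i \<noteq> 0"
  defines "G \<equiv> \<lambda>z. fls_const k * (\<Prod>i\<in>I. (z - fls_const (\<alpha> i)) / (z - fls_const (\<beta> i)))"
  shows expansions_jump: "fls_nth (G fls_X_inv) m - fls_nth (G fls_X) (- m)
      = k * (\<Sum>i\<in>I. residue \<alpha> \<beta> I i * \<beta> i powi (m - 1))"
    and "m < 0 \<Longrightarrow> fls_nth (G fls_X_inv) m = 0"
    and "m < 0 \<Longrightarrow> fls_nth (G fls_X) m = 0"
    and "fls_nth (G fls_X_inv) 0 = k"
    and "fls_nth (G fls_X) 0 = k * (\<Prod>i\<in>I. \<alpha> i / \<beta> i)"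
proof -
  have res: "residue (\<lambda>i. fls_const (\<alpha> i)) (\<lambda>i. fls_const (\<beta> i)) I i = fls_const (residue \<alpha> \<beta> I i)" for i
    by (simp add: residue_def fls_const_diff[symmetric] fls_const_divide_const fls_const_prod[symmetric])
  have inj: "inj_on (\<lambda>i. fls_const (\<beta> i)) I"
  proof (rule inj_onI)
    fix i j assume "i \<in> I" "j \<in> I" "fls_const (\<beta> i) = fls_const (\<beta> j)"
    then show "i = j"
      using inj_onD[OF I(2)] fls_const_nth[of "\<beta> i" 0] fls_const_nth[of "\<beta> j" 0] by (metis)
  qed
  have G: "G z = fls_const k * (1 + (\<Sum>i\<in>I. fls_const (residue \<alpha> \<beta> I i) * (1 / (z - fls_const (\<beta> i)))))"
    if "z = fls_X \<or> z = fls_X_inv" for z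
    unfolding G_def
    by (subst partial_fractions[OF I(1) inj]) (use that fls_X_neq_const in \<open>auto simp: res dest: sym\<close>)
  have nth: "fls_nth (G z) n = k * ((if n = 0 then 1 else 0) + (\<Sum>i\<in>I. residue \<alpha> \<beta> I i * fls_nth (1 / (z - fls_const (\<beta> i))) n))"
    if "z = fls_X \<or> z = fls_X_inv" for z n
  proof -
    have "fls_nth (fls_const c / w) n = c * fls_nth (1 / w) n" for c and w :: "'k fls"
      by (simp add: divide_inverse)
    then show ?thesis unfolding G[OF that] by (simp add: fls_nth_sum)
  qed
  show "fls_nth (G fls_X_inv) m - fls_nth (G fls_X) (- m)
      = k * (\<Sum>i\<in>I. residue \<alpha> \<beta> I i * \<beta> i powi (m - 1))"
    unfolding nth[OF disjI1, OF refl] nth[OF disjI2, OF refl]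
    by (simp add: right_diff_distrib[symmetric] sum_subtractf[symmetric] fls_simple_pole_jump[symmetric] I(3)
        del: One_nat_def cong: sum.cong)
  show "fls_nth (G fls_X_inv) m = 0" if "m < 0"
    unfolding nth[OF disjI2, OF refl] using that by (simp add: fls_simple_pole_at_infinity)
  show "fls_nth (G fls_X) m = 0" if "m < 0"
    unfolding nth[OF disjI1, OF refl] using that by (simp add: fls_simple_pole_at_zero I(3))
  show "fls_nth (G fls_X_inv) 0 = k"
    unfolding nth[OF disjI2, OF refl] by (simp add: fls_simple_pole_at_infinity)
  have "(\<Prod>i\<in>I. (0 - \<alpha> i) / (0 - \<beta> i)) = 1 + (\<Sum>i\<in>I. residue \<alpha> \<beta> I i / (0 - \<beta> i))"
    by (rule partial_fractions[OF I(1,2)]) (use I(3) in auto)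
  then show "fls_nth (G fls_X) 0 = k * (\<Prod>i\<in>I. \<alpha> i / \<beta> i)"
    unfolding nth[OF disjI1, OF refl] by (simp add: fls_simple_pole_at_zero I(3))
qed

section \<open>The eigenvalue of the Cartan current, row by row\<close>

definition tall :: "nat \<Rightarrow> 'r diagrams \<Rightarrow> bool" where
  "tall L \<Lambda> \<longleftrightarrow> (\<forall>a. \<forall>k>L. row (\<Lambda> a) k = 0)"

lemma tall_ex:
  fixes \<Lambda> :: "'r::finite diagrams"
  obtains L where "tall L \<Lambda>" "n \<le> L"
proof -
  obtain L where "\<forall>a. \<forall>k>L. row (\<Lambda> a) k = 0" using rows_bound by blast
  then have "tall (max L n) \<Lambda>" by (simp add: tall_def)
  then show thesis using that by simp
qed

lemma tall_plus:
  assumes "tall L (plus_cell \<Lambda> (l, i, j))" "(l, i, j) \<in> addables (\<Lambda> :: 'r::finite diagrams)"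
  shows "tall L \<Lambda>" "1 \<le> j" "j \<le> L"
proof -
  have row: "row (plus_cell \<Lambda> (l, i, j) a) k = (if a = l \<and> k = j then row (\<Lambda> l) j + 1 else row (\<Lambda> a) k)" for a k
    by (rule row_plus_cell[OF assms(2)])
  have "row (plus_cell \<Lambda> (l, i, j) l) j \<noteq> 0" unfolding row by simp
  then show "j \<le> L" using assms(1) by (auto simp: tall_def not_less[symmetric])
  then show "tall L \<Lambda>" using assms(1) unfolding tall_def row by (metis linorder_not_le)
  show "1 \<le> j" using addables_quadrant[OF assms(2)] by (simp add: in_quadrant_def)
qed

lemma num_rows_zero: "num_rows \<mu> < k \<Longrightarrow> row \<mu> k = 0"
proof -
  have "\<forall>k>num_rows \<mu>. row \<mu> k = 0"
    unfolding num_rows_def by (rule LeastI_ex) (rule row_bound)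
  then show "num_rows \<mu> < k \<Longrightarrow> row \<mu> k = 0" by blast
qed

lemma num_rows_le: "(\<And>k. L < k \<Longrightarrow> row \<mu> k = 0) \<Longrightarrow> num_rows \<mu> \<le> L"
  unfolding num_rows_def by (rule Least_le) blast

text \<open>
  Every row \<open>k\<close> of a diagram contributes a possible pole at the weight \<open>pole \<Lambda> (a, k, True)\<close> of the
  cell after its end, and one at the weight \<open>pole \<Lambda> (a, k, False)\<close> of the last cell.  These are
  distinct, including the rows to which nothing can be added or from which nothing can be
  removed; for the latter the residue turns out to vanish.
\<close>

definition poles :: "nat \<Rightarrow> ('r \<times> nat \<times> bool) set" where
  "poles L = {(a, k, s). 1 \<le> k \<and> k \<le> (if s then L + 1 else L)}"

lemma poles_eq: "poles L = (\<lambda>(a, k). (a, k, True)) ` (UNIV \<times> {1..L + 1}) \<union> (\<lambda>(a, k). (a, k, False)) ` (UNIV \<times> {1..L})"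
  by (auto simp: poles_def image_iff)

lemma finite_poles [simp]: "finite (poles L :: ('r::finite \<times> nat \<times> bool) set)"
  by (simp add: poles_eq)

lemma prod_poles:
  fixes \<phi> :: "'r::finite \<times> nat \<times> bool \<Rightarrow> 'f::comm_monoid_mult"
  shows "(\<Prod>i\<in>poles L. \<phi> i) = (\<Prod>a\<in>UNIV. (\<Prod>k=1..L + 1. \<phi> (a, k, True)) * (\<Prod>k=1..L. \<phi> (a, k, False)))"
proof -
  have "(\<Prod>i\<in>poles L. \<phi> i) = (\<Prod>i\<in>(\<lambda>(a, k). (a, k, True)) ` (UNIV \<times> {1..L + 1}). \<phi> i) *
      (\<Prod>i\<in>(\<lambda>(a, k). (a, k, False)) ` (UNIV \<times> {1..L}). \<phi> i)"
    unfolding poles_eq by (rule prod.union_disjoint) auto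
  also have "\<dots> = (\<Prod>(a, k)\<in>UNIV \<times> {1..L + 1}. \<phi> (a, k, True)) * (\<Prod>(a, k)\<in>UNIV \<times> {1..L}. \<phi> (a, k, False))"
    by (subst (1 2) prod.reindex) (auto simp: inj_on_def case_prod_unfold)
  also have "\<dots> = (\<Prod>a\<in>UNIV. (\<Prod>k=1..L + 1. \<phi> (a, k, True)) * (\<Prod>k=1..L. \<phi> (a, k, False)))"
    by (simp only: prod.cartesian_product[symmetric] prod.distrib)
  finally show ?thesis .
qed

lemma prod_poles_rows:
  fixes \<phi> :: "'r::finite \<times> nat \<times> bool \<Rightarrow> 'f::comm_monoid_mult"
  shows "(\<Prod>i\<in>poles L. \<phi> i) =
    (\<Prod>p\<in>UNIV \<times> {1..L}. \<phi> (fst p, snd p, True) * \<phi> (fst p, snd p, False)) * (\<Prod>a\<in>UNIV. \<phi> (a, L + 1, True))"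
proof -
  have "(\<Prod>i\<in>poles L. \<phi> i) = (\<Prod>a\<in>UNIV. (\<Prod>k=1..L. \<phi> (a, k, True) * \<phi> (a, k, False)) * \<phi> (a, L + 1, True))"
    unfolding prod_poles by (rule prod.cong) (simp_all add: prod.distrib mult_ac)
  also have "\<dots> = (\<Prod>a\<in>UNIV. \<Prod>k=1..L. \<phi> (a, k, True) * \<phi> (a, k, False)) * (\<Prod>a\<in>UNIV. \<phi> (a, L + 1, True))"
    by (simp only: prod.distrib)
  also have "(\<Prod>a\<in>UNIV. \<Prod>k=1..L. \<phi> (a, k, True) * \<phi> (a, k, False)) =
      (\<Prod>p\<in>UNIV \<times> {1..L}. \<phi> (fst p, snd p, True) * \<phi> (fst p, snd p, False))"
    by (simp only: prod.cartesian_product case_prod_unfold)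
  finally show ?thesis .
qed

lemma product_swap:
  fixes r r' p q c s u :: "'f::comm_ring_1"
  assumes "r' * p = r * q"
  shows "c * (r' * s * u) * p = c * (r * s * u) * q"
proof -
  have "c * (r' * s * u) * p = (r' * p) * (c * s * u)" by (simp only: mult_ac)
  also have "\<dots> = c * (r * s * u) * q" unfolding assms by (simp only: mult_ac)
  finally show ?thesis .
qed

lemma product_swap_minus:
  fixes r r' p q c s u :: "'f::comm_ring_1"
  assumes "r' * p = - (r * q)"
  shows "c * (r' * s * u) * p = - (c * (r * s * u) * q)"
  using product_swap[of r' p r "- q" c s u] assms by simp

context toroidal_parameters
begin

definition pole :: "'r diagrams \<Rightarrow> 'r \<times> nat \<times> bool \<Rightarrow> 'k" where
  "pole \<Lambda> = (\<lambda>(a, k, s). mon (int (row (\<Lambda> a) k) - (if s then 0 else 1)) (int k - 1) a)"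

text \<open>
  The zeros are indexed such that each row contributes as many as it has poles.  The zero of
  \<open>(a, k + 1, True)\<close> coincides with the pole of \<open>(a, k, False)\<close>, and the zero of \<open>(a, k, False)\<close> with the pole
  of \<open>(a, k + 1, True)\<close>, if the rows \<open>k\<close> and \<open>k + 1\<close> have the same length.
\<close>

definition zero :: "'r diagrams \<Rightarrow> 'r \<times> nat \<times> bool \<Rightarrow> 'k" where
  "zero \<Lambda> = (\<lambda>(a, k, s). if s then mon (int (row (\<Lambda> a) k) - 1) (int k - 2) a else mon (int (row (\<Lambda> a) k)) (int k) a)"

lemma inj_pole: "inj (pole \<Lambda>)"
  by (rule injI) (auto simp: pole_def split: if_splits)

lemma pole_nonzero [simp]: "pole \<Lambda> i \<noteq> 0"
  by (simp add: pole_def split: prod.splits)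

lemma pole_addable: "(l, i, j) \<in> addables \<Lambda> \<Longrightarrow> pole \<Lambda> (l, j, True) = weight (l, i, j)"
  by (simp add: pole_def weight_def addables_iff)

lemma pole_removable: "(l, i, j) \<in> removables \<Lambda> \<Longrightarrow> pole \<Lambda> (l, j, False) = weight (l, i, j)"
  by (simp add: pole_def weight_def removables_iff)

definition eigenvalue :: "('k \<Rightarrow> 'f) \<Rightarrow> 'r diagrams \<Rightarrow> 'f \<Rightarrow> 'f::field" where
  "eigenvalue \<epsilon> \<Lambda> z = (\<Prod>l\<in>UNIV. fock_gamma \<epsilon> t1 t2 t (\<Lambda> l) (inverse (\<chi> l)) z)"

text \<open>
  In the definition of the eigenvalue the factor with index \<open>i\<close> involves the rows \<open>i\<close> and \<open>i + 1\<close>.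
  Regrouping by rows leaves an unpaired factor for the first row and one for the empty row \<open>L + 1\<close>.
\<close>

lemma fock_gamma_rows:
  fixes \<Lambda> :: "'r diagrams"
  assumes z: "\<And>i j. z \<noteq> \<epsilon> (mon i j a)" and L: "\<And>k. L < k \<Longrightarrow> row (\<Lambda> a) k = 0"
  shows "fock_gamma \<epsilon> t1 t2 t (\<Lambda> a) (inverse (\<chi> a)) z = \<epsilon> (inverse t) *
    ((\<Prod>k=1..L + 1. (z - \<epsilon> (zero \<Lambda> (a, k, True))) / (z - \<epsilon> (pole \<Lambda> (a, k, True)))) *
     (\<Prod>k=1..L. (z - \<epsilon> (zero \<Lambda> (a, k, False))) / (z - \<epsilon> (pole \<Lambda> (a, k, False)))))"
proof -
  define n where "n k = int (row (\<Lambda> a) k)" for k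
  define T where "T k = (z - \<epsilon> (mon (n k - 1) (int k - 2) a)) / (z - \<epsilon> (mon (n k) (int k - 1) a))" for k
  define U where "U k = (z - \<epsilon> (mon (n k) (int k) a)) / (z - \<epsilon> (mon (n k - 1) (int k - 1) a))" for k
  define N where "N = num_rows (\<Lambda> a)"
  have "t1 powi i * inverse t2 * inverse (\<chi> a) = mon i (-1) a" "t1 powi i * inverse (\<chi> a) = mon i 0 a" for i
    by (simp_all add: mon_def power_int_minus)
  moreover have "(z - \<epsilon> (mon (n k) (int k) a)) * (z - \<epsilon> (mon (n (k + 1) - 1) (int k - 1) a)) /
      ((z - \<epsilon> (mon (n (k + 1)) (int k) a)) * (z - \<epsilon> (mon (n k - 1) (int k - 1) a))) = U k * T (k + 1)" for k
    by (simp add: U_def T_def mult.commute)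
  ultimately have "fock_gamma \<epsilon> t1 t2 t (\<Lambda> a) (inverse (\<chi> a)) z = \<epsilon> (inverse t) * (T 1 * (\<Prod>k=1..N. U k * T (k + 1)))"
    unfolding fock_gamma_def Let_def mon_def[symmetric] n_def[symmetric] N_def
    by (simp add: T_def mult.assoc)
  also have "(\<Prod>k=1..N. U k * T (k + 1)) = (\<Prod>k=1..L. U k * T (k + 1))"
  proof (rule prod.mono_neutral_left)
    show "\<forall>k\<in>{1..L} - {1..N}. U k * T (k + 1) = 1"
    proof
      fix k assume "k \<in> {1..L} - {1..N}"
      then have "n k = 0" "n (k + 1) = 0" by (auto simp: n_def N_def num_rows_zero)
      then show "U k * T (k + 1) = 1"
        using z by (simp add: U_def T_def)
    qed
    show "{1..N} \<subseteq> {1..L}" using num_rows_le[of L "\<Lambda> a"] L by (simp add: N_def)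
  qed simp
  also have "T 1 * (\<Prod>k=1..L. U k * T (k + 1)) = (\<Prod>k=1..L + 1. T k) * (\<Prod>k=1..L. U k)"
    by (induction L) (simp_all add: mult_ac)
  finally show ?thesis
    by (simp only: T_def U_def n_def zero_def pole_def prod.case if_True if_False diff_0_right)
qed

definition row_factor :: "('k \<Rightarrow> 'f) \<Rightarrow> 'r diagrams \<Rightarrow> 'f \<Rightarrow> 'r \<times> nat \<Rightarrow> 'f::field" where
  "row_factor \<epsilon> \<Lambda> z p =
     (z - \<epsilon> (zero \<Lambda> (fst p, snd p, True))) / (z - \<epsilon> (pole \<Lambda> (fst p, snd p, True))) *
     ((z - \<epsilon> (zero \<Lambda> (fst p, snd p, False))) / (z - \<epsilon> (pole \<Lambda> (fst p, snd p, False))))"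

text \<open>
  The contribution of the empty row \<open>L + 1\<close>.
\<close>

definition tail_factor :: "('k \<Rightarrow> 'f) \<Rightarrow> nat \<Rightarrow> 'f \<Rightarrow> 'r \<Rightarrow> 'f::field" where
  "tail_factor \<epsilon> L z a = (z - \<epsilon> (mon (-1) (int L - 1) a)) / (z - \<epsilon> (mon 0 (int L) a))"

lemma tail_factor_eq:
  "tall L \<Lambda> \<Longrightarrow> (z - \<epsilon> (zero \<Lambda> (a, L + 1, True))) / (z - \<epsilon> (pole \<Lambda> (a, L + 1, True))) = tail_factor \<epsilon> L z a"
  by (simp add: tail_factor_def zero_def pole_def tall_def)

lemma eigenvalue_poles:
  assumes "\<And>i j a. z \<noteq> \<epsilon> (mon i j a)" "tall L \<Lambda>"
  shows "eigenvalue \<epsilon> \<Lambda> z = \<epsilon> (inverse t) ^ card (UNIV :: 'r set) *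
    (\<Prod>i\<in>poles L. (z - \<epsilon> (zero \<Lambda> i)) / (z - \<epsilon> (pole \<Lambda> i)))"
proof -
  have "eigenvalue \<epsilon> \<Lambda> z = (\<Prod>a\<in>UNIV. \<epsilon> (inverse t) *
    ((\<Prod>k=1..L + 1. (z - \<epsilon> (zero \<Lambda> (a, k, True))) / (z - \<epsilon> (pole \<Lambda> (a, k, True)))) *
     (\<Prod>k=1..L. (z - \<epsilon> (zero \<Lambda> (a, k, False))) / (z - \<epsilon> (pole \<Lambda> (a, k, False))))))"
    unfolding eigenvalue_def using assms
    by (intro prod.cong refl fock_gamma_rows) (auto simp: tall_def)
  then show ?thesis
    unfolding prod_poles prod.distrib by simp
qed

lemma row_factor_other:
  assumes "(l, i, j) \<in> addables \<Lambda>" "p \<noteq> (l, j)"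
  shows "row_factor \<epsilon> (plus_cell \<Lambda> (l, i, j)) z p = row_factor \<epsilon> \<Lambda> z p"
  using assms(2) row_plus_cell[OF assms(1), of "fst p" "snd p"]
  by (cases p) (auto simp: row_factor_def zero_def pole_def)

lemma weight_addable: "(l, i, j) \<in> addables \<Lambda> \<Longrightarrow> weight (l, i, j) = mon (int (row (\<Lambda> l) j)) (int j - 1) l"
  by (simp add: weight_def addables_iff)

lemma t_div_mon:
  shows "mon i j a / t1 = mon (i - 1) j a" "mon i j a / t2 = mon i (j - 1) a" "mon i j a / t3 = mon (i + 1) (j + 1) a"
  by (simp_all add: mon_def power_int_add power_int_diff t3_def field_simps)

text \<open>
  With \<open>w\<close> the weight of the new cell, the poles of the row move from \<open>w\<close> and \<open>w / t1\<close> to \<open>t1 * w\<close> and \<open>w\<close>, and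
  its zeros from \<open>t3 * w\<close> and \<open>t2 * w\<close> to \<open>w / t2\<close> and \<open>w / t3\<close>.
\<close>

lemma row_factor_shift:
  assumes b: "(l, i, j) \<in> addables \<Lambda>"
    and z: "z \<noteq> \<epsilon> (weight (l, i, j))" "z \<noteq> \<epsilon> (t1 * weight (l, i, j))" "z \<noteq> \<epsilon> (weight (l, i, j) / t1)"
  defines "w \<equiv> weight (l, i, j)"
  shows "row_factor \<epsilon> (plus_cell \<Lambda> (l, i, j)) z (l, j) * ((z - \<epsilon> (t1 * w)) * (z - \<epsilon> (t2 * w)) * (z - \<epsilon> (t3 * w))) =
    row_factor \<epsilon> \<Lambda> z (l, j) * ((z - \<epsilon> (w / t1)) * (z - \<epsilon> (w / t2)) * (z - \<epsilon> (w / t3)))"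
proof -
  define n where "n = int (row (\<Lambda> l) j)"
  have w: "w = mon n (int j - 1) l" by (simp add: w_def n_def weight_addable[OF b])
  have n': "int (row (plus_cell \<Lambda> (l, i, j) l) j) = n + 1"
    by (simp add: row_plus_cell[OF b] n_def)
  have z': "z - \<epsilon> (mon n (int j - 1) l) \<noteq> 0" "z - \<epsilon> (mon (n + 1) (int j - 1) l) \<noteq> 0" "z - \<epsilon> (mon (n - 1) (int j - 1) l) \<noteq> 0"
    using z w[unfolded w_def] by (auto simp: t1_mon t_div_mon)
  show ?thesis
    unfolding row_factor_def zero_def pole_def fst_conv snd_conv prod.case if_True if_False n' n_def[symmetric]
      w t1_mon t2_mon t3_mon t_div_mon
    using z' by (simp add: divide_simps)
qed

lemma fock_gamma_row_factors:
  fixes \<Lambda> :: "'r diagrams"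
  assumes z: "\<And>i j. z \<noteq> \<epsilon> (mon i j a)" and L: "tall L \<Lambda>"
  shows "fock_gamma \<epsilon> t1 t2 t (\<Lambda> a) (inverse (\<chi> a)) z =
    \<epsilon> (inverse t) * ((\<Prod>k=1..L. row_factor \<epsilon> \<Lambda> z (a, k)) * tail_factor \<epsilon> L z a)"
proof -
  have "row (\<Lambda> a) k = 0" if "L < k" for k
    using L that by (simp add: tall_def)
  note rows = fock_gamma_rows[where z = z and \<epsilon> = \<epsilon> and a = a and L = L and \<Lambda> = \<Lambda>, OF z this]
  show ?thesis
    unfolding row_factor_def prod.distrib fst_conv snd_conv tail_factor_eq[OF L, symmetric]
    by (subst rows) (simp_all add: mult_ac)
qed

text \<open>
  Only the row of the new cell changes, so the eigenvalue is multiplied by the ratio which the relation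
  between \<open>\<psi>(z)\<close> and \<open>e(w)\<close> requires.
\<close>

lemma fock_gamma_plus:
  assumes z: "\<And>i j. z \<noteq> \<epsilon> (mon i j l)" and b: "(l, i, j) \<in> addables \<Lambda>"
  defines "w \<equiv> weight (l, i, j)"
  shows "fock_gamma \<epsilon> t1 t2 t (plus_cell \<Lambda> (l, i, j) l) (inverse (\<chi> l)) z
      * ((z - \<epsilon> (t1 * w)) * (z - \<epsilon> (t2 * w)) * (z - \<epsilon> (t3 * w))) =
    fock_gamma \<epsilon> t1 t2 t (\<Lambda> l) (inverse (\<chi> l)) z
      * ((z - \<epsilon> (w / t1)) * (z - \<epsilon> (w / t2)) * (z - \<epsilon> (w / t3)))"
proof -
  obtain L where L': "tall L (plus_cell \<Lambda> (l, i, j))" using tall_ex by blast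
  note L = tall_plus[OF L' b]
  have j: "j \<in> {1..L}" using L by simp
  have split: "(\<Prod>k=1..L. row_factor \<epsilon> M z (l, k)) =
      row_factor \<epsilon> M z (l, j) * (\<Prod>k\<in>{1..L} - {j}. row_factor \<epsilon> M z (l, k))" for M
    by (rule prod.remove[OF _ j]) simp
  have other: "(\<Prod>k\<in>{1..L} - {j}. row_factor \<epsilon> (plus_cell \<Lambda> (l, i, j)) z (l, k)) =
      (\<Prod>k\<in>{1..L} - {j}. row_factor \<epsilon> \<Lambda> z (l, k))"
    by (rule prod.cong) (auto intro: row_factor_other[OF b])
  have shift: "row_factor \<epsilon> (plus_cell \<Lambda> (l, i, j)) z (l, j) * ((z - \<epsilon> (t1 * w)) * (z - \<epsilon> (t2 * w)) * (z - \<epsilon> (t3 * w))) =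
    row_factor \<epsilon> \<Lambda> z (l, j) * ((z - \<epsilon> (w / t1)) * (z - \<epsilon> (w / t2)) * (z - \<epsilon> (w / t3)))"
    unfolding w_def
    by (rule row_factor_shift[OF b]) (use z in \<open>auto simp: weight_addable[OF b] t1_mon t_div_mon\<close>)
  show ?thesis
    unfolding fock_gamma_row_factors[where z = z and \<epsilon> = \<epsilon> and a = l, OF z L']
      fock_gamma_row_factors[where z = z and \<epsilon> = \<epsilon> and a = l, OF z L(1)] split other
    by (rule product_swap[OF shift])
qed

lemma plus_cell_other: "(l, i, j) \<in> addables (\<Lambda> :: 'r diagrams) \<Longrightarrow> a \<noteq> l \<Longrightarrow> plus_cell \<Lambda> (l, i, j) a = \<Lambda> a"
  using row_plus_cell[of l i j \<Lambda> a] by (simp add: row_inject[symmetric] fun_eq_iff)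

lemma eigenvalue_plus:
  assumes z: "\<And>i j a. z \<noteq> \<epsilon> (mon i j a)" and b: "b \<in> addables \<Lambda>"
  defines "w \<equiv> weight b"
  shows "eigenvalue \<epsilon> (plus_cell \<Lambda> b) z * ((z - \<epsilon> (t1 * w)) * (z - \<epsilon> (t2 * w)) * (z - \<epsilon> (t3 * w))) =
    eigenvalue \<epsilon> \<Lambda> z * ((z - \<epsilon> (w / t1)) * (z - \<epsilon> (w / t2)) * (z - \<epsilon> (w / t3)))"
proof -
  obtain l i j where b_eq: "b = (l, i, j)" by (cases b) auto
  note b' = b[unfolded b_eq]
  have split: "eigenvalue \<epsilon> M z = fock_gamma \<epsilon> t1 t2 t (M l) (inverse (\<chi> l)) z *
      (\<Prod>a\<in>UNIV - {l}. fock_gamma \<epsilon> t1 t2 t (M a) (inverse (\<chi> a)) z)" for M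
    unfolding eigenvalue_def by (rule prod.remove) auto
  have other: "(\<Prod>a\<in>UNIV - {l}. fock_gamma \<epsilon> t1 t2 t (plus_cell \<Lambda> (l, i, j) a) (inverse (\<chi> a)) z) =
      (\<Prod>a\<in>UNIV - {l}. fock_gamma \<epsilon> t1 t2 t (\<Lambda> a) (inverse (\<chi> a)) z)"
    by (rule prod.cong) (auto simp: plus_cell_other[OF b'])
  show ?thesis
    unfolding w_def b_eq split other
    using product_swap[where c = 1 and u = 1, OF fock_gamma_plus[where z = z and \<epsilon> = \<epsilon> and l = l, OF z b']]
    unfolding mult_1_left mult_1_right by blast
qed


subsection \<open>Residues at the ends of the rows\<close>

abbreviation end_residue :: "nat \<Rightarrow> 'r diagrams \<Rightarrow> 'r \<times> nat \<times> bool \<Rightarrow> 'k" where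
  "end_residue L \<Lambda> \<equiv> residue (zero \<Lambda>) (pole \<Lambda>) (poles L)"

text \<open>
  The pole itself only involves its own row; the other rows contribute their factors of the eigenvalue,
  evaluated at the pole.
\<close>

lemma residue_rows:
  fixes l :: 'r and s :: bool
  assumes L: "tall L \<Lambda>" "1 \<le> j" "j \<le> L"
  defines "x \<equiv> pole \<Lambda> (l, j, s)"
  shows "end_residue L \<Lambda> (l, j, s) =
    (x - zero \<Lambda> (l, j, True)) * (x - zero \<Lambda> (l, j, False)) / (x - pole \<Lambda> (l, j, \<not> s)) *
    ((\<Prod>p\<in>UNIV \<times> {1..L} - {(l, j)}. row_factor id \<Lambda> x p) * (\<Prod>a\<in>UNIV. tail_factor id L x a))"
proof -
  define \<phi> where "\<phi> i = (if i = (l, j, s) then x - zero \<Lambda> i else (x - zero \<Lambda> i) / (x - pole \<Lambda> i))" for i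
  have mem: "(l, j, s) \<in> poles L" using L by (simp add: poles_def)
  have "end_residue L \<Lambda> (l, j, s) = \<phi> (l, j, s) * (\<Prod>i\<in>poles L - {(l, j, s)}. \<phi> i)"
    unfolding residue_def \<phi>_def x_def[symmetric] by simp
  also have "\<dots> = (\<Prod>i\<in>poles L. \<phi> i)"
    by (rule prod.remove[symmetric]) (simp_all add: mem)
  also have "\<dots> = \<phi> (l, j, True) * \<phi> (l, j, False) *
      (\<Prod>p\<in>UNIV \<times> {1..L} - {(l, j)}. \<phi> (fst p, snd p, True) * \<phi> (fst p, snd p, False)) * (\<Prod>a\<in>UNIV. \<phi> (a, L + 1, True))"
    unfolding prod_poles_rows by (subst prod.remove[of _ "(l, j)"]) (use L in auto)
  also have "(\<Prod>p\<in>UNIV \<times> {1..L} - {(l, j)}. \<phi> (fst p, snd p, True) * \<phi> (fst p, snd p, False)) =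
      (\<Prod>p\<in>UNIV \<times> {1..L} - {(l, j)}. row_factor id \<Lambda> x p)"
    by (rule prod.cong) (auto simp: \<phi>_def row_factor_def)
  also have "(\<Prod>a\<in>UNIV. \<phi> (a, L + 1, True)) = (\<Prod>a\<in>UNIV. tail_factor id L x a)"
    using L by (intro prod.cong) (auto simp: \<phi>_def tail_factor_eq[where \<epsilon> = id, OF L(1), symmetric])
  also have "\<phi> (l, j, True) * \<phi> (l, j, False) =
      (x - zero \<Lambda> (l, j, True)) * (x - zero \<Lambda> (l, j, False)) / (x - pole \<Lambda> (l, j, \<not> s))"
    by (cases s) (simp_all add: \<phi>_def)
  finally show ?thesis by (simp only: mult.assoc)
qed

lemma zw_poly_reflect: "zw_poly y x = - ((x - y / t1) * (x - y / t2) * (x - y / t3))"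
proof -
  have "(y - t1 * x) * (y - t2 * x) * (y - t3 * x) =
      - ((t1 * t2 * t3) * ((x - y / t1) * (x - y / t2) * (x - y / t3)))"
    by (simp add: field_simps)
  then show ?thesis by (simp add: zw_poly_def t_product)
qed

text \<open>
  The new cell lies in another row, whose factor it changes by the ratio of the quadratic relations.
\<close>

lemma residue_plus_other:
  assumes ab: "a \<in> addables \<Lambda>" "(l, i, j) \<in> addables \<Lambda>" "a \<noteq> (l, i, j)" and L: "tall L (plus_cell \<Lambda> a)" "j \<le> L"
  shows "end_residue L (plus_cell \<Lambda> a) (l, j, True) * zw_poly (weight (l, i, j)) (weight a) =
    - (end_residue L \<Lambda> (l, j, True) * zw_poly (weight a) (weight (l, i, j)))"
proof -
  obtain l' i' j' where a: "a = (l', i', j')" by (cases a) auto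
  note ab' = ab(1)[unfolded a]
  define x where "x = weight (l, i, j)"
  define y where "y = weight a"
  have jL: "tall L \<Lambda>" "1 \<le> j'" "j' \<le> L"
    using tall_plus[OF L(1)[unfolded a] ab'] by auto
  have j: "1 \<le> j" using addables_quadrant[OF ab(2)] by (simp add: in_quadrant_def)
  have pos: "(l', j') \<noteq> (l, j)" using ab unfolding a by (auto simp: addables_iff)
  have b': "(l, i, j) \<in> addables (plus_cell \<Lambda> a)" by (rule addables_plus_cell[OF ab])
  have px: "pole \<Lambda> (l, j, True) = x" "pole (plus_cell \<Lambda> a) (l, j, True) = x"
    by (simp_all add: x_def pole_addable[OF ab(2)] pole_addable[OF b'])
  have same: "zero (plus_cell \<Lambda> a) (l, j, s) = zero \<Lambda> (l, j, s)" "pole (plus_cell \<Lambda> a) (l, j, s) = pole \<Lambda> (l, j, s)" for s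
    using pos by (auto simp: zero_def pole_def a row_plus_cell[OF ab'])
  have p: "(l', j') \<in> UNIV \<times> {1..L} - {(l, j)}" using pos jL by simp
  have split: "(\<Prod>p\<in>UNIV \<times> {1..L} - {(l, j)}. row_factor id M x p) =
      row_factor id M x (l', j') * (\<Prod>p\<in>UNIV \<times> {1..L} - {(l, j)} - {(l', j')}. row_factor id M x p)" for M
    by (rule prod.remove[OF _ p]) simp
  have other: "(\<Prod>p\<in>UNIV \<times> {1..L} - {(l, j)} - {(l', j')}. row_factor id (plus_cell \<Lambda> a) x p) =
      (\<Prod>p\<in>UNIV \<times> {1..L} - {(l, j)} - {(l', j')}. row_factor id \<Lambda> x p)"
    unfolding a by (rule prod.cong) (auto intro: row_factor_other[OF ab'])
  have ne: "x \<noteq> y" "x \<noteq> t1 * y" "x \<noteq> y / t1"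
    using two_addables[OF ab] two_addables[of "(l, i, j)" \<Lambda> a] ab
    by (auto simp: x_def y_def weight_precedes field_simps)
  have "row_factor id (plus_cell \<Lambda> a) x (l', j') * zw_poly x y = - (row_factor id \<Lambda> x (l', j') * zw_poly y x)"
    using row_factor_shift[OF ab', of x id] ne
    by (simp add: a[symmetric] y_def[symmetric] zw_poly_reflect[of y x] zw_poly_def[of x y])
  then show ?thesis
    unfolding residue_rows[OF L(1) j L(2)] residue_rows[OF jL(1) j L(2)] px same split other
      x_def[symmetric] y_def[symmetric]
    by (rule product_swap_minus)
qed

text \<open>
  When the cell at a pole is added, the pole stays, but now belongs to the last cell of its row.  The
  change of sign is that of \<open>e f\<close> against \<open>f e\<close> in the commutator.
\<close>

lemma residue_plus_self:
  assumes b: "(l, i, j) \<in> addables \<Lambda>" and L: "tall L (plus_cell \<Lambda> (l, i, j))"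
  shows "end_residue L (plus_cell \<Lambda> (l, i, j)) (l, j, False) = - end_residue L \<Lambda> (l, j, True)"
proof -
  let ?M = "plus_cell \<Lambda> (l, i, j)"
  define n where "n = int (row (\<Lambda> l) j)"
  define x where "x = weight (l, i, j)"
  have x_mon: "x = mon n (int j - 1) l" by (simp add: x_def n_def weight_addable[OF b])
  have n': "int (row (?M l) j) = n + 1"
    by (simp add: row_plus_cell[OF b] n_def)
  note L' = tall_plus[OF L b]
  have px: "pole \<Lambda> (l, j, True) = x" "pole ?M (l, j, False) = x"
    using pole_addable[OF b] pole_removable[OF removables_plus_cell[OF b]] by (simp_all add: x_def)
  have ends: "zero ?M (l, j, True) = x / t2" "zero ?M (l, j, False) = x / t3" "pole ?M (l, j, True) = t1 * x"
    "zero \<Lambda> (l, j, True) = t3 * x" "zero \<Lambda> (l, j, False) = t2 * x" "pole \<Lambda> (l, j, False) = x / t1"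
    by (simp_all add: zero_def pole_def n' n_def[symmetric] x_mon t1_mon t2_mon t3_mon t_div_mon)
  have other: "(\<Prod>p\<in>UNIV \<times> {1..L} - {(l, j)}. row_factor id ?M x p) =
      (\<Prod>p\<in>UNIV \<times> {1..L} - {(l, j)}. row_factor id \<Lambda> x p)"
    by (rule prod.cong) (auto intro: row_factor_other[OF b])
  have t1: "t1 \<noteq> 1" using mon_eq_iff[of 1 0 l 0 0 l] by (auto simp: mon_def)
  have "(x - x / t2) * (x - x / t3) / (x - t1 * x) = - ((x - t3 * x) * (x - t2 * x) / (x - x / t1))"
  proof -
    have "x \<noteq> 0" by (simp add: x_def)
    have "(x - x / t2) * (x - x / t3) / (x - t1 * x) = x * ((1 - 1 / t2) * (1 - t1 * t2) / (1 - t1))"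
      using \<open>x \<noteq> 0\<close> t1 by (simp add: t3_def field_simps)
    also have "\<dots> = - (x * ((1 - 1 / (t1 * t2)) * (1 - t2) / (1 - 1 / t1)))"
      using t1 by (simp add: divide_simps) (simp add: algebra_simps)
    also have "x * ((1 - 1 / (t1 * t2)) * (1 - t2) / (1 - 1 / t1)) = (x - t3 * x) * (x - t2 * x) / (x - x / t1)"
      using \<open>x \<noteq> 0\<close> t1 by (simp add: t3_def divide_simps) (simp add: algebra_simps)
    finally show ?thesis .
  qed
  then show ?thesis
    unfolding residue_rows[OF L L'(2,3)] residue_rows[OF L'] px not_True_eq_False not_False_eq_True ends other
    by simp
qed

lemma residue_eq_0:
  assumes "i \<in> poles L" "i' \<in> poles L" "i' \<noteq> i" "zero \<Lambda> i' = pole \<Lambda> i"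
  shows "end_residue L \<Lambda> i = 0"
  using assms by (auto simp: residue_def prod_zero_iff intro!: bexI[of _ i'])

text \<open>
  If no cell can be added to a row, then the preceding row has the same length and its zero cancels the
  pole.
\<close>

lemma residue_not_addable:
  assumes "(a, k, True) \<in> poles L" "(a, row (\<Lambda> a) k + 1, k) \<notin> addables \<Lambda>"
  shows "end_residue L \<Lambda> (a, k, True) = 0"
proof (cases "1 < k \<and> row (\<Lambda> a) k = row (\<Lambda> a) (k - 1)")
  case True
  then show ?thesis
    using assms(1) by (intro residue_eq_0[where i' = "(a, k - 1, False)"]) (auto simp: poles_def zero_def pole_def)
next
  case False
  have k: "1 \<le> k" using assms(1) by (simp add: poles_def)
  have "row (\<Lambda> a) k + 1 \<le> row (\<Lambda> a) (k - 1)" if "1 < k"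
  proof -
    have "1 \<le> k - 1" using that by simp
    then have "row (\<Lambda> a) k \<le> row (\<Lambda> a) (k - 1)" by (rule row_antimono) simp
    then show ?thesis using False that by linarith
  qed
  then have "addable (\<Lambda> a) k"
    unfolding addable_def using k row_Suc_le[OF k, of "\<Lambda> a"]
    by (intro is_diagram_fun_upd is_diagram_row) auto
  then show ?thesis using assms(2) by (simp add: addables_iff)
qed

text \<open>
  If the last cell of a row cannot be removed, then the next row has the same length and its zero cancels
  the pole.
\<close>

lemma residue_not_removable:
  assumes "(a, k, False) \<in> poles L" "(a, row (\<Lambda> a) k, k) \<notin> removables \<Lambda>"
  shows "end_residue L \<Lambda> (a, k, False) = 0"
proof (cases "row (\<Lambda> a) (k + 1) = row (\<Lambda> a) k")
  case True
  then show ?thesis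
    using assms(1) by (intro residue_eq_0[where i' = "(a, k + 1, True)"]) (auto simp: poles_def zero_def pole_def)
next
  case False
  have k: "1 \<le> k" using assms(1) by (simp add: poles_def)
  have "row (\<Lambda> a) (k + 1) < row (\<Lambda> a) k"
    using False row_Suc_le[OF k, of "\<Lambda> a"] by simp
  then have "removable (\<Lambda> a) k"
    unfolding removable_def
  proof (intro conjI is_diagram_fun_upd is_diagram_row k)
    show "row (\<Lambda> a) k - 1 \<le> row (\<Lambda> a) (k - 1)" if "1 < k"
    proof -
      have "1 \<le> k - 1" using that by simp
      then have "row (\<Lambda> a) k \<le> row (\<Lambda> a) (k - 1)" by (rule row_antimono) simp
      then show ?thesis by linarith
    qed
  qed auto
  then show ?thesis using assms(2) by (simp add: removables_iff)
qed

lemma sum_end_residues: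
  assumes L: "tall L \<Lambda>"
  shows "(\<Sum>i\<in>poles L. end_residue L \<Lambda> i * h (pole \<Lambda> i)) =
    (\<Sum>(l, i, j)\<in>addables \<Lambda>. end_residue L \<Lambda> (l, j, True) * h (weight (l, i, j))) +
    (\<Sum>(l, i, j)\<in>removables \<Lambda>. end_residue L \<Lambda> (l, j, False) * h (weight (l, i, j)))"
proof -
  let ?f = "\<lambda>i. end_residue L \<Lambda> i * h (pole \<Lambda> i)"
  let ?A = "(\<lambda>(l, i, j). (l, j, True)) ` addables \<Lambda>" and ?R = "(\<lambda>(l, i, j). (l, j, False)) ` removables \<Lambda>"
  have A: "?A \<subseteq> poles L"
  proof clarify
    fix l i j assume b: "(l, i, j) \<in> addables \<Lambda>"
    then show "(l, j, True) \<in> poles L"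
      using addable_le[of "\<Lambda> l" j L] L addables_quadrant[OF b]
      by (auto simp: poles_def addables_iff in_quadrant_def tall_def)
  qed
  have R: "?R \<subseteq> poles L"
  proof clarify
    fix l i j assume b: "(l, i, j) \<in> removables \<Lambda>"
    then have "row (\<Lambda> l) j \<noteq> 0" "1 \<le> j"
      using cells_quadrant[OF removables_in[OF b]] by (auto simp: removables_iff in_quadrant_def)
    then show "(l, j, False) \<in> poles L"
      using L by (auto simp: poles_def tall_def not_less[symmetric])
  qed
  have "?f i = 0" if "i \<in> poles L - (?A \<union> ?R)" for i
  proof -
    obtain a k s where i: "i = (a, k, s)" by (cases i) auto
    show ?thesis
    proof (cases s)
      case True
      then have "(a, row (\<Lambda> a) k + 1, k) \<notin> addables \<Lambda>" using that i by (auto simp: image_iff)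
      then show ?thesis using residue_not_addable[of a k L \<Lambda>] that i True by auto
    next
      case False
      then have "(a, row (\<Lambda> a) k, k) \<notin> removables \<Lambda>" using that i by (auto simp: image_iff)
      then show ?thesis using residue_not_removable[of a k L \<Lambda>] that i False by auto
    qed
  qed
  then have "(\<Sum>i\<in>poles L. ?f i) = (\<Sum>i\<in>?A \<union> ?R. ?f i)"
    using A R by (intro sum.mono_neutral_right) auto
  also have "\<dots> = (\<Sum>i\<in>?A. ?f i) + (\<Sum>i\<in>?R. ?f i)"
    by (rule sum.union_disjoint) auto
  also have "(\<Sum>i\<in>?A. ?f i) = (\<Sum>(l, i, j)\<in>addables \<Lambda>. end_residue L \<Lambda> (l, j, True) * h (weight (l, i, j)))"
    by (subst sum.reindex) (auto simp: inj_on_def addables_iff pole_addable intro!: sum.cong)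
  also have "(\<Sum>i\<in>?R. ?f i) = (\<Sum>(l, i, j)\<in>removables \<Lambda>. end_residue L \<Lambda> (l, j, False) * h (weight (l, i, j)))"
    by (subst sum.reindex) (auto simp: inj_on_def removables_iff pole_removable intro!: sum.cong)
  finally show ?thesis .
qed

end

section \<open>Modules with box-adding and box-removing currents\<close>

lemma lin_mult_zw: "(\<And>a b. lin (\<lambda>v. D v a b)) \<Longrightarrow> lin (\<lambda>v. mult_zw scale q1 q2 q3 (D v) a b)"
  and lin_mult_wz: "(\<And>a b. lin (\<lambda>v. D v a b)) \<Longrightarrow> lin (\<lambda>v. mult_wz scale q1 q2 q3 (D v) a b)"
  unfolding mult_zw_def mult_wz_def mult_z_minus_def mult_w_minus_def
  by (intro lin_diff lin_scale | assumption)+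

text \<open>
  The effect of multiplying a series by \<open>z - y\<close> on the coefficients of \<open>z\<^sup>-\<^sup>m\<close>.
\<close>

definition shift_minus :: "'k \<Rightarrow> (int \<Rightarrow> 'k) \<Rightarrow> int \<Rightarrow> 'k::field" where
  "shift_minus y h m = h (m + 1) - y * h m"

lemma shift_minus_fls:
  shows "shift_minus y (fls_nth f) = fls_nth ((fls_X_inv - fls_const y) * f)"
    and "shift_minus y (\<lambda>m. fls_nth f (- m)) = (\<lambda>m. fls_nth ((fls_X - fls_const y) * f) (- m))"
  by (auto simp: shift_minus_def fun_eq_iff left_diff_distrib fls_X_times_conv_shift fls_X_inv_times_conv_shift)

context toroidal_parameters
begin

lemma t_neq_1 [simp]: "t1 \<noteq> 1" "t2 \<noteq> 1" "t3 \<noteq> 1"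
proof -
  fix a :: 'r
  show "t1 \<noteq> 1" using mon_eq_iff[of 1 0 a 0 0 a] by (auto simp: mon_def)
  show "t2 \<noteq> 1" using mon_eq_iff[of 0 1 a 0 0 a] by (auto simp: mon_def)
  show "t3 \<noteq> 1" using t3_mon[of 0 0 a] mon_eq_iff[of "-1" "-1" a 0 0 a] by auto
qed

lemma mult_minus_shift:
  assumes v: "\<And>\<tau>. \<tau> \<in> T \<Longrightarrow> v \<tau> \<noteq> 0" and q: "q \<noteq> 0"
  shows "mult_z_minus scale q (\<lambda>a b. \<Sum>\<tau>\<in>T. Poly_Mapping.single (B \<tau>) (k \<tau> * (h \<tau> a * v \<tau> powi b))) =
      (\<lambda>a b. \<Sum>\<tau>\<in>T. Poly_Mapping.single (B \<tau>) (k \<tau> * (shift_minus (q * v \<tau>) (h \<tau>) a * v \<tau> powi b)))"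
    and "mult_w_minus scale q (\<lambda>a b. \<Sum>\<tau>\<in>T. Poly_Mapping.single (B \<tau>) (k \<tau> * (h \<tau> a * v \<tau> powi b))) =
      (\<lambda>a b. \<Sum>\<tau>\<in>T. Poly_Mapping.single (B \<tau>) (- q * k \<tau> * (shift_minus (v \<tau> / q) (h \<tau>) a * v \<tau> powi b)))"
  using assms
  by (intro ext; simp add: mult_z_minus_def mult_w_minus_def scale_sum_right sum_subtractf[symmetric]
      single_diff[symmetric] power_int_add shift_minus_def algebra_simps cong: sum.cong)+

text \<open>
  The polynomial of the relations acts on a term of weight \<open>v \<tau>\<close> as its value at \<open>w = v \<tau>\<close>, which leaves
  three factors in \<open>z\<close>.
\<close>

lemma mult_zw_shift:
  assumes v: "\<And>\<tau>. \<tau> \<in> T \<Longrightarrow> v \<tau> \<noteq> 0"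
  shows "mult_zw scale t1 t2 t3 (\<lambda>a b. \<Sum>\<tau>\<in>T. Poly_Mapping.single (B \<tau>) (k \<tau> * (h \<tau> a * v \<tau> powi b))) a b =
      (\<Sum>\<tau>\<in>T. Poly_Mapping.single (B \<tau>) (k \<tau> *
        (shift_minus (t1 * v \<tau>) (shift_minus (t2 * v \<tau>) (shift_minus (t3 * v \<tau>) (h \<tau>))) a * v \<tau> powi b)))"
    and "mult_wz scale t1 t2 t3 (\<lambda>a b. \<Sum>\<tau>\<in>T. Poly_Mapping.single (B \<tau>) (k \<tau> * (h \<tau> a * v \<tau> powi b))) a b =
      - (\<Sum>\<tau>\<in>T. Poly_Mapping.single (B \<tau>) (k \<tau> *
        (shift_minus (v \<tau> / t1) (shift_minus (v \<tau> / t2) (shift_minus (v \<tau> / t3) (h \<tau>))) a * v \<tau> powi b)))"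
proof -
  show "mult_zw scale t1 t2 t3 (\<lambda>a b. \<Sum>\<tau>\<in>T. Poly_Mapping.single (B \<tau>) (k \<tau> * (h \<tau> a * v \<tau> powi b))) a b =
      (\<Sum>\<tau>\<in>T. Poly_Mapping.single (B \<tau>) (k \<tau> *
        (shift_minus (t1 * v \<tau>) (shift_minus (t2 * v \<tau>) (shift_minus (t3 * v \<tau>) (h \<tau>))) a * v \<tau> powi b)))"
    unfolding mult_zw_def
    by (subst mult_minus_shift(1)[OF v t3_nonzero], assumption, subst mult_minus_shift(1)[OF v t2_nonzero], assumption,
        subst mult_minus_shift(1)[OF v t1_nonzero], assumption, rule refl)
  have t: "- t1 * (- t2 * (- t3 * x)) = - x" for x
    using t_product by algebra
  show "mult_wz scale t1 t2 t3 (\<lambda>a b. \<Sum>\<tau>\<in>T. Poly_Mapping.single (B \<tau>) (k \<tau> * (h \<tau> a * v \<tau> powi b))) a b =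
      - (\<Sum>\<tau>\<in>T. Poly_Mapping.single (B \<tau>) (k \<tau> *
        (shift_minus (v \<tau> / t1) (shift_minus (v \<tau> / t2) (shift_minus (v \<tau> / t3) (h \<tau>))) a * v \<tau> powi b)))"
    unfolding mult_wz_def
    by (subst mult_minus_shift(2)[OF v t3_nonzero], assumption, subst mult_minus_shift(2)[OF v t2_nonzero], assumption,
        subst mult_minus_shift(2)[OF v t1_nonzero], assumption, unfold t)
      (simp add: sum_negf[symmetric] single_uminus)
qed

text \<open>The coefficient of \<open>z\<^sup>-\<^sup>m\<close> in the expansions of the eigenvalue at infinity and at zero.\<close>

definition psi_plus_value :: "'r diagrams \<Rightarrow> int \<Rightarrow> 'k" where
  "psi_plus_value \<Lambda> m = fls_nth (eigenvalue fls_const \<Lambda> fls_X_inv) m"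

definition psi_minus_value :: "'r diagrams \<Rightarrow> int \<Rightarrow> 'k" where
  "psi_minus_value \<Lambda> m = fls_nth (eigenvalue fls_const \<Lambda> fls_X) (- m)"

lemma eigenvalue_fls:
  assumes "tall L \<Lambda>" "z = fls_X \<or> z = fls_X_inv"
  shows "eigenvalue fls_const \<Lambda> z = fls_const (inverse t ^ card (UNIV :: 'r set)) *
    (\<Prod>i\<in>poles L. (z - fls_const (zero \<Lambda> i)) / (z - fls_const (pole \<Lambda> i)))"
proof -
  have "eigenvalue fls_const \<Lambda> z = fls_const (inverse t) ^ card (UNIV :: 'r set) *
    (\<Prod>i\<in>poles L. (z - fls_const (zero \<Lambda> i)) / (z - fls_const (pole \<Lambda> i)))"
    by (rule eigenvalue_poles[OF _ assms(1)]) (use assms(2) fls_X_neq_const in \<open>auto dest: sym\<close>)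
  then show ?thesis by (simp only: fls_const_power)
qed

lemma
  assumes L: "tall L \<Lambda>"
  shows psi_jump: "psi_plus_value \<Lambda> m - psi_minus_value \<Lambda> m =
      inverse t ^ card (UNIV :: 'r set) * (\<Sum>i\<in>poles L. end_residue L \<Lambda> i * pole \<Lambda> i powi (m - 1))"
    and psi_plus_value_neg: "m < 0 \<Longrightarrow> psi_plus_value \<Lambda> m = 0"
    and psi_minus_value_pos: "m > 0 \<Longrightarrow> psi_minus_value \<Lambda> m = 0"
    and psi_plus_value_0: "psi_plus_value \<Lambda> 0 = inverse t ^ card (UNIV :: 'r set)"
    and psi_minus_value_0_prod: "psi_minus_value \<Lambda> 0 = inverse t ^ card (UNIV :: 'r set) * (\<Prod>i\<in>poles L. zero \<Lambda> i / pole \<Lambda> i)"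
proof -
  note expansions = expansions_of_product[where I = "poles L" and \<beta> = "pole \<Lambda>" and \<alpha> = "zero \<Lambda>"
      and k = "inverse t ^ card (UNIV :: 'r set)", OF finite_poles inj_on_subset[OF inj_pole subset_UNIV] pole_nonzero,
      folded eigenvalue_fls[OF L disjI1[OF refl]] eigenvalue_fls[OF L disjI2[OF refl]],
      folded psi_plus_value_def]
  show "psi_plus_value \<Lambda> m - psi_minus_value \<Lambda> m =
      inverse t ^ card (UNIV :: 'r set) * (\<Sum>i\<in>poles L. end_residue L \<Lambda> i * pole \<Lambda> i powi (m - 1))"
    unfolding psi_minus_value_def by (rule expansions(1))
  show "m < 0 \<Longrightarrow> psi_plus_value \<Lambda> m = 0" by (rule expansions(2))
  show "m > 0 \<Longrightarrow> psi_minus_value \<Lambda> m = 0" unfolding psi_minus_value_def by (rule expansions(3)) simp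
  show "psi_plus_value \<Lambda> 0 = inverse t ^ card (UNIV :: 'r set)" by (rule expansions(4))
  show "psi_minus_value \<Lambda> 0 = inverse t ^ card (UNIV :: 'r set) * (\<Prod>i\<in>poles L. zero \<Lambda> i / pole \<Lambda> i)"
    using expansions(5) by (simp add: psi_minus_value_def)
qed

lemma psi_minus_value_0: "psi_minus_value \<Lambda> 0 = t ^ card (UNIV :: 'r set)"
proof -
  obtain L where L: "tall L \<Lambda>" using tall_ex by blast
  define q where "q p = zero \<Lambda> (fst p, snd p, True) / pole \<Lambda> (fst p, snd p, True) *
      (zero \<Lambda> (fst p, snd p, False) / pole \<Lambda> (fst p, snd p, False))" for p
  have q: "q p = 1" for p
    unfolding q_def zero_def pole_def by (simp add: mon_def power_int_diff power2_eq_square field_simps)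
  have "zero \<Lambda> (a, L + 1, True) / pole \<Lambda> (a, L + 1, True) = t3" for a
    using t3_mon[of "int (row (\<Lambda> a) (L + 1))" "int L" a] by (simp add: zero_def pole_def field_simps)
  then have "(\<Prod>i\<in>poles L. zero \<Lambda> i / pole \<Lambda> i) = t3 ^ card (UNIV :: 'r set)"
    unfolding prod_poles_rows using q by (simp add: q_def)
  moreover have "inverse t * t3 = t"
    using t_square by (simp add: t3_def power2_eq_square field_simps)
  ultimately show ?thesis
    unfolding psi_minus_value_0_prod[OF L] by (simp add: power_mult_distrib[symmetric])
qed

text \<open>
  Each expansion of the rational functions in \<open>eigenvalue_plus\<close> is a ring homomorphism, so the equation
  holds for their coefficients.
\<close>

lemma psi_value_shift:
  assumes b: "b \<in> addables \<Lambda>" and g: "g = psi_plus_value \<or> g = psi_minus_value"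
  defines "w \<equiv> weight b"
  shows "shift_minus (t1 * w) (shift_minus (t2 * w) (shift_minus (t3 * w) (g (plus_cell \<Lambda> b)))) =
    shift_minus (w / t1) (shift_minus (w / t2) (shift_minus (w / t3) (g \<Lambda>)))"
proof -
  have eq: "(z - fls_const (t1 * w)) * ((z - fls_const (t2 * w)) * ((z - fls_const (t3 * w)) * eigenvalue fls_const (plus_cell \<Lambda> b) z)) =
      (z - fls_const (w / t1)) * ((z - fls_const (w / t2)) * ((z - fls_const (w / t3)) * eigenvalue fls_const \<Lambda> z))"
    if "z = fls_X \<or> z = fls_X_inv" for z
  proof -
    have z: "z \<noteq> fls_const (mon i j a)" for i j a using that fls_X_neq_const by (auto dest: sym)
    show ?thesis
      using eigenvalue_plus[where z = z and \<epsilon> = fls_const, OF z b] unfolding w_def by (simp only: mult_ac)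
  qed
  from g show ?thesis
  proof
    assume g: "g = psi_plus_value"
    have "g M = fls_nth (eigenvalue fls_const M fls_X_inv)" for M
      by (simp add: g fun_eq_iff psi_plus_value_def)
    then show ?thesis by (simp only: shift_minus_fls(1) eq[OF disjI2[OF refl]])
  next
    assume g: "g = psi_minus_value"
    have "g M = (\<lambda>m. fls_nth (eigenvalue fls_const M fls_X) (- m))" for M
      by (simp add: g fun_eq_iff psi_minus_value_def)
    then show ?thesis by (simp only: shift_minus_fls(2) eq[OF disjI1[OF refl]])
  qed
qed

lemma psi_adding_relation:
  assumes \<psi>: "\<And>m. lin (\<psi> m)" "\<And>m \<Lambda>. \<psi> m (basis_vector \<Lambda>) = Poly_Mapping.single \<Lambda> (g \<Lambda> m)"
    and g: "g = psi_plus_value \<or> g = psi_minus_value"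
    and e: "\<And>p. lin (e p)" "\<And>p \<Lambda>. e p (basis_vector \<Lambda>) =
      (\<Sum>b\<in>addables \<Lambda>. Poly_Mapping.single (plus_cell \<Lambda> b) (C \<Lambda> b * weight b powi p))"
  shows "mult_zw scale t1 t2 t3 (\<lambda>a b. \<psi> a (e b (basis_vector \<Lambda>))) m n =
    - mult_wz scale t1 t2 t3 (\<lambda>a b. e b (\<psi> a (basis_vector \<Lambda>))) m n"
proof -
  have \<psi>_single: "\<psi> m (Poly_Mapping.single \<Lambda> x) = Poly_Mapping.single \<Lambda> (x * g \<Lambda> m)" for m \<Lambda> x
    by (subst lin_map_single[OF \<psi>(1)]) (simp add: \<psi>(2))
  have 1: "(\<lambda>a b. \<psi> a (e b (basis_vector \<Lambda>))) = (\<lambda>a b. \<Sum>s\<in>addables \<Lambda>. Poly_Mapping.single (plus_cell \<Lambda> s)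
      (C \<Lambda> s * (g (plus_cell \<Lambda> s) a * weight s powi b)))"
    by (simp add: e(2) lin_map_sum[OF \<psi>(1)] \<psi>_single mult_ac)
  have 2: "(\<lambda>a b. e b (\<psi> a (basis_vector \<Lambda>))) = (\<lambda>a b. \<Sum>s\<in>addables \<Lambda>. Poly_Mapping.single (plus_cell \<Lambda> s)
      (C \<Lambda> s * (g \<Lambda> a * weight s powi b)))"
    unfolding \<psi>(2) by (subst lin_map_single[OF e(1)]) (simp add: e(2) scale_sum_right mult_ac)
  show ?thesis
    unfolding 1 2
      mult_zw_shift(1)[of "addables \<Lambda>" weight "plus_cell \<Lambda>" "C \<Lambda>" "\<lambda>s. g (plus_cell \<Lambda> s)", OF weight_nonzero]
      mult_zw_shift(2)[of "addables \<Lambda>" weight "plus_cell \<Lambda>" "C \<Lambda>" "\<lambda>s. g \<Lambda>", OF weight_nonzero] minus_minus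
    by (intro sum.cong refl) (simp add: psi_value_shift[OF _ g])
qed

text \<open>
  By the indexing of the zeros, such an equality would need two rows of the shape that prevents the cell
  from being added: either the next row would be longer than that of the cell, or the preceding row equally long.
\<close>

lemma weight_neq_zero:
  assumes b: "(l, i, j) \<in> addables \<Lambda>" and "1 \<le> k"
  shows "weight (l, i, j) \<noteq> zero \<Lambda> (a, k, s)"
proof
  assume "weight (l, i, j) = zero \<Lambda> (a, k, s)"
  then have eq: "mon (int (row (\<Lambda> l) j)) (int j - 1) l =
      (if s then mon (int (row (\<Lambda> a) k) - 1) (int k - 2) a else mon (int (row (\<Lambda> a) k)) (int k) a)"
    by (simp add: weight_addable[OF b] zero_def)
  show False
  proof (cases s)
    case True
    then have *: "a = l" "int (row (\<Lambda> l) j) = int (row (\<Lambda> a) k) - 1" "int k = int j + 1" using eq by auto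
    then have "k = j + 1" by linarith
    with * have "int (row (\<Lambda> l) (j + 1)) = int (row (\<Lambda> l) j) + 1" by auto
    then have "row (\<Lambda> l) (j + 1) = row (\<Lambda> l) j + 1" by linarith
    moreover have "1 \<le> j" using addables_quadrant[OF b] by (simp add: in_quadrant_def)
    ultimately show False using row_Suc_le[of j "\<Lambda> l"] by simp
  next
    case False
    then have *: "a = l" "j = k + 1" "row (\<Lambda> l) k = row (\<Lambda> l) j" using eq by auto
    have "downset (insert (l, i, j) (cells \<Lambda>))" using b by (simp add: addables_def)
    from downset_pred[OF this, of "(l, i, j)" "(l, i, k)"] have "(l, i, k) \<in> cells \<Lambda>"
      using * assms(2) addables_quadrant[OF b] by (auto simp: in_quadrant_def precedes_def)
    then show False using * b by (simp add: mem_cells addables_iff)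
  qed
qed

lemma end_residue_nonzero:
  assumes b: "(l, i, j) \<in> addables \<Lambda>" and "j \<le> L + 1"
  shows "end_residue L \<Lambda> (l, j, True) \<noteq> 0"
proof -
  have mem: "(l, j, True) \<in> poles L"
    using assms addables_quadrant[OF b] by (simp add: poles_def in_quadrant_def)
  have "pole \<Lambda> (l, j, True) \<noteq> zero \<Lambda> (a, k, s)" if "(a, k, s) \<in> poles L" for a k s
    using weight_neq_zero[OF b, of k a s] that by (simp add: pole_addable[OF b] poles_def)
  moreover have "pole \<Lambda> (l, j, True) \<noteq> pole \<Lambda> i" if "i \<noteq> (l, j, True)" for i
    using that injD[OF inj_pole] by metis
  ultimately show ?thesis
    using mem by (auto simp: residue_def prod_zero_iff)
qed

end

text \<open>
  In such a module only the coefficients \<open>C\<close> of adding a box and \<open>D\<close> of removing it again depend on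
  the normalisation of the basis.  Two conditions on them are sufficient for the relations of the
  toroidal algebra: the exchange rule for \<open>C\<close>, and that \<open>C \<Lambda> b * D \<Lambda> b\<close> is the correctly
  normalised residue of the eigenvalue at the weight of \<open>b\<close>.
\<close>

locale box_module = toroidal_parameters t1 t2 t \<chi>
  for t1 t2 t :: "'k::field" and \<chi> :: "'r::{finite,linorder} \<Rightarrow> 'k" +
  fixes \<rho> :: "toroidal_gen \<Rightarrow> ('r diagrams \<Rightarrow>\<^sub>0 'k) \<Rightarrow> ('r diagrams \<Rightarrow>\<^sub>0 'k)"
    and C D :: "'r diagrams \<Rightarrow> 'r cell \<Rightarrow> 'k"
  assumes lin_rho: "lin (\<rho> g)"
    and rho_E: "\<rho> (E p) (basis_vector \<Lambda>) =
      (\<Sum>b\<in>addables \<Lambda>. Poly_Mapping.single (plus_cell \<Lambda> b) (C \<Lambda> b * weight b powi p))"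
    and rho_F: "\<rho> (F p) (basis_vector \<Lambda>) =
      (\<Sum>b\<in>removables \<Lambda>. Poly_Mapping.single (minus_cell \<Lambda> b) (D (minus_cell \<Lambda> b) b * weight b powi p))"
    and rho_Psi: "\<rho> (Psi m) (basis_vector \<Lambda>) = Poly_Mapping.single \<Lambda> (if m \<ge> 0 then psi_plus_value \<Lambda> m else psi_minus_value \<Lambda> m)"
    and rho_Psi0_inv: "\<rho> Psi0_inv (basis_vector \<Lambda>) = Poly_Mapping.single \<Lambda> (psi_minus_value \<Lambda> 0)"
    and exchange_C: "exchange C"
    and C_nonzero: "b \<in> addables \<Lambda> \<Longrightarrow> C \<Lambda> b \<noteq> 0"
    and C_D: "(l, i, j) \<in> addables \<Lambda> \<Longrightarrow> tall L (plus_cell \<Lambda> (l, i, j)) \<Longrightarrow>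
      C \<Lambda> (l, i, j) * D \<Lambda> (l, i, j) * (weight (l, i, j) * ((1 - t1) * (1 - t2) * (1 - t3))) =
      - (inverse t ^ card (UNIV :: 'r set) * end_residue L \<Lambda> (l, j, True))"
begin

abbreviation kappa :: 'k where "kappa \<equiv> (1 - t1) * (1 - t2) * (1 - t3)"

lemma kappa_nonzero: "kappa \<noteq> 0"
  by simp

text \<open>
  The assumption on \<open>C\<close> and \<open>D\<close> makes this the residue of the eigenvalue up to a factor, without reference
  to a number of rows.
\<close>

definition norm_residue :: "'r diagrams \<Rightarrow> 'r cell \<Rightarrow> 'k" where
  "norm_residue \<Lambda> b = C \<Lambda> b * D \<Lambda> b"

lemma norm_residue_eq:
  assumes "(l, i, j) \<in> addables \<Lambda>" "tall L (plus_cell \<Lambda> (l, i, j))"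
  shows "norm_residue \<Lambda> (l, i, j) =
    - (inverse t ^ card (UNIV :: 'r set) / (weight (l, i, j) * kappa)) * end_residue L \<Lambda> (l, j, True)"
proof -
  have "norm_residue \<Lambda> (l, i, j) = - (inverse t ^ card (UNIV :: 'r set) * end_residue L \<Lambda> (l, j, True)) / (weight (l, i, j) * kappa)"
    using C_D[OF assms] by (subst nonzero_eq_divide_eq) (simp_all add: norm_residue_def)
  then show ?thesis by simp
qed

lemma norm_residue_nonzero:
  assumes "b \<in> addables \<Lambda>"
  shows "norm_residue \<Lambda> b \<noteq> 0"
proof -
  obtain l i j where b: "b = (l, i, j)" by (cases b) auto
  obtain L where L: "tall L (plus_cell \<Lambda> (l, i, j))" using tall_ex by blast
  show ?thesis
    using norm_residue_eq[OF assms[unfolded b] L] end_residue_nonzero[OF assms[unfolded b], of L]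
      tall_plus[OF L assms[unfolded b]] by (simp add: b)
qed

lemma norm_residue_plus:
  assumes ab: "a \<in> addables \<Lambda>" "b \<in> addables \<Lambda>" "a \<noteq> b"
  shows "norm_residue (plus_cell \<Lambda> a) b * zw_poly (weight b) (weight a) =
    - (norm_residue \<Lambda> b * zw_poly (weight a) (weight b))"
proof -
  obtain l i j where b: "b = (l, i, j)" by (cases b) auto
  have b': "b \<in> addables (plus_cell \<Lambda> a)" and a': "a \<in> addables (plus_cell \<Lambda> b)"
    using addables_plus_cell[of a \<Lambda> b] addables_plus_cell[of b \<Lambda> a] ab by auto
  obtain L where L: "tall L (plus_cell (plus_cell \<Lambda> a) b)" using tall_ex by blast
  have La: "tall L (plus_cell \<Lambda> a)" "j \<le> L"
    using tall_plus[OF L[unfolded b] b'[unfolded b]] by auto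
  have "tall L (plus_cell (plus_cell \<Lambda> b) a)"
    using L plus_cell_commute[OF ab] by simp
  then have Lb: "tall L (plus_cell \<Lambda> b)"
    using tall_plus[of L "plus_cell \<Lambda> b" "fst a" "fst (snd a)" "snd (snd a)"] a' by simp
  have "end_residue L (plus_cell \<Lambda> a) (l, j, True) * zw_poly (weight b) (weight a) =
      - (end_residue L \<Lambda> (l, j, True) * zw_poly (weight a) (weight b))"
    using residue_plus_other[OF ab(1) ab(2)[unfolded b] ab(3)[unfolded b] La] by (simp add: b)
  then have "k * end_residue L (plus_cell \<Lambda> a) (l, j, True) * zw_poly (weight b) (weight a) =
      - (k * end_residue L \<Lambda> (l, j, True) * zw_poly (weight a) (weight b))" for k
    by algebra
  then show ?thesis
    using norm_residue_eq[OF b'[unfolded b] L[unfolded b]] norm_residue_eq[OF ab(2)[unfolded b] Lb[unfolded b]]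
    by (simp only: b)
qed

lemma D_nonzero: "b \<in> addables \<Lambda> \<Longrightarrow> D \<Lambda> b \<noteq> 0"
  using norm_residue_nonzero[of b \<Lambda>] by (auto simp: norm_residue_def)

text \<open>
  Taking a box \<open>b\<close> off and putting \<open>a\<close> on commute, since the residue at \<open>b\<close> and the coefficient
  \<open>C\<close> of \<open>b\<close> react to the presence of \<open>a\<close> by related factors.
\<close>

lemma C_D_commute:
  assumes ab: "a \<in> addables M" "b \<in> addables M" "a \<noteq> b"
  shows "C M a * D M b = C (plus_cell M b) a * D (plus_cell M a) b"
proof -
  let ?p = "zw_poly (weight b) (weight a)" and ?q = "zw_poly (weight a) (weight b)"
  have b': "b \<in> addables (plus_cell M a)" by (rule addables_plus_cell[OF ab])
  have nz: "C M b \<noteq> 0" "C (plus_cell M a) b \<noteq> 0" "?p \<noteq> 0"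
    using C_nonzero ab b' zw_poly_nonzero[OF ab] by auto
  have A: "C M a * C (plus_cell M a) b * ?p = - (C M b * C (plus_cell M b) a * ?q)"
    by (rule exchangeD[OF exchange_C ab])
  have R: "C (plus_cell M a) b * D (plus_cell M a) b * ?p = - (C M b * D M b * ?q)"
    using norm_residue_plus[OF ab] by (simp add: norm_residue_def)
  have "(C M a * D M b) * (C M b * C (plus_cell M a) b * ?p) =
      (C (plus_cell M b) a * D (plus_cell M a) b) * (C M b * C (plus_cell M a) b * ?p)"
    using A R by algebra
  then show ?thesis using nz by simp
qed

text \<open>
  Removing then obeys the same rule as adding: the exchange factors of \<open>C\<close> cancel against those of the
  residues.
\<close>

lemma exchange_D: "exchange D"
  unfolding exchange_def
proof (intro allI ballI impI)
  fix \<Lambda> :: "'r diagrams" and a b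
  assume ab: "a \<in> addables \<Lambda>" "b \<in> addables \<Lambda>" "a \<noteq> b"
  let ?p = "zw_poly (weight b) (weight a)" and ?q = "zw_poly (weight a) (weight b)"
  have b': "b \<in> addables (plus_cell \<Lambda> a)" by (rule addables_plus_cell[OF ab])
  have nz: "C \<Lambda> a \<noteq> 0" "C (plus_cell \<Lambda> a) b \<noteq> 0"
    using C_nonzero ab b' by auto
  have 1: "C \<Lambda> a * D \<Lambda> b = C (plus_cell \<Lambda> b) a * D (plus_cell \<Lambda> a) b"
    by (rule C_D_commute[OF ab])
  have 2: "C (plus_cell \<Lambda> a) b * D (plus_cell \<Lambda> a) b * ?p = - (C \<Lambda> b * D \<Lambda> b * ?q)"
    and 3: "C (plus_cell \<Lambda> b) a * D (plus_cell \<Lambda> b) a * ?q = - (C \<Lambda> a * D \<Lambda> a * ?p)"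
    using norm_residue_plus[OF ab] norm_residue_plus[of b \<Lambda> a] ab by (simp_all add: norm_residue_def)
  have 4: "C (plus_cell \<Lambda> b) a \<noteq> 0"
    using C_nonzero addables_plus_cell[of b \<Lambda> a] ab by auto
  have "D \<Lambda> a * D (plus_cell \<Lambda> a) b * ?p * (C \<Lambda> a * C (plus_cell \<Lambda> b) a)
      = - (D \<Lambda> b * D (plus_cell \<Lambda> b) a * ?q) * (C \<Lambda> a * C (plus_cell \<Lambda> b) a)"
    using 1 3 by algebra
  then show "D \<Lambda> a * D (plus_cell \<Lambda> a) b * ?p = - (D \<Lambda> b * D (plus_cell \<Lambda> b) a * ?q)"
    using nz 4 by (subst (asm) mult_right_cancel) auto
qed

lemma rho_single: "\<rho> g (Poly_Mapping.single \<Lambda> x) = scale x (\<rho> g (basis_vector \<Lambda>))"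
  by (rule lin_map_single[OF lin_rho])

lemma psi_plus_basis: "psi_plus \<rho> m (basis_vector \<Lambda>) = Poly_Mapping.single \<Lambda> (psi_plus_value \<Lambda> m)"
proof -
  obtain L where L: "tall L \<Lambda>" using tall_ex by blast
  show ?thesis using psi_plus_value_neg[OF L] by (auto simp: psi_plus_def rho_Psi)
qed

lemma psi_minus_basis: "psi_minus \<rho> m (basis_vector \<Lambda>) = Poly_Mapping.single \<Lambda> (psi_minus_value \<Lambda> m)"
proof -
  obtain L where L: "tall L \<Lambda>" using tall_ex by blast
  show ?thesis using psi_minus_value_pos[OF L] by (auto simp: psi_minus_def rho_Psi rho_Psi0_inv)
qed

lemma lin_psi: "lin (psi_plus \<rho> m)" "lin (psi_minus \<rho> m)"
proof -
  have "psi_plus \<rho> m = (\<lambda>v. if m \<ge> 0 then \<rho> (Psi m) v else 0)"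
    "psi_minus \<rho> m = (\<lambda>v. if m < 0 then \<rho> (Psi m) v else if m = 0 then \<rho> Psi0_inv v else 0)"
    by (auto simp: psi_plus_def psi_minus_def fun_eq_iff)
  note eq = this
  show "lin (psi_plus \<rho> m)"
    unfolding eq by (cases "m \<ge> 0") (simp_all add: lin_rho lin_zero)
  consider "m < 0" | "m = 0" | "m > 0" by linarith
  then show "lin (psi_minus \<rho> m)"
    unfolding eq by cases (simp_all add: lin_rho lin_zero)
qed

lemma psi_E_relation:
  assumes \<psi>: "\<And>m. lin (\<psi> m)" "\<And>m \<Lambda>. \<psi> m (basis_vector \<Lambda>) = Poly_Mapping.single \<Lambda> (g \<Lambda> m)"
    and g: "g = psi_plus_value \<or> g = psi_minus_value"
  shows "mult_zw scale t1 t2 t3 (\<lambda>a b. \<psi> a (\<rho> (E b) (basis_vector \<Lambda>))) m n =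
    - mult_wz scale t1 t2 t3 (\<lambda>a b. \<rho> (E b) (\<psi> a (basis_vector \<Lambda>))) m n"
  by (rule psi_adding_relation[OF \<psi> g lin_rho rho_E])

lemma psi_F_relation:
  assumes \<psi>: "\<And>m. lin (\<psi> m)" "\<And>m \<Lambda>. \<psi> m (basis_vector \<Lambda>) = Poly_Mapping.single \<Lambda> (g \<Lambda> m)"
    and g: "g = psi_plus_value \<or> g = psi_minus_value"
  shows "mult_wz scale t1 t2 t3 (\<lambda>a b. \<psi> a (\<rho> (F b) (basis_vector \<Lambda>))) m n =
    - mult_zw scale t1 t2 t3 (\<lambda>a b. \<rho> (F b) (\<psi> a (basis_vector \<Lambda>))) m n"
proof (rule transposed_exchange_relation[OF \<psi>(1) \<psi>(1) lin_rho lin_adding_op _ transposed_removing[OF rho_F]])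
  show "transposed (\<psi> m) (\<psi> m)" for m
    by (auto simp: transposed_def \<psi>(2) lookup_single when_def)
  show "mult_zw scale t1 t2 t3 (\<lambda>m n. \<psi> m (adding_op D n (basis_vector \<Lambda>))) m n =
      - mult_wz scale t1 t2 t3 (\<lambda>m n. adding_op D n (\<psi> m (basis_vector \<Lambda>))) m n" for \<Lambda>
    by (rule psi_adding_relation[OF \<psi> g lin_adding_op adding_op_basis])
qed

text \<open>
  The left side is the diagonal part of \<open>e f - f e\<close>.  As all residues at poles where no cell can be added or
  removed vanish, it is the sum over all poles, which is the difference of the two expansions.
\<close>

lemma sum_C_D_jump:
  "(\<Sum>b\<in>removables \<Lambda>. norm_residue (minus_cell \<Lambda> b) b * weight b powi m)
    - (\<Sum>b\<in>addables \<Lambda>. norm_residue \<Lambda> b * weight b powi m) =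
    1 / kappa * (psi_plus_value \<Lambda> m - psi_minus_value \<Lambda> m)"
proof -
  obtain L0 where L0: "tall L0 \<Lambda>" using tall_ex by blast
  obtain L where L: "tall L \<Lambda>" and La: "\<And>b. b \<in> addables \<Lambda> \<Longrightarrow> tall L (plus_cell \<Lambda> b)"
  proof -
    have "\<forall>b. \<exists>L. tall L (plus_cell \<Lambda> b)" using tall_ex by metis
    then obtain f where f: "\<And>b. tall (f b) (plus_cell \<Lambda> b)" by metis
    define N where "N = Max (insert L0 (f ` addables \<Lambda>))"
    have N: "L0 \<le> N" "\<And>b. b \<in> addables \<Lambda> \<Longrightarrow> f b \<le> N"
      by (auto simp: N_def)
    have mono: "tall k M \<Longrightarrow> k \<le> k' \<Longrightarrow> tall k' M" for k k' and M :: "'r diagrams"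
      by (auto simp: tall_def)
    show thesis
    proof (rule that)
      show "tall N \<Lambda>" by (rule mono[OF L0 N(1)])
      show "tall N (plus_cell \<Lambda> b)" if "b \<in> addables \<Lambda>" for b by (rule mono[OF f N(2)[OF that]])
    qed
  qed
  define c where "c = inverse t ^ card (UNIV :: 'r set)"
  have pow: "x powi (m - 1) = x powi m / x" if "x \<noteq> 0" for x :: 'k
    using that by (simp add: power_int_diff)
  have cancel: "e * (p / w) * c = - (k * (- (c / (w * k)) * e * p))" if "k \<noteq> 0" "w \<noteq> 0" for e p k w :: 'k
    using that by simp
  have add: "(\<Sum>(l, i, j)\<in>addables \<Lambda>. end_residue L \<Lambda> (l, j, True) * weight (l, i, j) powi (m - 1)) * c =
      - (kappa * (\<Sum>b\<in>addables \<Lambda>. norm_residue \<Lambda> b * weight b powi m))"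
    unfolding sum_distrib_right sum_distrib_left sum_negf[symmetric]
  proof (rule sum.cong[OF refl], clarify)
    fix l i j assume b: "(l, i, j) \<in> addables \<Lambda>"
    show "end_residue L \<Lambda> (l, j, True) * weight (l, i, j) powi (m - 1) * c =
        - (kappa * (norm_residue \<Lambda> (l, i, j) * weight (l, i, j) powi m))"
      unfolding norm_residue_eq[OF b La[OF b]] c_def[symmetric] pow[OF weight_nonzero]
      by (rule cancel[OF kappa_nonzero weight_nonzero])
  qed
  have rem: "(\<Sum>(l, i, j)\<in>removables \<Lambda>. end_residue L \<Lambda> (l, j, False) * weight (l, i, j) powi (m - 1)) * c =
      kappa * (\<Sum>b\<in>removables \<Lambda>. norm_residue (minus_cell \<Lambda> b) b * weight b powi m)"
    unfolding sum_distrib_right sum_distrib_left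
  proof (rule sum.cong[OF refl], clarify)
    fix l i j assume b: "(l, i, j) \<in> removables \<Lambda>"
    let ?M = "minus_cell \<Lambda> (l, i, j)"
    have b': "(l, i, j) \<in> addables ?M" "plus_cell ?M (l, i, j) = \<Lambda>"
      using addables_minus_cell[OF b] plus_minus_cell[OF b] by auto
    have L': "tall L (plus_cell ?M (l, i, j))" using b' L by simp
    have flip: "end_residue L \<Lambda> (l, j, False) = - end_residue L ?M (l, j, True)"
      using residue_plus_self[OF b'(1) L'] b'(2) by simp
    show "end_residue L \<Lambda> (l, j, False) * weight (l, i, j) powi (m - 1) * c =
        kappa * (norm_residue ?M (l, i, j) * weight (l, i, j) powi m)"
      unfolding norm_residue_eq[OF b'(1) L'] c_def[symmetric] pow[OF weight_nonzero] flip
      using cancel[OF kappa_nonzero weight_nonzero] by simp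
  qed
  have collect: "- (k * x) + k * y = k * (y - x)" for k x y :: 'k
    by (simp add: algebra_simps)
  have "psi_plus_value \<Lambda> m - psi_minus_value \<Lambda> m =
      (\<Sum>i\<in>poles L. end_residue L \<Lambda> i * pole \<Lambda> i powi (m - 1)) * c"
    unfolding psi_jump[OF L] c_def by (rule mult.commute)
  also have "\<dots> = kappa * ((\<Sum>b\<in>removables \<Lambda>. norm_residue (minus_cell \<Lambda> b) b * weight b powi m)
      - (\<Sum>b\<in>addables \<Lambda>. norm_residue \<Lambda> b * weight b powi m))"
    unfolding sum_end_residues[where h = "\<lambda>x. x powi (m - 1)", OF L] distrib_right add rem by (rule collect)
  finally show ?thesis using kappa_nonzero by simp
qed

lemma EF_relation:
  "op_commutator (\<rho> (E m)) (\<rho> (F n)) (basis_vector \<Lambda>) =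
    scale (1 / kappa) (psi_plus \<rho> (m + n) (basis_vector \<Lambda>) - psi_minus \<rho> (m + n) (basis_vector \<Lambda>))"
proof -
  define RA where "RA = (SIGMA r:removables \<Lambda>. addables (minus_cell \<Lambda> r) - {r})"
  define AR where "AR = (SIGMA s:addables \<Lambda>. removables (plus_cell \<Lambda> s) - {s})"
  let ?x = "\<lambda>b p. weight b powi p"
  have EF: "\<rho> (E m) (\<rho> (F n) (basis_vector \<Lambda>)) =
      (\<Sum>r\<in>removables \<Lambda>. \<Sum>s\<in>addables (minus_cell \<Lambda> r). Poly_Mapping.single (plus_cell (minus_cell \<Lambda> r) s)
         (D (minus_cell \<Lambda> r) r * ?x r n * (C (minus_cell \<Lambda> r) s * ?x s m)))"
    unfolding rho_F lin_map_sum[OF lin_rho] by (subst rho_single) (simp add: rho_E scale_sum_right)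
  have FE: "\<rho> (F n) (\<rho> (E m) (basis_vector \<Lambda>)) =
      (\<Sum>s\<in>addables \<Lambda>. \<Sum>r\<in>removables (plus_cell \<Lambda> s). Poly_Mapping.single (minus_cell (plus_cell \<Lambda> s) r)
         (C \<Lambda> s * ?x s m * (D (minus_cell (plus_cell \<Lambda> s) r) r * ?x r n)))"
    unfolding rho_E lin_map_sum[OF lin_rho] by (subst rho_single) (simp add: rho_F scale_sum_right)
  have EF': "\<rho> (E m) (\<rho> (F n) (basis_vector \<Lambda>)) =
      Poly_Mapping.single \<Lambda> (\<Sum>r\<in>removables \<Lambda>. norm_residue (minus_cell \<Lambda> r) r * ?x r (m + n)) +
      (\<Sum>(r, s)\<in>RA. Poly_Mapping.single (plus_cell (minus_cell \<Lambda> r) s)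
         (D (minus_cell \<Lambda> r) r * ?x r n * (C (minus_cell \<Lambda> r) s * ?x s m)))"
  proof -
    have "(\<Sum>s\<in>addables (minus_cell \<Lambda> r). Poly_Mapping.single (plus_cell (minus_cell \<Lambda> r) s)
         (D (minus_cell \<Lambda> r) r * ?x r n * (C (minus_cell \<Lambda> r) s * ?x s m))) =
        Poly_Mapping.single \<Lambda> (norm_residue (minus_cell \<Lambda> r) r * ?x r (m + n)) +
        (\<Sum>s\<in>addables (minus_cell \<Lambda> r) - {r}. Poly_Mapping.single (plus_cell (minus_cell \<Lambda> r) s)
         (D (minus_cell \<Lambda> r) r * ?x r n * (C (minus_cell \<Lambda> r) s * ?x s m)))"
      if "r \<in> removables \<Lambda>" for r
      using that by (subst sum.remove[OF _ addables_minus_cell[OF that]])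
        (simp_all add: norm_residue_def power_int_add mult_ac)
    then show ?thesis
      unfolding EF RA_def by (subst sum.Sigma[symmetric]) (simp_all add: sum.distrib single_sum)
  qed
  have FE': "\<rho> (F n) (\<rho> (E m) (basis_vector \<Lambda>)) =
      Poly_Mapping.single \<Lambda> (\<Sum>s\<in>addables \<Lambda>. norm_residue \<Lambda> s * ?x s (m + n)) +
      (\<Sum>(s, r)\<in>AR. Poly_Mapping.single (minus_cell (plus_cell \<Lambda> s) r)
         (C \<Lambda> s * ?x s m * (D (minus_cell (plus_cell \<Lambda> s) r) r * ?x r n)))"
  proof -
    have "(\<Sum>r\<in>removables (plus_cell \<Lambda> s). Poly_Mapping.single (minus_cell (plus_cell \<Lambda> s) r)
         (C \<Lambda> s * ?x s m * (D (minus_cell (plus_cell \<Lambda> s) r) r * ?x r n))) =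
        Poly_Mapping.single \<Lambda> (norm_residue \<Lambda> s * ?x s (m + n)) +
        (\<Sum>r\<in>removables (plus_cell \<Lambda> s) - {s}. Poly_Mapping.single (minus_cell (plus_cell \<Lambda> s) r)
         (C \<Lambda> s * ?x s m * (D (minus_cell (plus_cell \<Lambda> s) r) r * ?x r n)))"
      if "s \<in> addables \<Lambda>" for s
      using that by (subst sum.remove[OF _ removables_plus_cell[OF that]])
        (simp_all add: norm_residue_def power_int_add mult_ac)
    then show ?thesis
      unfolding FE AR_def by (subst sum.Sigma[symmetric]) (simp_all add: sum.distrib single_sum)
  qed
  \<comment> \<open>Moves of two different boxes commute, with the same coefficients.\<close>
  have RA: "(s, r) \<in> AR \<and> plus_cell (minus_cell \<Lambda> r) s = minus_cell (plus_cell \<Lambda> s) r \<and>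
      D (minus_cell \<Lambda> r) r * C (minus_cell \<Lambda> r) s = C \<Lambda> s * D (minus_cell (plus_cell \<Lambda> s) r) r"
    if "(r, s) \<in> RA" for r s
  proof -
    define M where "M = minus_cell \<Lambda> r"
    have r: "r \<in> addables M" "plus_cell M r = \<Lambda>" and s: "s \<in> addables M" "s \<noteq> r"
      using that addables_minus_cell[of r \<Lambda>] plus_minus_cell[of r \<Lambda>] by (simp_all add: RA_def M_def)
    have s': "s \<in> addables \<Lambda>" using addables_plus_cell[of r M s] r s by auto
    have r': "r \<in> addables (plus_cell M s)" using addables_plus_cell[of s M r] r s by auto
    have comm: "plus_cell \<Lambda> s = plus_cell (plus_cell M s) r"
      using plus_cell_commute[of r M s] r s by auto
    have "r \<in> removables (plus_cell \<Lambda> s)" "minus_cell (plus_cell \<Lambda> s) r = plus_cell M s"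
      unfolding comm using removables_plus_cell[OF r'] minus_plus_cell[OF r'] by auto
    moreover have "C M s * D M r = C \<Lambda> s * D (plus_cell M s) r"
      using C_D_commute[OF s(1) r(1) s(2)] r(2) by simp
    ultimately show ?thesis
      unfolding M_def[symmetric] using s s' by (auto simp: AR_def mult.commute)
  qed
  have AR: "(r, s) \<in> RA" if "(s, r) \<in> AR" for r s
  proof -
    define N where "N = plus_cell \<Lambda> s"
    have s: "s \<in> removables N" "minus_cell N s = \<Lambda>" and r: "r \<in> removables N" "r \<noteq> s"
      using that removables_plus_cell[of s \<Lambda>] minus_plus_cell[of s \<Lambda>] by (simp_all add: AR_def N_def)
    have r': "r \<in> removables \<Lambda>" using removables_minus_cell[of s N r] r s by auto
    have s': "s \<in> removables (minus_cell N r)" using removables_minus_cell[of r N s] r s by auto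
    have "cells (minus_cell \<Lambda> r) = cells (minus_cell (minus_cell N r) s)"
      using r r' s s' by auto
    then have "minus_cell \<Lambda> r = minus_cell (minus_cell N r) s" by (simp only: cells_inject)
    then have "s \<in> addables (minus_cell \<Lambda> r)" using addables_minus_cell[OF s'] by simp
    then show ?thesis using r r' by (auto simp: RA_def)
  qed
  have "(\<Sum>(r, s)\<in>RA. Poly_Mapping.single (plus_cell (minus_cell \<Lambda> r) s)
         (D (minus_cell \<Lambda> r) r * ?x r n * (C (minus_cell \<Lambda> r) s * ?x s m))) =
      (\<Sum>(s, r)\<in>AR. Poly_Mapping.single (minus_cell (plus_cell \<Lambda> s) r)
         (C \<Lambda> s * ?x s m * (D (minus_cell (plus_cell \<Lambda> s) r) r * ?x r n)))"
  proof (rule sum.reindex_bij_witness[where i = "\<lambda>(s, r). (r, s)" and j = "\<lambda>(r, s). (s, r)"], goal_cases)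
    case (5 a)
    obtain r s where a: "a = (r, s)" by (cases a) auto
    have "D (minus_cell \<Lambda> r) r * ?x r n * (C (minus_cell \<Lambda> r) s * ?x s m) =
        D (minus_cell \<Lambda> r) r * C (minus_cell \<Lambda> r) s * (?x r n * ?x s m)" by (simp only: mult_ac)
    also have "\<dots> = C \<Lambda> s * ?x s m * (D (minus_cell (plus_cell \<Lambda> s) r) r * ?x r n)"
      using RA[of r s] 5 a by (simp add: mult_ac)
    finally have "D (minus_cell \<Lambda> r) r * ?x r n * (C (minus_cell \<Lambda> r) s * ?x s m) =
        C \<Lambda> s * ?x s m * (D (minus_cell (plus_cell \<Lambda> s) r) r * ?x r n)" .
    moreover have "plus_cell (minus_cell \<Lambda> r) s = minus_cell (plus_cell \<Lambda> s) r"
      using RA[of r s] 5 a by blast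
    ultimately show ?case unfolding a prod.case by (simp only:)
  qed (use RA AR in auto)
  then have "op_commutator (\<rho> (E m)) (\<rho> (F n)) (basis_vector \<Lambda>) =
      Poly_Mapping.single \<Lambda> (\<Sum>r\<in>removables \<Lambda>. norm_residue (minus_cell \<Lambda> r) r * ?x r (m + n)) -
      Poly_Mapping.single \<Lambda> (\<Sum>s\<in>addables \<Lambda>. norm_residue \<Lambda> s * ?x s (m + n))"
    unfolding op_commutator_def EF' FE' by simp
  also have "\<dots> = Poly_Mapping.single \<Lambda> (1 / kappa * (psi_plus_value \<Lambda> (m + n) - psi_minus_value \<Lambda> (m + n)))"
    unfolding single_diff[symmetric] sum_C_D_jump ..
  also have "\<dots> = scale (1 / kappa) (psi_plus \<rho> (m + n) (basis_vector \<Lambda>) - psi_minus \<rho> (m + n) (basis_vector \<Lambda>))"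
    unfolding psi_plus_basis psi_minus_basis single_diff[symmetric] scale_single ..
  finally show ?thesis .
qed

text \<open>
  All relations are equations between linear maps, so they may be checked on the basis.
\<close>

theorem box_module_toroidal_rep: "toroidal_rep t1 t2 t3 scale \<rho>"
  unfolding toroidal_rep_def
proof (intro conjI allI ballI)
  note lin1 = lin_comp[OF lin_rho lin_rho]
  note e_rel = adding_relations[of "\<lambda>p. \<rho> (E p)" C, OF lin_rho rho_E exchange_C C_nonzero]
  note f_rel = removing_relations[of "\<lambda>p. \<rho> (F p)" D, OF lin_rho rho_F exchange_D D_nonzero]
  show "vector_space (scale :: 'k \<Rightarrow> ('r diagrams \<Rightarrow>\<^sub>0 'k) \<Rightarrow> _)" by (rule vector_space_scale)
  show "lin (\<rho> g)" for g by (rule lin_rho)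
  show "\<rho> (Psi i) (\<rho> (Psi j) v) = \<rho> (Psi j) (\<rho> (Psi i) v)" for i j v
  proof (rule lin_eqI[OF lin1 lin1])
    fix \<Lambda>
    show "\<rho> (Psi i) (\<rho> (Psi j) (basis_vector \<Lambda>)) = \<rho> (Psi j) (\<rho> (Psi i) (basis_vector \<Lambda>))"
      unfolding rho_Psi by (subst (1 2) rho_single) (simp add: rho_Psi mult.commute)
  qed
  have inv: "psi_plus_value \<Lambda> 0 * psi_minus_value \<Lambda> 0 = 1" for \<Lambda>
  proof -
    obtain L where L: "tall L \<Lambda>" using tall_ex by blast
    show ?thesis by (simp add: psi_plus_value_0[OF L] psi_minus_value_0 power_mult_distrib[symmetric])
  qed
  then have inv': "psi_minus_value \<Lambda> 0 * psi_plus_value \<Lambda> 0 = 1" for \<Lambda>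
    by (simp only: mult.commute)
  show "\<rho> (Psi 0) (\<rho> Psi0_inv v) = v" for v
  proof (rule lin_eqI[OF lin1 lin_ident])
    show "\<rho> (Psi 0) (\<rho> Psi0_inv (basis_vector \<Lambda>)) = basis_vector \<Lambda>" for \<Lambda>
      unfolding rho_Psi0_inv by (subst rho_single) (simp add: rho_Psi inv')
  qed
  show "\<rho> Psi0_inv (\<rho> (Psi 0) v) = v" for v
  proof (rule lin_eqI[OF lin1 lin_ident])
    show "\<rho> Psi0_inv (\<rho> (Psi 0) (basis_vector \<Lambda>)) = basis_vector \<Lambda>" for \<Lambda>
      unfolding rho_Psi by (subst rho_single) (simp add: rho_Psi0_inv inv)
  qed
  show "mult_zw scale t1 t2 t3 (\<lambda>a b. \<rho> (E a) (\<rho> (E b) v)) m n =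
      - mult_wz scale t1 t2 t3 (\<lambda>a b. \<rho> (E b) (\<rho> (E a) v)) m n" for v m n
    by (rule lin_eqI[OF lin_mult_zw[OF lin1] lin_neg[OF lin_mult_wz[OF lin1]] e_rel(1)])
  show "mult_wz scale t1 t2 t3 (\<lambda>a b. \<rho> (F a) (\<rho> (F b) v)) m n =
      - mult_zw scale t1 t2 t3 (\<lambda>a b. \<rho> (F b) (\<rho> (F a) v)) m n" for v m n
    by (rule lin_eqI[OF lin_mult_wz[OF lin1] lin_neg[OF lin_mult_zw[OF lin1]] f_rel(1)])
  show "op_commutator (\<rho> (E m)) (\<rho> (F n)) v =
      scale (1 / kappa) (psi_plus \<rho> (m + n) v - psi_minus \<rho> (m + n) v)" for v m n
    by (rule lin_eqI[OF lin_op_commutator[OF lin_rho lin_rho] lin_scale[OF lin_diff[OF lin_psi]] EF_relation])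
  show "mult_zw scale t1 t2 t3 (\<lambda>a b. \<psi> a (\<rho> (E b) v)) m n =
      - mult_wz scale t1 t2 t3 (\<lambda>a b. \<rho> (E b) (\<psi> a v)) m n"
    if "\<psi> \<in> {psi_plus \<rho>, psi_minus \<rho>}" for \<psi> v m n
  proof -
    have lin: "lin (\<psi> a)" for a using that lin_psi by auto
    have "mult_zw scale t1 t2 t3 (\<lambda>a b. \<psi> a (\<rho> (E b) (basis_vector \<Lambda>))) m n =
        - mult_wz scale t1 t2 t3 (\<lambda>a b. \<rho> (E b) (\<psi> a (basis_vector \<Lambda>))) m n" for \<Lambda>
      using that psi_E_relation[OF lin_psi(1) psi_plus_basis disjI1[OF refl]]
        psi_E_relation[OF lin_psi(2) psi_minus_basis disjI2[OF refl]] by auto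
    then show ?thesis
      by (rule lin_eqI[OF lin_mult_zw[OF lin_comp[OF lin lin_rho]] lin_neg[OF lin_mult_wz[OF lin_comp[OF lin_rho lin]]]])
  qed
  show "mult_wz scale t1 t2 t3 (\<lambda>a b. \<psi> a (\<rho> (F b) v)) m n =
      - mult_zw scale t1 t2 t3 (\<lambda>a b. \<rho> (F b) (\<psi> a v)) m n"
    if "\<psi> \<in> {psi_plus \<rho>, psi_minus \<rho>}" for \<psi> v m n
  proof -
    have lin: "lin (\<psi> a)" for a using that lin_psi by auto
    have "mult_wz scale t1 t2 t3 (\<lambda>a b. \<psi> a (\<rho> (F b) (basis_vector \<Lambda>))) m n =
        - mult_zw scale t1 t2 t3 (\<lambda>a b. \<rho> (F b) (\<psi> a (basis_vector \<Lambda>))) m n" for \<Lambda>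
      using that psi_F_relation[OF lin_psi(1) psi_plus_basis disjI1[OF refl]]
        psi_F_relation[OF lin_psi(2) psi_minus_basis disjI2[OF refl]] by auto
    then show ?thesis
      by (rule lin_eqI[OF lin_mult_wz[OF lin_comp[OF lin lin_rho]] lin_neg[OF lin_mult_zw[OF lin_comp[OF lin_rho lin]]]])
  qed
  show "(\<Sum>\<sigma> | \<sigma> permutes {1, 2, 3}. op_commutator (\<rho> (X (i (\<sigma> 1))))
      (op_commutator (\<rho> (X (i (\<sigma> 2) + 1))) (\<rho> (X (i (\<sigma> 3) - 1)))) v) = 0"
    if "X \<in> {E, F}" for X and i :: "nat \<Rightarrow> int" and v
  proof (rule lin_eqI[OF lin_sum lin_zero])
    show "lin (op_commutator (\<rho> (X (i (\<sigma> 1)))) (op_commutator (\<rho> (X (i (\<sigma> 2) + 1))) (\<rho> (X (i (\<sigma> 3) - 1)))))" for \<sigma>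
      by (intro lin_op_commutator lin_rho)
    show "(\<Sum>\<sigma> | \<sigma> permutes {1, 2, 3}. op_commutator (\<rho> (X (i (\<sigma> 1))))
      (op_commutator (\<rho> (X (i (\<sigma> 2) + 1))) (\<rho> (X (i (\<sigma> 3) - 1)))) (basis_vector \<Lambda>)) = 0" for \<Lambda>
      using that e_rel(2) f_rel(2) by auto
  qed
qed

end

section \<open>The fixed-point basis of the Gieseker spaces\<close>

context toroidal_parameters
begin

lemma one_minus_divide: "x \<noteq> 0 \<Longrightarrow> 1 - a / x = (x - a) / (x :: 'k)"
  by (simp add: diff_divide_distrib)

text \<open>
  The polynomial \<open>(x - t1 * t2 * y) * (x - t3 * y)\<close> is symmetric, because \<open>t1 * t2\<close> is inverse to \<open>t3\<close>.  So
  the assumption, for \<open>a\<close> and \<open>b\<close> in both roles, gives the exchange rule.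
\<close>

lemma exchangeI_ratio:
  assumes "\<And>\<Lambda> a b. a \<in> addables \<Lambda> \<Longrightarrow> b \<in> addables \<Lambda> \<Longrightarrow> a \<noteq> b \<Longrightarrow>
    C (plus_cell \<Lambda> a) b * ((weight b - t1 * weight a) * (weight b - t2 * weight a)) =
    C \<Lambda> b * ((weight b - t1 * t2 * weight a) * (weight b - weight a))"
  shows "exchange C"
  unfolding exchange_def
proof (intro allI ballI impI)
  fix \<Lambda> :: "'r diagrams" and a b
  assume ab: "a \<in> addables \<Lambda>" "b \<in> addables \<Lambda>" "a \<noteq> b"
  define x where "x = weight b"
  define y where "y = weight a"
  have 1: "C (plus_cell \<Lambda> a) b * ((x - t1 * y) * (x - t2 * y)) = C \<Lambda> b * ((x - t1 * t2 * y) * (x - y))"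
    and 2: "C (plus_cell \<Lambda> b) a * ((y - t1 * x) * (y - t2 * x)) = C \<Lambda> a * ((y - t1 * t2 * x) * (y - x))"
    using assms[of a \<Lambda> b] assms[of b \<Lambda> a] ab by (auto simp: x_def y_def)
  have 3: "(x - t1 * t2 * y) * (x - t3 * y) = (y - t1 * t2 * x) * (y - t3 * x)"
    using t_product by algebra
  have "C \<Lambda> a * C (plus_cell \<Lambda> a) b * zw_poly x y = C \<Lambda> a * (C \<Lambda> b * ((x - t1 * t2 * y) * (x - y))) * (x - t3 * y)"
    unfolding 1[symmetric] zw_poly_def by (simp only: mult_ac)
  also have "\<dots> = - (C \<Lambda> b * (C \<Lambda> a * ((y - t1 * t2 * x) * (y - x))) * (y - t3 * x))"
    using 3 by algebra
  also have "\<dots> = - (C \<Lambda> b * C (plus_cell \<Lambda> b) a * zw_poly y x)"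
    unfolding 2[symmetric] zw_poly_def by (simp only: mult_ac)
  finally show "C \<Lambda> a * C (plus_cell \<Lambda> a) b * zw_poly (weight b) (weight a) =
      - (C \<Lambda> b * C (plus_cell \<Lambda> b) a * zw_poly (weight a) (weight b))"
    unfolding x_def y_def .
qed

lemma times_edge: "a * b = - e \<Longrightarrow> c * a * r * b = - (c * (e * r))" for a b c e r :: 'k
proof -
  assume "a * b = - e"
  moreover have "c * a * r * b = (a * b) * (c * r)" by (simp only: mult_ac)
  ultimately show ?thesis by (simp add: mult_ac)
qed

lemma prod_row_product:
  "(\<Prod>a\<in>UNIV. (\<Prod>k=1..L. f (a, k)) * g a) = (\<Prod>p\<in>UNIV \<times> {1..L}. f p) * (\<Prod>a\<in>(UNIV :: 'r set). g a)"
  for f :: "'r \<times> nat \<Rightarrow> 'k" and L :: nat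
  by (simp only: prod.distrib prod.cartesian_product case_prod_unfold prod.collapse)

subsection \<open>The coefficients as products over any sufficiently large number of rows\<close>

lemma cutoff_props: "j \<le> cutoff \<Lambda> j" "tall (cutoff \<Lambda> j) (\<Lambda> :: 'r diagrams)"
  and cutoff_le: "tall L \<Lambda> \<Longrightarrow> j \<le> L \<Longrightarrow> cutoff \<Lambda> j \<le> L"
proof -
  obtain L where "tall L \<Lambda>" "j \<le> L" using tall_ex by blast
  then have "j \<le> cutoff \<Lambda> j \<and> (\<forall>a. \<forall>k>cutoff \<Lambda> j. row (\<Lambda> a) k = 0)"
    unfolding cutoff_def by (intro LeastI) (auto simp: tall_def)
  then show "j \<le> cutoff \<Lambda> j" "tall (cutoff \<Lambda> j) \<Lambda>" by (auto simp: tall_def)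
  show "cutoff \<Lambda> j \<le> L" if "tall L \<Lambda>" "j \<le> L" for L
    using that unfolding cutoff_def by (intro Least_le) (auto simp: tall_def)
qed

lemma row_weight_eq: "row_weight t1 t2 \<chi> \<Lambda> a k = pole \<Lambda> (a, k, False)"
  by (simp add: row_weight_def pole_def mon_def)

lemma t1_pole: "t1 * pole \<Lambda> (a, k, False) = pole \<Lambda> (a, k, True)"
  and t2_pole: "t2 * pole \<Lambda> (a, k, True) = zero \<Lambda> (a, k, False)"
  and pole_t2: "pole \<Lambda> (a, k, False) = t2 * zero \<Lambda> (a, k, True)"
  by (simp_all add: pole_def zero_def t1_mon t2_mon)

text \<open>
  The contributions of a row to the coefficients of adding and of removing a cell of weight \<open>x\<close>.  Away
  from the row of that cell their product is the factor of the row in the eigenvalue, up to \<open>t2\<close>.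
\<close>

definition adding_factor :: "'r diagrams \<Rightarrow> 'k \<Rightarrow> 'r \<times> nat \<Rightarrow> 'k" where
  "adding_factor \<Lambda> x p = (x - zero \<Lambda> (fst p, snd p, False)) / (x - pole \<Lambda> (fst p, snd p, True))"

definition removing_factor :: "'r diagrams \<Rightarrow> 'k \<Rightarrow> 'r \<times> nat \<Rightarrow> 'k" where
  "removing_factor \<Lambda> x p = t2 * (x - zero \<Lambda> (fst p, snd p, True)) / (x - pole \<Lambda> (fst p, snd p, False))"

text \<open>
  The values of the infinite products over the empty rows after row \<open>L\<close>.
\<close>

definition adding_tail :: "nat \<Rightarrow> 'k \<Rightarrow> 'r \<Rightarrow> 'k" where
  "adding_tail L x a = x / (x - mon 0 (int L) a)"

definition removing_tail :: "nat \<Rightarrow> 'k \<Rightarrow> 'r \<Rightarrow> 'k" where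
  "removing_tail L x a = 1 - t2 * x / mon (-1) (int L) a"

text \<open>
  The tails make the choice of the row at which the products are cut off irrelevant.  This is needed
  to compare coefficients for different diagrams row by row.
\<close>

lemma telescoping_product:
  fixes f g :: "nat \<Rightarrow> 'r \<Rightarrow> 'k" and \<Lambda> :: "'r diagrams"
  assumes step: "\<And>k a. m \<le> k \<Longrightarrow> f (Suc k) a * g (Suc k) a = g k a"
    and "m \<le> L"
  shows "(\<Prod>a\<in>UNIV. (\<Prod>k=1..m. f k a) * g m a) = (\<Prod>a\<in>UNIV. (\<Prod>k=1..L. f k a) * g L a)"
  using assms(2)
proof (induction L rule: dec_induct)
  case (step k)
  have "(\<Prod>k=1..Suc k. f k a) * g (Suc k) a = (\<Prod>k=1..k. f k a) * g k a" for a
    using assms(1)[OF step.hyps(1), of a] by (simp add: mult.assoc)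
  then show ?case using step.IH by (simp only:)
qed simp

lemma gieseker_e_eq:
  assumes b: "(l, i, j) \<in> addables \<Lambda>" and L: "tall L (plus_cell \<Lambda> (l, i, j))"
  defines "x \<equiv> weight (l, i, j)"
  shows "gieseker_e t1 t2 \<chi> p (plus_cell \<Lambda> (l, i, j)) l j = x powi p / (1 - t1 * t2) *
    ((\<Prod>p\<in>UNIV \<times> {1..L}. adding_factor (plus_cell \<Lambda> (l, i, j)) x p) * (\<Prod>a\<in>UNIV. adding_tail L x a))"
proof -
  let ?M = "plus_cell \<Lambda> (l, i, j)"
  note L' = tall_plus[OF L b]
  have x: "x \<noteq> 0" by (simp add: x_def)
  have wl: "row_weight t1 t2 \<chi> ?M l j = x"
    using pole_removable[OF removables_plus_cell[OF b]] by (simp add: row_weight_eq x_def)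
  define m where "m = cutoff ?M j"
  have m: "j \<le> m" "tall m ?M" "m \<le> L"
    unfolding m_def using cutoff_props[where j = j and \<Lambda> = ?M] cutoff_le[OF L L'(3)] by auto
  define f where "f k a = adding_factor ?M x (a, k)" for k a
  have empty: "pole ?M (a, k, True) = mon 0 (int k - 1) a" "zero ?M (a, k, False) = mon 0 (int k) a" if "m < k" for a k
    using m(2) that by (simp_all add: pole_def zero_def tall_def)
  have x_tail: "x \<noteq> mon 0 (int k) a" if "j \<le> k" for k a
    using that by (auto simp: x_def weight_addable[OF b])
  have f: "(1 - t1 * t2 * pole ?M (a, k, False) / x) / (1 - t1 * pole ?M (a, k, False) / x) = f k a" for a k
    using t1_pole[of ?M a k] t2_pole[of ?M a k] x
    by (simp add: f_def adding_factor_def one_minus_divide mult.assoc mult.left_commute[of t1])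
  have g: "1 / (1 - t1 * pole ?M (a, m + 1, False) / x) = adding_tail m x a" for a
    using t1_pole[of ?M a "m + 1"] empty(1)[of "m + 1" a] x by (simp add: adding_tail_def one_minus_divide)
  have "f (Suc k) a * adding_tail (Suc k) x a = adding_tail k x a" if "m \<le> k" for k a
  proof -
    have "x - mon 0 (int k + 1) a \<noteq> 0" using x_tail[of "Suc k" a] that m by (simp add: add.commute)
    then show ?thesis
      using that by (simp add: f_def adding_factor_def adding_tail_def empty add.commute)
  qed
  then have "(\<Prod>a\<in>UNIV. (\<Prod>k=1..m. f k a) * adding_tail m x a) = (\<Prod>a\<in>UNIV. (\<Prod>k=1..L. f k a) * adding_tail L x a)"
    by (rule telescoping_product[OF _ m(3)])
  then show ?thesis
    unfolding gieseker_e_def Let_def m_def[symmetric] wl unfolding row_weight_eq f g prod_row_product[symmetric]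
    by (simp add: f_def)
qed

lemma gieseker_f_eq:
  assumes b: "(l, i, j) \<in> addables \<Lambda>" and L: "tall L (plus_cell \<Lambda> (l, i, j))"
  defines "x \<equiv> weight (l, i, j)"
  shows "gieseker_f t1 t2 t \<chi> p \<Lambda> l j =
    (- t) powi (int (card (UNIV :: 'r set)) - 2) * (\<Prod>a\<in>UNIV. inverse (\<chi> a)) *
    (x powi (p - int (card (UNIV :: 'r set))) / (1 - t1 * t2)) *
    ((\<Prod>p\<in>UNIV \<times> {1..L}. removing_factor \<Lambda> x p) * (\<Prod>a\<in>UNIV. removing_tail L x a))"
proof -
  note L' = tall_plus[OF L b]
  have wl: "t1 * row_weight t1 t2 \<chi> \<Lambda> l j = x"
    using pole_addable[OF b] by (simp add: row_weight_eq x_def t1_pole)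
  define m where "m = cutoff \<Lambda> j"
  have m: "j \<le> m" "tall m \<Lambda>" "m \<le> L"
    unfolding m_def using cutoff_props[where j = j and \<Lambda> = \<Lambda>] cutoff_le[OF L'(1,3)] by auto
  define f where "f k a = removing_factor \<Lambda> x (a, k)" for k a
  have empty: "pole \<Lambda> (a, k, False) = mon (-1) (int k - 1) a" "zero \<Lambda> (a, k, True) = mon (-1) (int k - 2) a" if "m < k" for a k
    using m(2) that by (simp_all add: pole_def zero_def tall_def)
  have x_tail: "x \<noteq> mon (-1) k a" for k a
    by (auto simp: x_def weight_addable[OF b])
  have ratio: "(1 - t2 * x / w) / (1 - x / w) = t2 * (x - w / t2) / (x - w)" if "w \<noteq> 0" for w
  proof -
    have "(1 - t2 * x / w) / (1 - x / w) = ((w - t2 * x) / w) / ((w - x) / w)"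
      using that by (simp add: diff_divide_distrib)
    also have "\<dots> = (- (w - t2 * x)) / (- (w - x))" using that by (simp only: minus_divide_divide) simp
    also have "- (w - t2 * x) = t2 * (x - w / t2)" by (simp add: right_diff_distrib)
    finally show ?thesis by simp
  qed
  have f: "(1 - t1 * t2 * row_weight t1 t2 \<chi> \<Lambda> l j / row_weight t1 t2 \<chi> \<Lambda> a k) /
      (1 - t1 * row_weight t1 t2 \<chi> \<Lambda> l j / row_weight t1 t2 \<chi> \<Lambda> a k) = f k a" for a k
  proof -
    have 1: "t1 * t2 * row_weight t1 t2 \<chi> \<Lambda> l j = t2 * x" using wl by (simp add: mult_ac)
    have 2: "pole \<Lambda> (a, k, False) / t2 = zero \<Lambda> (a, k, True)" using pole_t2[of \<Lambda> a k] by simp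
    show ?thesis
      unfolding 1 wl unfolding row_weight_eq ratio[OF pole_nonzero] 2 by (simp add: f_def removing_factor_def)
  qed
  have g: "1 - t1 * t2 * row_weight t1 t2 \<chi> \<Lambda> l j / row_weight t1 t2 \<chi> \<Lambda> a (m + 1) = removing_tail m x a" for a
  proof -
    have 1: "t1 * t2 * row_weight t1 t2 \<chi> \<Lambda> l j = t2 * x" using wl by (simp add: mult_ac)
    show ?thesis
      unfolding 1 unfolding row_weight_eq using empty(1)[of "m + 1" a] by (simp add: removing_tail_def)
  qed
  have "f (Suc k) a * removing_tail (Suc k) x a = removing_tail k x a" if "m \<le> k" for k a
  proof -
    define w where "w = mon (-1) (int k) a"
    have w: "w \<noteq> 0" "x - w \<noteq> 0" using x_tail by (auto simp: w_def)
    have "mon (-1) (int (Suc k)) a = t2 * w" by (simp add: w_def t2_mon add.commute)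
    then have "removing_tail (Suc k) x a = 1 - x / w" "removing_tail k x a = 1 - t2 * x / w"
      by (simp_all add: removing_tail_def w_def)
    moreover have "f (Suc k) a = (1 - t2 * x / w) / (1 - x / w)"
    proof -
      have "zero \<Lambda> (a, Suc k, True) = w / t2" "pole \<Lambda> (a, Suc k, False) = w"
        using that by (simp_all add: empty w_def t_div_mon)
      then show ?thesis unfolding ratio[OF w(1)] by (simp add: f_def removing_factor_def)
    qed
    moreover have "1 - x / w \<noteq> 0" using w by simp
    ultimately show ?thesis by simp
  qed
  then have "(\<Prod>a\<in>UNIV. (\<Prod>k=1..m. f k a) * removing_tail m x a) = (\<Prod>a\<in>UNIV. (\<Prod>k=1..L. f k a) * removing_tail L x a)"
    by (rule telescoping_product[OF _ m(3)])
  then show ?thesis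
    unfolding gieseker_f_def Let_def m_def[symmetric] f g unfolding wl prod_row_product[symmetric]
    by (simp add: f_def)
qed

definition gieseker_C :: "'r diagrams \<Rightarrow> 'r cell \<Rightarrow> 'k" where
  "gieseker_C \<Lambda> = (\<lambda>(l, i, j). gieseker_e t1 t2 \<chi> 0 (plus_cell \<Lambda> (l, i, j)) l j)"

definition gieseker_D :: "'r diagrams \<Rightarrow> 'r cell \<Rightarrow> 'k" where
  "gieseker_D \<Lambda> = (\<lambda>(l, i, j). gieseker_f t1 t2 t \<chi> 0 \<Lambda> l j)"

lemma gieseker_e_power:
  assumes "(l, i, j) \<in> addables \<Lambda>"
  shows "gieseker_e t1 t2 \<chi> p (plus_cell \<Lambda> (l, i, j)) l j = gieseker_C \<Lambda> (l, i, j) * weight (l, i, j) powi p"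
proof -
  obtain L where L: "tall L (plus_cell \<Lambda> (l, i, j))" using tall_ex by blast
  show ?thesis unfolding gieseker_C_def prod.case gieseker_e_eq[OF assms L] by simp
qed

lemma gieseker_f_power:
  assumes "(l, i, j) \<in> addables \<Lambda>"
  shows "gieseker_f t1 t2 t \<chi> p \<Lambda> l j = gieseker_D \<Lambda> (l, i, j) * weight (l, i, j) powi p"
proof -
  obtain L where L: "tall L (plus_cell \<Lambda> (l, i, j))" using tall_ex by blast
  show ?thesis unfolding gieseker_D_def prod.case gieseker_f_eq[OF assms L]
    by (simp add: power_int_diff power_int_minus inverse_eq_divide)
qed

lemma t12_neq_1: "t1 * t2 \<noteq> 1"
  using t_neq_1(3) t_product by auto

lemma gieseker_C_nonzero:
  assumes "b \<in> addables \<Lambda>"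
  shows "gieseker_C \<Lambda> b \<noteq> 0"
proof -
  obtain l i j where b_eq: "b = (l, i, j)" by (cases b) auto
  note b = assms[unfolded b_eq]
  obtain L where L: "tall L (plus_cell \<Lambda> (l, i, j))" using tall_ex by blast
  let ?x = "weight (l, i, j)"
  have x: "?x = mon (int (row (\<Lambda> l) j)) (int j - 1) l" by (rule weight_addable[OF b])
  have "?x \<noteq> zero (plus_cell \<Lambda> (l, i, j)) (a, k, False)" if "1 \<le> k" for a k
    using weight_neq_zero[OF b that, of a False] by (auto simp: zero_def row_plus_cell[OF b] x)
  moreover have "?x \<noteq> pole (plus_cell \<Lambda> (l, i, j)) (a, k, True)" for a k
    by (auto simp: pole_def row_plus_cell[OF b] x)
  moreover have "?x \<noteq> mon 0 (int L) a" for a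
    using tall_plus[OF L b] by (auto simp: x)
  ultimately show ?thesis
    unfolding b_eq gieseker_C_def prod.case gieseker_e_eq[OF b L]
    using t12_neq_1 by (auto simp: adding_factor_def adding_tail_def prod_zero_iff)
qed

text \<open>
  The presence of \<open>a\<close> changes only the factor of its row in the coefficient of \<open>b\<close>.
\<close>

lemma gieseker_exchange: "exchange gieseker_C"
proof (rule exchangeI_ratio)
  fix \<Lambda> :: "'r diagrams" and a b
  assume ab: "a \<in> addables \<Lambda>" "b \<in> addables \<Lambda>" "a \<noteq> b"
  obtain l i j l' i' j' where eqs: "b = (l, i, j)" "a = (l', i', j')" by (cases a, cases b) auto
  note b = ab(2)[unfolded eqs] and a = ab(1)[unfolded eqs]
  let ?x = "weight (l, i, j)" and ?y = "weight (l', i', j')"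
  let ?A = "plus_cell \<Lambda> a" and ?B = "plus_cell \<Lambda> b"
  have b': "(l, i, j) \<in> addables ?A" and a': "(l', i', j') \<in> addables ?B"
    using addables_plus_cell[of a \<Lambda> b] addables_plus_cell[of b \<Lambda> a] ab eqs by auto
  have comm: "plus_cell ?A (l, i, j) = plus_cell ?B (l', i', j')"
    using plus_cell_commute[OF ab] eqs by simp
  obtain L where L: "tall L (plus_cell ?A (l, i, j))" using tall_ex by blast
  have LB: "tall L (plus_cell ?B (l', i', j'))" using L comm by simp
  note LB' = tall_plus[OF LB a']
  have pos: "(l', j') \<noteq> (l, j)" using ab eqs a b by (auto simp: addables_iff)
  have p: "(l', j') \<in> UNIV \<times> {1..L}" using LB' by simp
  have split: "(\<Prod>p\<in>UNIV \<times> {1..L}. adding_factor M ?x p) =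
      adding_factor M ?x (l', j') * (\<Prod>p\<in>UNIV \<times> {1..L} - {(l', j')}. adding_factor M ?x p)" for M
    by (rule prod.remove[OF _ p]) simp
  have other: "(\<Prod>p\<in>UNIV \<times> {1..L} - {(l', j')}. adding_factor (plus_cell ?B (l', i', j')) ?x p) =
      (\<Prod>p\<in>UNIV \<times> {1..L} - {(l', j')}. adding_factor ?B ?x p)"
    by (rule prod.cong) (auto simp: adding_factor_def zero_def pole_def row_plus_cell[OF a'])
  have row: "row (?B l') j' = row (\<Lambda> l') j'"
    using pos row_plus_cell[OF b, of l' j'] eqs by auto
  have y: "?y = mon (int (row (\<Lambda> l') j')) (int j' - 1) l'" by (rule weight_addable[OF a])
  have old: "adding_factor ?B ?x (l', j') = (?x - t2 * ?y) / (?x - ?y)"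
    by (simp add: adding_factor_def zero_def pole_def row y t2_mon)
  have new: "adding_factor (plus_cell ?B (l', i', j')) ?x (l', j') = (?x - t1 * t2 * ?y) / (?x - t1 * ?y)"
    by (simp add: adding_factor_def zero_def pole_def row_plus_cell[OF a'] row y t1_mon t2_mon mult.assoc add.commute)
  have ne: "?x \<noteq> ?y" "?x \<noteq> t1 * ?y" "?x \<noteq> t2 * ?y"
    using two_addables[of a \<Lambda> b] ab eqs unfolding weight_precedes by auto
  have "adding_factor (plus_cell ?B (l', i', j')) ?x (l', j') * ((?x - t1 * ?y) * (?x - t2 * ?y)) =
      adding_factor ?B ?x (l', j') * ((?x - t1 * t2 * ?y) * (?x - ?y))"
  proof -
    have "p / u * (u * v) = v / w * (p * w)" if "u \<noteq> 0" "w \<noteq> 0" for p u v w :: 'k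
      using that by simp
    moreover have "?x - t1 * ?y \<noteq> 0" "?x - ?y \<noteq> 0" using ne by (simp_all del: weight_eq_iff)
    ultimately show ?thesis unfolding old new by blast
  qed
  then show "gieseker_C (plus_cell \<Lambda> a) b * ((weight b - t1 * weight a) * (weight b - t2 * weight a)) =
      gieseker_C \<Lambda> b * ((weight b - t1 * t2 * weight a) * (weight b - weight a))"
    using gieseker_e_eq[OF b', of L 0, OF L] gieseker_e_eq[OF b, of L 0] LB'(1)
    unfolding eqs(1) unfolding eqs(2) gieseker_C_def prod.case
    by (simp only: comm[unfolded eqs] eqs split other[unfolded eqs]) (rule product_swap)
qed

text \<open>
  The row of the box contributes an explicit constant, every other row \<open>t2\<close> times its factor in the
  eigenvalue.  The powers of \<open>t2\<close> cancel against the tails, and those of \<open>x\<close> and \<open>t\<close> against the prefactor of \<open>f\<close>.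
\<close>

lemma gieseker_C_D:
  assumes b: "(l, i, j) \<in> addables \<Lambda>" and L: "tall L (plus_cell \<Lambda> (l, i, j))"
  shows "gieseker_C \<Lambda> (l, i, j) * gieseker_D \<Lambda> (l, i, j) * (weight (l, i, j) * ((1 - t1) * (1 - t2) * (1 - t3))) =
      - (inverse t ^ card (UNIV :: 'r set) * end_residue L \<Lambda> (l, j, True))"
proof -
  define N where "N = card (UNIV :: 'r set)"
  define M where "M = plus_cell \<Lambda> (l, i, j)"
  define x where "x = weight (l, i, j)"
  have x0: "x \<noteq> 0" by (simp add: x_def)
  note L' = tall_plus[OF L b]
  have p: "(l, j) \<in> UNIV \<times> {1..L}" using L' by simp
  have x_mon: "x = mon (int (row (\<Lambda> l) j)) (int j - 1) l" unfolding x_def by (rule weight_addable[OF b])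
  define R where "R = (\<Prod>p\<in>UNIV \<times> {1..L} - {(l, j)}. row_factor id \<Lambda> x p)"
  define T where "T = (\<Prod>a\<in>UNIV. tail_factor id L x a)"
  \<comment> \<open>In all rows but the one of the new box, the two factors combine to a row factor of the eigenvalue.\<close>
  have "adding_factor M x p * removing_factor \<Lambda> x p = t2 * row_factor id \<Lambda> x p"
    if "p \<in> UNIV \<times> {1..L} - {(l, j)}" for p
    using that by (cases p) (auto simp: adding_factor_def removing_factor_def row_factor_def zero_def pole_def M_def row_plus_cell[OF b])
  then have "(\<Prod>p\<in>UNIV \<times> {1..L} - {(l, j)}. adding_factor M x p * removing_factor \<Lambda> x p) =
      (\<Prod>p\<in>UNIV \<times> {1..L} - {(l, j)}. t2 * row_factor id \<Lambda> x p)"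
    by (rule prod.cong[OF refl])
  also have "\<dots> = t2 ^ card (UNIV \<times> {1..L} - {(l :: 'r, j)}) * R"
    unfolding prod.distrib R_def by simp
  also have "card (UNIV \<times> {1..L} - {(l :: 'r, j)}) = N * L - 1"
    using p by (subst card_Diff_singleton) (auto simp: N_def card_cartesian_product)
  finally have others: "(\<Prod>p\<in>UNIV \<times> {1..L} - {(l, j)}. adding_factor M x p * removing_factor \<Lambda> x p) = t2 ^ (N * L - 1) * R" .
  have "t2 ^ (N * L) = t2 * t2 ^ (N * L - 1)"
  proof -
    have "0 < N * L" using L' by (simp add: N_def card_gt_0_iff)
    then show ?thesis by (metis Suc_diff_1 power_Suc)
  qed
  then have t2_pow: "t2 ^ (N * L - 1) = t2 ^ (N * L) / t2" by simp
  have own: "adding_factor M x (l, j) * removing_factor \<Lambda> x (l, j) = ((1 - t1 * t2) / (1 - t1)) ^ 2"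
  proof -
    have "zero M (l, j, False) = t1 * t2 * x" "pole M (l, j, True) = t1 * x"
        "zero \<Lambda> (l, j, True) = t3 * x" "pole \<Lambda> (l, j, False) = x / t1"
      by (simp_all add: zero_def pole_def M_def row_plus_cell[OF b] x_mon t1_mon t2_mon t3_mon t_div_mon mult.assoc add.commute)
    then have "adding_factor M x (l, j) = (x - t1 * t2 * x) / (x - t1 * x)"
        "removing_factor \<Lambda> x (l, j) = t2 * (x - t3 * x) / (x - x / t1)"
      by (simp_all add: adding_factor_def removing_factor_def)
    moreover have "(x - t1 * t2 * x) / (x - t1 * x) = (1 - t1 * t2) / (1 - t1)"
    proof -
      have "x - t1 * t2 * x = (1 - t1 * t2) * x" "x - t1 * x = (1 - t1) * x" by (simp_all add: algebra_simps)
      then show ?thesis using x0 by simp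
    qed
    moreover have "t2 * (x - t3 * x) / (x - x / t1) = (1 - t1 * t2) / (1 - t1)"
    proof -
      have "t2 * (x - t3 * x) = (1 - t1 * t2) * (- (x / t1))" by (simp add: t3_def field_simps)
      moreover have "x - x / t1 = (1 - t1) * (- (x / t1))" by (simp add: field_simps)
      ultimately show ?thesis using x0 by simp
    qed
    ultimately show ?thesis by (simp add: power2_eq_square)
  qed
  have "adding_tail L x a * removing_tail L x a = (- x * t1 * t2 / t2 ^ L) * \<chi> a * tail_factor id L x a" for a
  proof -
    have 1: "mon (-1) (int L) a = t2 * mon (-1) (int L - 1) a" by (simp add: t2_mon)
    have "mon (-1) (int L) a = t2 ^ L / (t1 * \<chi> a)" by (simp add: mon_def power_int_minus field_simps)
    then have 2: "1 / mon (-1) (int L - 1) a = t1 * t2 * \<chi> a / t2 ^ L" using 1 by (simp add: field_simps)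
    have "removing_tail L x a = - (x - mon (-1) (int L - 1) a) * (1 / mon (-1) (int L - 1) a)"
      unfolding removing_tail_def 1 by (simp add: diff_divide_distrib)
    moreover have "x / d * (- s * (t1 * t2 * u / q)) = (- x * t1 * t2 / q) * u * (s / d)" for d s u q :: 'k
      by (simp add: mult_ac)
    ultimately show ?thesis
      unfolding 2 adding_tail_def tail_factor_def id_apply by (simp only:)
  qed
  then have tails: "(\<Prod>a\<in>UNIV. adding_tail L x a * removing_tail L x a) =
      (- x * t1 * t2 / t2 ^ L) ^ N * (\<Prod>a\<in>UNIV. \<chi> a) * T"
    unfolding T_def N_def by (simp only: prod.distrib prod_constant)
  have chi: "(\<Prod>a\<in>UNIV. inverse (\<chi> a)) * (\<Prod>a\<in>UNIV. \<chi> a) = 1"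
    by (simp add: prod.distrib[symmetric])
  have scalars: "(- t) powi (int N - 2) * x powi (- int N) * t2 ^ (N * L) * (- x * t1 * t2 / t2 ^ L) ^ N = inverse t ^ N * (t1 * t2)"
  proof -
    have "(- t) powi (int N - 2) = (- t) ^ N * (t1 * t2)"
      using t_square by (simp add: power_int_diff field_simps)
    moreover have "x powi (- int N) = 1 / x ^ N" by (simp add: power_int_minus inverse_eq_divide)
    moreover have "(- x * t1 * t2 / t2 ^ L) ^ N = (- x * t1 * t2) ^ N / t2 ^ (N * L)"
      by (simp only: power_divide power_mult[symmetric] mult.commute[of L])
    moreover have "(- t) ^ N * (- x * t1 * t2) ^ N / x ^ N = inverse t ^ N"
    proof -
      have "t * (t1 * t2) = inverse t" using t_square by (simp add: power2_eq_square field_simps)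
      then have "(- t) * (- x * t1 * t2) / x = inverse t" using x0 by (simp add: mult.assoc)
      then show ?thesis by (simp only: power_mult_distrib[symmetric] power_divide[symmetric])
    qed
    moreover have "(a * c) * (1 / y) * q * (b / q) = (a * b / y) * c" if "q \<noteq> 0" for a b c q y :: 'k
      using that by simp
    moreover have "t2 ^ (N * L) \<noteq> 0" by simp
    ultimately show ?thesis by (simp only: not_False_eq_True)
  qed
  have res: "end_residue L \<Lambda> (l, j, True) = (x - t3 * x) * (x - t2 * x) / (x - x / t1) * (R * T)"
  proof -
    have "pole \<Lambda> (l, j, True) = x" "zero \<Lambda> (l, j, True) = t3 * x" "zero \<Lambda> (l, j, False) = t2 * x" "pole \<Lambda> (l, j, False) = x / t1"
      by (simp_all add: zero_def pole_def x_mon t2_mon t3_mon t_div_mon)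
    then show ?thesis unfolding residue_rows[OF L'] R_def T_def by simp
  qed
  have "(\<Prod>p\<in>UNIV \<times> {1..L}. adding_factor M x p) * (\<Prod>p\<in>UNIV \<times> {1..L}. removing_factor \<Lambda> x p) =
      (\<Prod>p\<in>UNIV \<times> {1..L}. adding_factor M x p * removing_factor \<Lambda> x p)"
    by (simp only: prod.distrib)
  also have "\<dots> = adding_factor M x (l, j) * removing_factor \<Lambda> x (l, j) *
      (\<Prod>p\<in>UNIV \<times> {1..L} - {(l, j)}. adding_factor M x p * removing_factor \<Lambda> x p)"
    by (rule prod.remove[OF _ p]) simp
  also have "\<dots> = ((1 - t1 * t2) / (1 - t1)) ^ 2 * (t2 ^ (N * L) / t2 * R)"
    unfolding own others t2_pow ..
  finally have "(\<Prod>p\<in>UNIV \<times> {1..L}. adding_factor M x p) * (\<Prod>p\<in>UNIV \<times> {1..L}. removing_factor \<Lambda> x p) =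
      ((1 - t1 * t2) / (1 - t1)) ^ 2 * (t2 ^ (N * L) / t2 * R)" .
  moreover have "(\<Prod>a\<in>UNIV. adding_tail L x a) * (\<Prod>a\<in>UNIV. removing_tail L x a) =
      (- x * t1 * t2 / t2 ^ L) ^ N * (\<Prod>a\<in>UNIV. \<chi> a) * T"
    unfolding prod.distrib[symmetric] by (rule tails)
  moreover have "gieseker_C \<Lambda> (l, i, j) = 1 / (1 - t1 * t2) *
      ((\<Prod>p\<in>UNIV \<times> {1..L}. adding_factor M x p) * (\<Prod>a\<in>UNIV. adding_tail L x a))"
    unfolding gieseker_C_def prod.case gieseker_e_eq[OF b L] M_def x_def by simp
  moreover have "gieseker_D \<Lambda> (l, i, j) = (- t) powi (int N - 2) * (\<Prod>a\<in>UNIV. inverse (\<chi> a)) *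
    (x powi (- int N) / (1 - t1 * t2)) *
    ((\<Prod>p\<in>UNIV \<times> {1..L}. removing_factor \<Lambda> x p) * (\<Prod>a\<in>UNIV. removing_tail L x a))"
    unfolding gieseker_D_def prod.case gieseker_f_eq[OF b L] x_def N_def by simp
  moreover have "1 / d * (ap * aq) * (c * h * (y / d) * (rp * rq)) =
      (1 / d) ^ 2 * o' / t2 * (h * h') * (c * y * e * u) * (R * T)"
    if "ap * rp = o' * (e / t2 * R)" "aq * rq = u * h' * T" for ap aq rp rq c h h' y d e u o' :: 'k
  proof -
    have "1 / d * (ap * aq) * (c * h * (y / d) * (rp * rq)) = (1 / d) ^ 2 * c * h * y * ((ap * rp) * (aq * rq))"
      by (simp add: power2_eq_square)
    then show ?thesis unfolding that by simp
  qed
  ultimately have "gieseker_C \<Lambda> (l, i, j) * gieseker_D \<Lambda> (l, i, j) =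
      (1 / (1 - t1 * t2)) ^ 2 * ((1 - t1 * t2) / (1 - t1)) ^ 2 / t2 * ((\<Prod>a\<in>UNIV. inverse (\<chi> a)) * (\<Prod>a\<in>UNIV. \<chi> a)) *
      ((- t) powi (int N - 2) * x powi (- int N) * t2 ^ (N * L) * (- x * t1 * t2 / t2 ^ L) ^ N) * (R * T)"
    by (simp only:)
  also have "\<dots> = inverse t ^ N * (t1 / (1 - t1) ^ 2) * (R * T)"
    unfolding chi scalars using t12_neq_1 by (simp add: power_divide)
  finally have CD: "gieseker_C \<Lambda> (l, i, j) * gieseker_D \<Lambda> (l, i, j) = inverse t ^ N * (t1 / (1 - t1) ^ 2) * (R * T)" .
  have "t1 / (1 - t1) ^ 2 * (x * ((1 - t1) * (1 - t2) * (1 - t3))) = - ((x - t3 * x) * (x - t2 * x) / (x - x / t1))"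
  proof -
    have "x - x / t1 = - (x / t1) * (1 - t1)" by (simp add: field_simps)
    moreover have "(x - t3 * x) * (x - t2 * x) = x * (x * ((1 - t2) * (1 - t3)))" by (simp add: algebra_simps)
    ultimately show ?thesis using x0 by (simp add: power2_eq_square)
  qed
  then show ?thesis
    unfolding CD res x_def[symmetric] N_def[symmetric] by (rule times_edge)
qed

end

section \<open>Tensor products of Fock modules\<close>

context toroidal_parameters
begin

lemma mon_quotient: "a = i - i' \<Longrightarrow> b = j - j' \<Longrightarrow> t1 powi a * t2 powi b = mon i j l / mon i' j' l"
  by (simp add: mon_def power_int_diff)

text \<open>
  The condition on the products allows to clear the denominators of the arguments without leaving a factor.
\<close>

lemma four_factors:
  fixes x z z' p p' :: 'k
  assumes "z * z' = p * p'" "z \<noteq> 0" "z' \<noteq> 0" "p \<noteq> 0" "p' \<noteq> 0"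
  shows "(1 - x / z) * (1 - x / z') / ((1 - x / p) * (1 - x / p')) = (x - z') / (x - p) * ((x - z) / (x - p'))"
proof -
  have 1: "1 - x / w = (x - w) * (- (1 / w))" if "w \<noteq> 0" for w
    using that by (simp add: diff_divide_distrib)
  have "(1 - x / z) * (1 - x / z') / ((1 - x / p) * (1 - x / p')) =
      ((x - z) * (x - z') * (1 / (z * z'))) / ((x - p) * (x - p') * (1 / (p * p')))"
    unfolding 1[OF assms(2)] 1[OF assms(3)] 1[OF assms(4)] 1[OF assms(5)] by simp
  also have "\<dots> = ((x - z) * (x - z')) / ((x - p) * (x - p'))"
    unfolding assms(1) using assms(4,5) by simp
  finally show ?thesis by (simp add: mult.commute)
qed

text \<open>
  In \<open>F(u)\<close>, the coefficient of adding a box to row \<open>j\<close> collects the row factors of the eigenvalue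
  below \<open>j\<close>, and the coefficient of removing the box collects those above \<open>j\<close>.
\<close>

lemma fock_e_rows:
  fixes \<Lambda> :: "'r diagrams" and l :: 'r and j :: nat
  defines "x \<equiv> mon (int (row (\<Lambda> l) j)) (int j - 1) l"
  shows "fock_e t1 t2 (\<Lambda> l) j = (\<Prod>k\<in>{1..<j}. row_factor id \<Lambda> x (l, k)) * (1 / (1 - t1))"
proof -
  define n where "n k = int (row (\<Lambda> l) k)" for k
  have "(1 - t1 powi (n j - n k) * t2 powi (int j - int k - 1)) *
         (1 - t1 powi (n j - n k + 1) * t2 powi (int j - int k + 1)) /
         ((1 - t1 powi (n j - n k) * t2 powi (int j - int k)) *
          (1 - t1 powi (n j - n k + 1) * t2 powi (int j - int k))) = row_factor id \<Lambda> x (l, k)" for k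
  proof -
    have q: "t1 powi (n j - n k) * t2 powi (int j - int k - 1) = x / zero \<Lambda> (l, k, False)"
      "t1 powi (n j - n k + 1) * t2 powi (int j - int k + 1) = x / zero \<Lambda> (l, k, True)"
      "t1 powi (n j - n k) * t2 powi (int j - int k) = x / pole \<Lambda> (l, k, True)"
      "t1 powi (n j - n k + 1) * t2 powi (int j - int k) = x / pole \<Lambda> (l, k, False)"
      unfolding x_def zero_def pole_def n_def by (auto intro!: mon_quotient)
    have "zero \<Lambda> (l, k, False) * zero \<Lambda> (l, k, True) = pole \<Lambda> (l, k, True) * pole \<Lambda> (l, k, False)"
      by (simp add: zero_def pole_def mon_def power_int_diff power2_eq_square field_simps)
    moreover have "zero \<Lambda> (l, k, s) \<noteq> 0" for s by (simp add: zero_def)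
    ultimately show ?thesis
      unfolding q by (subst four_factors) (simp_all add: row_factor_def)
  qed
  then show ?thesis
    unfolding fock_e_def Let_def n_def by simp
qed

lemma fock_f_rows:
  assumes b: "(l, i, j) \<in> addables \<Lambda>" and L: "tall L (plus_cell \<Lambda> (l, i, j))"
  defines "x \<equiv> weight (l, i, j)"
  shows "fock_f t1 t2 t (plus_cell \<Lambda> (l, i, j) l) j = inverse t *
    ((\<Prod>k\<in>{j + 1..L}. row_factor id \<Lambda> x (l, k)) * tail_factor id L x l) * (1 / (inverse t1 - 1))"
proof -
  note L' = tall_plus[OF L b]
  let ?\<mu> = "plus_cell \<Lambda> (l, i, j) l"
  define n where "n k = int (row (\<Lambda> l) k)" for k
  define n' where "n' k = int (row ?\<mu> k)" for k
  define T where "T k = (x - mon (n k - 1) (int k - 2) l) / (x - mon (n k) (int k - 1) l)" for k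
  define U where "U k = (x - mon (n k) (int k) l) / (x - mon (n k - 1) (int k - 1) l)" for k
  define N where "N = num_rows ?\<mu>"
  have x: "x = mon (n j) (int j - 1) l" "x \<noteq> 0" by (simp_all add: x_def n_def weight_addable[OF b])
  have n': "n' j = n j + 1" "\<And>k. j < k \<Longrightarrow> n' k = n k"
    by (auto simp: n'_def n_def row_plus_cell[OF b])
  have "j \<le> N"
    using num_rows_zero[of ?\<mu> j] row_plus_cell[OF b, of l j] by (force simp: N_def not_less[symmetric])
  have "N \<le> L" unfolding N_def by (rule num_rows_le) (use L in \<open>simp add: tall_def\<close>)
  have quot: "1 - w / x = (x - w) / x" for w using x(2) by (simp add: diff_divide_distrib)
  have mq: "t1 powi a * t2 powi c = mon u v l / x" if "a = u - n j" "c = v - (int j - 1)" for a c u v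
    unfolding x(1) by (rule mon_quotient[OF that])
  have first: "(1 - t1 powi (n' (j + 1) - n' j)) / (1 - t1 powi (n' (j + 1) - n' j + 1) * t2) = T (j + 1)"
  proof -
    have "t1 powi (n' (j + 1) - n' j) = mon (n (j + 1) - 1) (int j - 1) l / x"
      using mq[of "n' (j + 1) - n' j" "n (j + 1) - 1" 0 "int j - 1"] by (simp add: n')
    moreover have "t1 powi (n' (j + 1) - n' j + 1) * t2 = mon (n (j + 1)) (int j) l / x"
      using mq[of "n' (j + 1) - n' j + 1" "n (j + 1)" 1 "int j"] by (simp add: n')
    ultimately show ?thesis using x(2) by (simp add: quot T_def)
  qed
  have factor: "(1 - t1 powi (n' k - n' j + 1) * t2 powi (int k - int j + 1)) *
         (1 - t1 powi (n' (k + 1) - n' j) * t2 powi (int k - int j)) /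
         ((1 - t1 powi (n' (k + 1) - n' j + 1) * t2 powi (int k - int j + 1)) *
          (1 - t1 powi (n' k - n' j) * t2 powi (int k - int j))) = U k * T (k + 1)" if "j < k" for k
  proof -
    have q: "t1 powi (n' k - n' j + 1) * t2 powi (int k - int j + 1) = mon (n k) (int k) l / x"
      "t1 powi (n' (k + 1) - n' j) * t2 powi (int k - int j) = mon (n (k + 1) - 1) (int k - 1) l / x"
      "t1 powi (n' (k + 1) - n' j + 1) * t2 powi (int k - int j + 1) = mon (n (k + 1)) (int k) l / x"
      "t1 powi (n' k - n' j) * t2 powi (int k - int j) = mon (n k - 1) (int k - 1) l / x"
      using that by (auto simp: n' intro!: mq)
    show ?thesis unfolding q quot using x(2) by (simp add: U_def T_def)
  qed
  have "fock_f t1 t2 t ?\<mu> j = inverse t * T (j + 1) * (\<Prod>k\<in>{j + 1..N}. U k * T (k + 1)) * (1 / (inverse t1 - 1))"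
    unfolding fock_f_def Let_def n'_def[symmetric] N_def[symmetric] first
    by (intro arg_cong2[where f = "(*)"] prod.cong refl factor) auto
  also have "(\<Prod>k\<in>{j + 1..N}. U k * T (k + 1)) = (\<Prod>k\<in>{j + 1..L}. U k * T (k + 1))"
  proof (rule prod.mono_neutral_left)
    show "\<forall>k\<in>{j + 1..L} - {j + 1..N}. U k * T (k + 1) = 1"
    proof
      fix k assume k: "k \<in> {j + 1..L} - {j + 1..N}"
      then have "n' k = 0" "n' (k + 1) = 0" by (auto simp: n'_def N_def num_rows_zero)
      then have "n k = 0" "n (k + 1) = 0" using k n' by auto
      moreover have "x \<noteq> mon 0 (int k) l" "x \<noteq> mon (-1) (int k - 1) l" using k by (auto simp: x(1) n_def)
      ultimately show "U k * T (k + 1) = 1" by (simp add: U_def T_def)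
    qed
  qed (use \<open>N \<le> L\<close> in auto)
  also have "inverse t * T (j + 1) * (\<Prod>k\<in>{j + 1..L}. U k * T (k + 1)) = inverse t * ((\<Prod>k\<in>{j + 1..L}. T k * U k) * T (L + 1))"
  proof -
    have "T (j + 1) * (\<Prod>k\<in>{j + 1..L}. U k * T (k + 1)) = (\<Prod>k\<in>{j + 1..L}. T k * U k) * T (L + 1)"
      using L'(3) by (induction L rule: dec_induct) (simp_all add: mult_ac)
    then show ?thesis by (simp only: mult.assoc)
  qed
  also have "T (L + 1) = tail_factor id L x l"
    using L'(1) by (simp add: T_def tail_factor_def n_def tall_def)
  also have "(\<Prod>k\<in>{j + 1..L}. T k * U k) = (\<Prod>k\<in>{j + 1..L}. row_factor id \<Lambda> x (l, k))"
    by (rule prod.cong) (simp_all add: T_def U_def row_factor_def zero_def pole_def n_def)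
  finally show ?thesis .
qed

text \<open>The coefficients of the tensor product, with the twists by the eigenvalues of the other factors.\<close>

definition fock_C :: "'r diagrams \<Rightarrow> 'r cell \<Rightarrow> 'k" where
  "fock_C \<Lambda> = (\<lambda>(l, i, j). fock_e t1 t2 (\<Lambda> l) j *
     (\<Prod>a | a < l. fock_gamma id t1 t2 t (\<Lambda> a) (inverse (\<chi> a)) (weight (l, i, j))))"

definition fock_D :: "'r diagrams \<Rightarrow> 'r cell \<Rightarrow> 'k" where
  "fock_D \<Lambda> = (\<lambda>(l, i, j). fock_f t1 t2 t (plus_cell \<Lambda> (l, i, j) l) j *
     (\<Prod>a | l < a. fock_gamma id t1 t2 t (\<Lambda> a) (inverse (\<chi> a)) (weight (l, i, j))))"

lemma weight_neq_mon: "a \<noteq> l \<Longrightarrow> weight (l, i, j) \<noteq> id (mon m n a)"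
  by (simp add: weight_def)

lemma row_factor_nonzero:
  assumes b: "(l, i, j) \<in> addables \<Lambda>" and p: "(a, k) \<noteq> (l, j)" "1 \<le> k"
  shows "row_factor id \<Lambda> (weight (l, i, j)) (a, k) \<noteq> 0"
proof -
  have "weight (l, i, j) \<noteq> pole \<Lambda> (a, k, s)" for s
    using p by (auto simp: weight_addable[OF b] pole_def)
  then show ?thesis
    using weight_neq_zero[OF b p(2)] by (simp add: row_factor_def)
qed

lemma fock_C_nonzero:
  assumes "b \<in> addables \<Lambda>"
  shows "fock_C \<Lambda> b \<noteq> 0"
proof -
  obtain l i j where b_eq: "b = (l, i, j)" by (cases b) auto
  note b = assms[unfolded b_eq]
  obtain L where L: "tall L \<Lambda>" using tall_ex by blast
  have "fock_gamma id t1 t2 t (\<Lambda> a) (inverse (\<chi> a)) (weight (l, i, j)) \<noteq> 0" if "a \<noteq> l" for a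
  proof -
    have "tail_factor id L (weight (l, i, j)) a \<noteq> 0"
      using that by (auto simp: tail_factor_def weight_def)
    then show ?thesis
      unfolding fock_gamma_row_factors[where z = "weight (l, i, j)" and \<epsilon> = id and a = a, OF weight_neq_mon[OF that] L]
      using row_factor_nonzero[OF b] that by (auto simp: prod_zero_iff)
  qed
  moreover have "fock_e t1 t2 (\<Lambda> l) j \<noteq> 0"
    unfolding fock_e_rows using row_factor_nonzero[OF b, of l] by (auto simp: weight_addable[OF b] prod_zero_iff)
  ultimately show ?thesis
    by (auto simp: b_eq fock_C_def prod_zero_iff)
qed

lemma fock_exchange: "exchange fock_C"
proof -
  define before :: "'r cell \<Rightarrow> 'r cell \<Rightarrow> bool" where
    "before = (\<lambda>(l', i', j') (l, i, j). l' < l \<or> l' = l \<and> j' < j)"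
  \<comment> \<open>A box only affects the coefficients of the boxes after it, in the order of factors and rows.\<close>
  have main: "fock_C (plus_cell \<Lambda> a) b * zw_poly (weight b) (weight a) = - (fock_C \<Lambda> b * zw_poly (weight a) (weight b))"
      "fock_C (plus_cell \<Lambda> b) a = fock_C \<Lambda> a"
    if ab: "a \<in> addables \<Lambda>" "b \<in> addables \<Lambda>" "before a b" for \<Lambda> a b
  proof -
    obtain l i j l' i' j' where eqs: "b = (l, i, j)" "a = (l', i', j')" by (cases a, cases b) auto
    note b = ab(2)[unfolded eqs] and a = ab(1)[unfolded eqs]
    let ?x = "weight (l, i, j)" and ?y = "weight (l', i', j')"
    let ?A = "plus_cell \<Lambda> (l', i', j')" and ?B = "plus_cell \<Lambda> (l, i, j)"
    let ?\<gamma> = "\<lambda>M c x. fock_gamma id t1 t2 t (M c) (inverse (\<chi> c)) x"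
    have ne: "a \<noteq> b" using ab(3) eqs by (auto simp: before_def)
    have b': "(l, i, j) \<in> addables ?A" and a': "(l', i', j') \<in> addables ?B"
      using addables_plus_cell[of a \<Lambda> b] addables_plus_cell[of b \<Lambda> a] ab ne eqs by auto
    have rat: "zw_poly ?x ?y = (?x - t1 * ?y) * (?x - t2 * ?y) * (?x - t3 * ?y)"
      "- zw_poly ?y ?x = (?x - ?y / t1) * (?x - ?y / t2) * (?x - ?y / t3)"
      by (simp_all add: zw_poly_def[of ?x ?y] zw_poly_reflect[of ?y ?x])

    show "fock_C (plus_cell \<Lambda> b) a = fock_C \<Lambda> a"
    proof -
      have rows: "row (?B l') k = row (\<Lambda> l') k" if "k \<le> j'" for k
        using ab(3) that by (auto simp: row_plus_cell[OF b] eqs before_def)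
      have "fock_e t1 t2 (?B l') j' = fock_e t1 t2 (\<Lambda> l') j'"
        unfolding fock_e_def Let_def by (intro arg_cong2[where f = "(*)"] prod.cong refl) (auto simp: rows)
      moreover have "(\<Prod>c | c < l'. ?\<gamma> ?B c ?y) = (\<Prod>c | c < l'. ?\<gamma> \<Lambda> c ?y)"
        by (rule prod.cong) (use ab(3) in \<open>auto simp: plus_cell_other[OF b] eqs before_def\<close>)
      ultimately show ?thesis by (simp add: fock_C_def eqs)
    qed
    show "fock_C (plus_cell \<Lambda> a) b * zw_poly (weight b) (weight a) = - (fock_C \<Lambda> b * zw_poly (weight a) (weight b))"
    proof (cases "l' < l")
      case True
      have z: "?x \<noteq> id (mon m n l')" for m n by (rule weight_neq_mon) (use True in simp)
      have e: "fock_e t1 t2 (?A l) j = fock_e t1 t2 (\<Lambda> l) j"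
        using True by (simp add: plus_cell_other[OF a])
      have split: "(\<Prod>c | c < l. ?\<gamma> M c ?x) = ?\<gamma> M l' ?x * (\<Prod>c\<in>{c. c < l} - {l'}. ?\<gamma> M c ?x)" for M
        by (rule prod.remove) (use True in auto)
      have other: "(\<Prod>c\<in>{c. c < l} - {l'}. ?\<gamma> ?A c ?x) = (\<Prod>c\<in>{c. c < l} - {l'}. ?\<gamma> \<Lambda> c ?x)"
        by (rule prod.cong) (auto simp: plus_cell_other[OF a])
      have "?\<gamma> ?A l' ?x * zw_poly ?x ?y = ?\<gamma> \<Lambda> l' ?x * - zw_poly ?y ?x"
        unfolding rat using fock_gamma_plus[where z = ?x and \<epsilon> = id and l = l', OF z a] by simp
      from product_swap_minus[where u = 1, OF this[unfolded mult_minus_right]] show ?thesis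
        unfolding fock_C_def eqs prod.case e split other by simp
    next
      case False
      then have lj: "l' = l" "j' < j" using ab(3) by (auto simp: eqs before_def)
      have j: "j' \<in> {1..<j}" using lj addables_quadrant[OF a] by (simp add: in_quadrant_def)
      have x: "mon (int (row (\<Lambda> l) j)) (int j - 1) l = ?x" "mon (int (row (?A l) j)) (int j - 1) l = ?x"
        by (rule weight_addable[OF b, symmetric], rule weight_addable[OF b', symmetric])
      have split: "(\<Prod>k\<in>{1..<j}. row_factor id M ?x (l, k)) =
          row_factor id M ?x (l, j') * (\<Prod>k\<in>{1..<j} - {j'}. row_factor id M ?x (l, k))" for M
        by (rule prod.remove[OF _ j]) simp
      have other: "(\<Prod>k\<in>{1..<j} - {j'}. row_factor id ?A ?x (l, k)) = (\<Prod>k\<in>{1..<j} - {j'}. row_factor id \<Lambda> ?x (l, k))"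
        by (rule prod.cong) (auto intro: row_factor_other[OF a])
      have gammas: "(\<Prod>c | c < l. ?\<gamma> ?A c ?x) = (\<Prod>c | c < l. ?\<gamma> \<Lambda> c ?x)"
        by (rule prod.cong) (use lj plus_cell_other[OF a] in auto)
      have ne: "?x \<noteq> ?y" "?x \<noteq> t1 * ?y" "?x \<noteq> ?y / t1"
        using two_addables[of a \<Lambda> b] two_addables[of b \<Lambda> a] ab ne unfolding weight_precedes eqs
        by (auto simp: field_simps)
      have "row_factor id ?A ?x (l, j') * zw_poly ?x ?y = row_factor id \<Lambda> ?x (l, j') * - zw_poly ?y ?x"
        unfolding rat using row_factor_shift[OF a, of ?x id] ne lj by simp
      moreover have "r' * s * d * g * p = - (r * s * d * g * q)" if "r' * p = r * - q" for r r' s d g p q :: 'k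
        using product_swap_minus[of r' p r q 1 s "d * g"] that by (simp add: mult.assoc)
      ultimately show ?thesis
        unfolding fock_C_def eqs prod.case fock_e_rows x split other gammas by blast
    qed
  qed
  show ?thesis
    unfolding exchange_def
  proof (intro allI ballI impI)
    fix \<Lambda> :: "'r diagrams" and a b
    assume ab: "a \<in> addables \<Lambda>" "b \<in> addables \<Lambda>" "a \<noteq> b"
    have "before a b \<or> before b a"
      using ab by (cases a, cases b) (auto simp: before_def addables_iff not_less_iff_gr_or_eq)
    then show "fock_C \<Lambda> a * fock_C (plus_cell \<Lambda> a) b * zw_poly (weight b) (weight a) =
        - (fock_C \<Lambda> b * fock_C (plus_cell \<Lambda> b) a * zw_poly (weight a) (weight b))"
    proof
      assume "before a b"
      from main[OF ab(1,2) this] show ?thesis by algebra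
    next
      assume "before b a"
      from main[OF ab(2,1) this] show ?thesis by algebra
    qed
  qed
qed

text \<open>
  The rows before and after that of the box come from adding and from removing it, the other diagrams from
  the twists on both sides.  Together all rows but one appear once, as in the residue.
\<close>

lemma fock_C_D:
  assumes b: "(l, i, j) \<in> addables \<Lambda>" and L: "tall L (plus_cell \<Lambda> (l, i, j))"
  shows "fock_C \<Lambda> (l, i, j) * fock_D \<Lambda> (l, i, j) * (weight (l, i, j) * ((1 - t1) * (1 - t2) * (1 - t3))) =
      - (inverse t ^ card (UNIV :: 'r set) * end_residue L \<Lambda> (l, j, True))"
proof -
  note L' = tall_plus[OF L b]
  define x where "x = weight (l, i, j)"
  have x0: "x \<noteq> 0" by (simp add: x_def)
  have x_mon: "x = mon (int (row (\<Lambda> l) j)) (int j - 1) l" unfolding x_def by (rule weight_addable[OF b])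
  let ?\<gamma> = "\<lambda>c. fock_gamma id t1 t2 t (\<Lambda> c) (inverse (\<chi> c)) x"
  let ?rf = "row_factor id \<Lambda> x"
  define G where "G = (\<Prod>c\<in>UNIV - {l}. (\<Prod>k=1..L. ?rf (c, k)) * tail_factor id L x c)"
  define R where "R = (\<Prod>k\<in>{1..L} - {j}. ?rf (l, k))"
  have "(\<Prod>c | c < l. ?\<gamma> c) * (\<Prod>c | l < c. ?\<gamma> c) = (\<Prod>c\<in>{c. c < l} \<union> {c. l < c}. ?\<gamma> c)"
    by (rule prod.union_disjoint[symmetric]) auto
  also have "{c. c < l} \<union> {c. l < c} = UNIV - {l}" by auto
  also have "(\<Prod>c\<in>UNIV - {l}. ?\<gamma> c) = (\<Prod>c\<in>UNIV - {l}. inverse t * ((\<Prod>k=1..L. ?rf (c, k)) * tail_factor id L x c))"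
  proof (rule prod.cong[OF refl])
    fix c assume "c \<in> UNIV - {l}"
    then have z: "x \<noteq> id (mon m n c)" for m n unfolding x_def by (intro weight_neq_mon) auto
    show "?\<gamma> c = inverse t * ((\<Prod>k=1..L. ?rf (c, k)) * tail_factor id L x c)"
      using fock_gamma_row_factors[where z = x and \<epsilon> = id and a = c, OF z L'(1)] by simp
  qed
  also have "\<dots> = inverse t ^ (card (UNIV :: 'r set) - 1) * G"
    unfolding prod.distrib G_def by (simp add: card_Diff_singleton)
  finally have gammas: "(\<Prod>c | c < l. ?\<gamma> c) * (\<Prod>c | l < c. ?\<gamma> c) = inverse t ^ (card (UNIV :: 'r set) - 1) * G" .
  have t_pow: "inverse t * inverse t ^ (card (UNIV :: 'r set) - 1) = inverse t ^ card (UNIV :: 'r set)"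
  proof -
    have "0 < card (UNIV :: 'r set)" by (simp add: card_gt_0_iff)
    then show ?thesis by (metis Suc_diff_1 power_Suc)
  qed
  have R: "(\<Prod>k\<in>{1..<j}. ?rf (l, k)) * (\<Prod>k\<in>{j + 1..L}. ?rf (l, k)) = R"
  proof -
    have "{1..L} - {j} = {1..<j} \<union> {j + 1..L}" using L' by auto
    moreover have "{1..<j} \<inter> {j + 1..L} = {}" by auto
    ultimately show ?thesis
      unfolding R_def using prod.union_disjoint[of "{1..<j}" "{j + 1..L}" "\<lambda>k. ?rf (l, k)"] by simp
  qed
  have e: "fock_e t1 t2 (\<Lambda> l) j = (\<Prod>k\<in>{1..<j}. ?rf (l, k)) * (1 / (1 - t1))"
    unfolding fock_e_rows x_mon ..
  have f: "fock_f t1 t2 t (plus_cell \<Lambda> (l, i, j) l) j = inverse t *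
      ((\<Prod>k\<in>{j + 1..L}. ?rf (l, k)) * tail_factor id L x l) * (1 / (inverse t1 - 1))"
    unfolding fock_f_rows[OF b L] x_def ..
  have res: "end_residue L \<Lambda> (l, j, True) = (x - t3 * x) * (x - t2 * x) / (x - x / t1) * (R * tail_factor id L x l * G)"
  proof -
    have "pole \<Lambda> (l, j, True) = x" "zero \<Lambda> (l, j, True) = t3 * x" "zero \<Lambda> (l, j, False) = t2 * x" "pole \<Lambda> (l, j, False) = x / t1"
      by (simp_all add: zero_def pole_def x_mon t2_mon t3_mon t_div_mon)
    moreover have "(\<Prod>p\<in>UNIV \<times> {1..L} - {(l, j)}. ?rf p) * (\<Prod>a\<in>UNIV. tail_factor id L x a) = R * tail_factor id L x l * G"
    proof -
      have "UNIV \<times> {1..L} - {(l, j)} = Pair l ` ({1..L} - {j}) \<union> (UNIV - {l}) \<times> {1..L}"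
        by auto
      then have "(\<Prod>p\<in>UNIV \<times> {1..L} - {(l, j)}. ?rf p) =
          (\<Prod>p\<in>Pair l ` ({1..L} - {j}). ?rf p) * (\<Prod>p\<in>(UNIV - {l}) \<times> {1..L}. ?rf p)"
        by (simp only:) (rule prod.union_disjoint, auto)
      also have "(\<Prod>p\<in>Pair l ` ({1..L} - {j}). ?rf p) = R"
        unfolding R_def by (subst prod.reindex) (auto simp: inj_on_def)
      also have "(\<Prod>p\<in>(UNIV - {l}) \<times> {1..L}. ?rf p) = (\<Prod>c\<in>UNIV - {l}. \<Prod>k=1..L. ?rf (c, k))"
        by (simp only: prod.cartesian_product case_prod_unfold prod.collapse)
      finally show ?thesis
        unfolding G_def prod.distrib prod.remove[OF finite UNIV_I, of "tail_factor id L x" l] by (simp only: mult_ac)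
    qed
    ultimately show ?thesis unfolding residue_rows[OF L'] by simp
  qed
  have edge: "1 / (1 - t1) * (1 / (inverse t1 - 1)) * (x * ((1 - t1) * (1 - t2) * (1 - t3))) =
      - ((x - t3 * x) * (x - t2 * x) / (x - x / t1))"
  proof -
    have "x - x / t1 = - (x * (inverse t1 - 1))" by (simp add: field_simps)
    moreover have "(x - t3 * x) * (x - t2 * x) = x * (x * ((1 - t2) * (1 - t3)))" by (simp add: algebra_simps)
    ultimately show ?thesis using x0 by simp
  qed
  have "fock_C \<Lambda> (l, i, j) * fock_D \<Lambda> (l, i, j) =
      fock_e t1 t2 (\<Lambda> l) j * fock_f t1 t2 t (plus_cell \<Lambda> (l, i, j) l) j * ((\<Prod>c | c < l. ?\<gamma> c) * (\<Prod>c | l < c. ?\<gamma> c))"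
    unfolding fock_C_def fock_D_def prod.case x_def[symmetric] by (simp only: mult_ac)
  also have "\<dots> = (inverse t * inverse t ^ (card (UNIV :: 'r set) - 1)) *
      ((\<Prod>k\<in>{1..<j}. ?rf (l, k)) * (\<Prod>k\<in>{j + 1..L}. ?rf (l, k)) * tail_factor id L x l * G) * (1 / (1 - t1) * (1 / (inverse t1 - 1)))"
    unfolding e f gammas by (simp only: mult_ac)
  finally have "fock_C \<Lambda> (l, i, j) * fock_D \<Lambda> (l, i, j) =
      inverse t ^ card (UNIV :: 'r set) * (1 / (1 - t1) * (1 / (inverse t1 - 1))) * (R * tail_factor id L x l * G)"
    unfolding t_pow R by (simp only: mult_ac)
  then show ?thesis
    unfolding res x_def[symmetric] by (simp only: times_edge[OF edge])
qed

end

section \<open>Comparison of the two representations\<close>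

context toroidal_parameters
begin

lemma rescaling_isomorphism:
  fixes g :: "'r diagrams \<Rightarrow> 'k"
  assumes V: "box_module t1 t2 t \<chi> \<rho> C D" and W: "box_module t1 t2 t \<chi> \<rho>' C' D'"
    and g: "\<And>\<Lambda>. g \<Lambda> \<noteq> 0"
    and rec: "\<And>\<Lambda> b. b \<in> addables \<Lambda> \<Longrightarrow> g (plus_cell \<Lambda> b) * C \<Lambda> b = g \<Lambda> * C' \<Lambda> b"
  shows "toroidal_iso t1 t2 t3 scale \<rho> scale \<rho>' (lin_ext (\<lambda>\<Lambda>. Poly_Mapping.single \<Lambda> (g \<Lambda>)))"
proof -
  interpret V: box_module t1 t2 t \<chi> \<rho> C D by (rule V)
  interpret W: box_module t1 t2 t \<chi> \<rho>' C' D' by (rule W)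
  define \<phi> where "\<phi> = lin_ext (\<lambda>\<Lambda>. Poly_Mapping.single \<Lambda> (g \<Lambda>))"
  define \<phi>' where "\<phi>' = lin_ext (\<lambda>\<Lambda>. Poly_Mapping.single \<Lambda> (1 / g \<Lambda>))"
  have lin: "lin \<phi>" "lin \<phi>'" by (simp_all add: \<phi>_def \<phi>'_def lin_lin_ext)
  have single: "\<phi> (Poly_Mapping.single \<Lambda> x) = Poly_Mapping.single \<Lambda> (x * g \<Lambda>)" for \<Lambda> x
    by (simp add: \<phi>_def)
  have inv: "\<phi>' (\<phi> v) = v" "\<phi> (\<phi>' v) = v" for v
    by (rule lin_eqI[OF lin_comp[OF lin(2,1)] lin_ident], use g in \<open>simp add: \<phi>_def \<phi>'_def\<close>)
      (rule lin_eqI[OF lin_comp[OF lin] lin_ident], use g in \<open>simp add: \<phi>_def \<phi>'_def\<close>)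
  have bij: "bij \<phi>"
    by (rule bij_betw_byWitness[where f' = \<phi>']) (auto simp: inv)
  \<comment> \<open>The compatibility with \<open>f\<close> follows from that with \<open>e\<close>, because \<open>C * D\<close> is the same residue on both sides.\<close>
  have rec': "g \<Lambda> * D \<Lambda> b = g (plus_cell \<Lambda> b) * D' \<Lambda> b" if b: "b \<in> addables \<Lambda>" for \<Lambda> b
  proof -
    obtain l i j where b_eq: "b = (l, i, j)" by (cases b) auto
    obtain L where L: "tall L (plus_cell \<Lambda> (l, i, j))" using tall_ex by blast
    have "C \<Lambda> b * D \<Lambda> b = C' \<Lambda> b * D' \<Lambda> b"
      using V.norm_residue_eq[OF b[unfolded b_eq] L] W.norm_residue_eq[OF b[unfolded b_eq] L]
      by (simp add: b_eq V.norm_residue_def W.norm_residue_def)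
    then have "(g \<Lambda> * D \<Lambda> b) * C \<Lambda> b = (g (plus_cell \<Lambda> b) * D' \<Lambda> b) * C \<Lambda> b"
      using rec[OF b] by algebra
    then show ?thesis using V.C_nonzero[OF b] by simp
  qed
  have intertwines: "\<phi> (\<rho> x v) = \<rho>' x (\<phi> v)" for x v
  proof (rule lin_eqI[OF lin_comp[OF lin(1) V.lin_rho] lin_comp[OF W.lin_rho lin(1)]])
    fix \<Lambda>
    have \<phi>: "\<rho>' x (\<phi> (basis_vector \<Lambda>)) = scale (g \<Lambda>) (\<rho>' x (basis_vector \<Lambda>))"
      unfolding single by (subst W.rho_single) simp
    show "\<phi> (\<rho> x (basis_vector \<Lambda>)) = \<rho>' x (\<phi> (basis_vector \<Lambda>))"
    proof (cases x)
      case (E p)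
      show ?thesis
        unfolding \<phi> unfolding E V.rho_E W.rho_E lin_map_sum[OF lin(1)] scale_sum_right single scale_single
        using rec by (intro sum.cong refl arg_cong[where f = "Poly_Mapping.single _"]) (simp add: mult_ac)
    next
      case (F p)
      have "g (minus_cell \<Lambda> b) * D (minus_cell \<Lambda> b) b = g \<Lambda> * D' (minus_cell \<Lambda> b) b" if "b \<in> removables \<Lambda>" for b
        using rec'[OF addables_minus_cell[OF that]] that by simp
      then show ?thesis
        unfolding \<phi> unfolding F V.rho_F W.rho_F lin_map_sum[OF lin(1)] scale_sum_right single scale_single
        by (intro sum.cong refl arg_cong[where f = "Poly_Mapping.single _"]) (simp add: mult_ac)
    next
      case (Psi m)
      show ?thesis unfolding \<phi> unfolding Psi V.rho_Psi W.rho_Psi single scale_single by (simp add: mult.commute)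
    next
      case Psi0_inv
      show ?thesis
        unfolding \<phi> unfolding Psi0_inv V.rho_Psi0_inv W.rho_Psi0_inv single scale_single by (simp add: mult.commute)
    qed
  qed
  show ?thesis
    unfolding toroidal_iso_def \<phi>_def[symmetric]
    using V.box_module_toroidal_rep W.box_module_toroidal_rep lin bij intertwines by blast
qed

lemma lookup_sum_addables:
  fixes \<Lambda> :: "'r diagrams" and h :: "'r cell \<Rightarrow> 'k"
  assumes "b \<in> addables \<Lambda>"
  shows "Poly_Mapping.lookup (\<Sum>a\<in>addables \<Lambda>. Poly_Mapping.single (plus_cell \<Lambda> a) (h a)) (plus_cell \<Lambda> b) = h b"
proof -
  have "Poly_Mapping.lookup (\<Sum>a\<in>addables \<Lambda>. Poly_Mapping.single (plus_cell \<Lambda> a) (h a)) (plus_cell \<Lambda> b) =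
      (\<Sum>a\<in>addables \<Lambda>. if b = a then h a else 0)"
    unfolding lookup_sum lookup_single when_def
  proof (rule sum.cong[OF refl])
    fix a assume "a \<in> addables \<Lambda>"
    then show "(if plus_cell \<Lambda> a = plus_cell \<Lambda> b then h a else 0) = (if b = a then h a else 0)"
      using plus_cell_inject[of a \<Lambda> b] assms by auto
  qed
  then show ?thesis using assms by simp
qed

text \<open>
  Comparison of the coefficients of \<open>\<Lambda> + b\<close> in the two images of \<open>\<Lambda>\<close> under \<open>e\<^sub>0\<close>.
\<close>

lemma isomorphism_recursion:
  fixes g :: "'r diagrams \<Rightarrow> 'k"
  assumes V: "box_module t1 t2 t \<chi> \<rho> C D" and W: "box_module t1 t2 t \<chi> \<rho>' C' D'"
    and iso: "toroidal_iso t1 t2 t3 scale \<rho> scale \<rho>' (lin_ext (\<lambda>\<Lambda>. Poly_Mapping.single \<Lambda> (g \<Lambda>)))"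
    and b: "b \<in> addables \<Lambda>"
  shows "g (plus_cell \<Lambda> b) * C \<Lambda> b = g \<Lambda> * C' \<Lambda> b"
proof -
  interpret V: box_module t1 t2 t \<chi> \<rho> C D by (rule V)
  interpret W: box_module t1 t2 t \<chi> \<rho>' C' D' by (rule W)
  define \<phi> where "\<phi> = lin_ext (\<lambda>\<Lambda>. Poly_Mapping.single \<Lambda> (g \<Lambda>))"
  have lin: "lin \<phi>" by (simp add: \<phi>_def lin_lin_ext)
  have single: "\<phi> (Poly_Mapping.single \<Lambda> x) = Poly_Mapping.single \<Lambda> (x * g \<Lambda>)" for \<Lambda> x
    by (simp add: \<phi>_def)
  have "\<phi> (\<rho> (E 0) (basis_vector \<Lambda>)) = \<rho>' (E 0) (\<phi> (basis_vector \<Lambda>))"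
    using iso by (simp add: toroidal_iso_def \<phi>_def[symmetric])
  moreover have "\<phi> (\<rho> (E 0) (basis_vector \<Lambda>)) =
      (\<Sum>a\<in>addables \<Lambda>. Poly_Mapping.single (plus_cell \<Lambda> a) (C \<Lambda> a * g (plus_cell \<Lambda> a)))"
    by (simp add: V.rho_E lin_map_sum[OF lin] single)
  moreover have "\<rho>' (E 0) (\<phi> (basis_vector \<Lambda>)) =
      (\<Sum>a\<in>addables \<Lambda>. Poly_Mapping.single (plus_cell \<Lambda> a) (g \<Lambda> * C' \<Lambda> a))"
    unfolding single by (subst W.rho_single) (simp add: W.rho_E scale_sum_right)
  ultimately have "C \<Lambda> b * g (plus_cell \<Lambda> b) = g \<Lambda> * C' \<Lambda> b"
    using lookup_sum_addables[OF b] by metis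
  then show ?thesis by (simp add: mult.commute)
qed

theorem unique_isomorphism:
  assumes V: "box_module t1 t2 t \<chi> \<rho> C D" and W: "box_module t1 t2 t \<chi> \<rho>' C' D'"
  shows "\<exists>!g :: 'r diagrams \<Rightarrow> 'k. g (\<lambda>_. empty_diagram) = 1 \<and>
    toroidal_iso t1 t2 t3 scale \<rho> scale \<rho>' (lin_ext (\<lambda>\<Lambda>. Poly_Mapping.single \<Lambda> (g \<Lambda>)))"
proof -
  interpret V: box_module t1 t2 t \<chi> \<rho> C D by (rule V)
  interpret W: box_module t1 t2 t \<chi> \<rho>' C' D' by (rule W)
  obtain g where g: "g (\<lambda>_. empty_diagram) = 1" "\<And>\<Lambda>. g \<Lambda> \<noteq> 0"
    "\<And>\<Lambda> b. b \<in> addables \<Lambda> \<Longrightarrow> g (plus_cell \<Lambda> b) * C \<Lambda> b = g \<Lambda> * C' \<Lambda> b"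
    using exchange_gauge_equivalent[OF V.exchange_C V.C_nonzero W.exchange_C W.C_nonzero] by metis
  show ?thesis
  proof (rule ex1I[of _ g])
    show "g (\<lambda>_. empty_diagram) = 1 \<and>
        toroidal_iso t1 t2 t3 scale \<rho> scale \<rho>' (lin_ext (\<lambda>\<Lambda>. Poly_Mapping.single \<Lambda> (g \<Lambda>)))"
      using g rescaling_isomorphism[OF V W g(2,3)] by blast
  next
    fix h :: "'r diagrams \<Rightarrow> 'k"
    assume h: "h (\<lambda>_. empty_diagram) = 1 \<and>
        toroidal_iso t1 t2 t3 scale \<rho> scale \<rho>' (lin_ext (\<lambda>\<Lambda>. Poly_Mapping.single \<Lambda> (h \<Lambda>)))"
    have "h \<Lambda> = g \<Lambda>" for \<Lambda>
    proof (induction \<Lambda> rule: diagrams_induct)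
      case empty
      then show ?case using h g(1) by simp
    next
      case (plus \<Lambda> b)
      have "h (plus_cell \<Lambda> b) * C \<Lambda> b = h \<Lambda> * C' \<Lambda> b"
        using isomorphism_recursion[OF V W _ plus(1)] h by blast
      then have "h (plus_cell \<Lambda> b) * C \<Lambda> b = g (plus_cell \<Lambda> b) * C \<Lambda> b"
        using g(3)[OF plus(1)] plus(2) by simp
      then show ?case using V.C_nonzero[OF plus(1)] by simp
    qed
    then show "h = g" by blast
  qed
qed

subsection \<open>The Gieseker representation\<close>

lemma cells_Sigma: "cells \<Lambda> = (SIGMA a:UNIV. boxes (\<Lambda> a))"
  by (auto simp: cells_def boxes_def)

lemma finite_boxes: "finite (boxes (\<Lambda> a))" for \<Lambda> :: "'r diagrams"
proof -
  have "boxes (\<Lambda> a) \<subseteq> snd ` cells \<Lambda>" by (force simp: cells_Sigma)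
  then show ?thesis by (rule finite_subset) simp
qed

lemma box_weight_eq: "c \<in> cells \<Lambda> \<Longrightarrow> box_weight t1 t2 (\<chi> (fst c)) (snd c) = weight c"
proof -
  assume c: "c \<in> cells \<Lambda>"
  obtain a i j where [simp]: "c = (a, i, j)" by (cases c) auto
  have "int i - 1 = int (i - 1)" "int j - 1 = int (j - 1)" using c by (auto simp: cells_def)
  then show ?thesis
    by (simp only: box_weight_def weight_def mon_def prod.case fst_conv snd_conv \<open>c = (a, i, j)\<close> power_int_of_nat)
qed

text \<open>
  The Gieseker eigenvalue has a factor for every box and that of the Fock modules one for every row.
  Both behave in the same way when a box is added, and agree for empty diagrams.
\<close>

lemma gieseker_psi_eigenvalue:
  fixes z :: "'k fls"
  assumes "z = fls_X \<or> z = fls_X_inv"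
  shows "gieseker_psi fls_const t1 t2 t \<chi> \<Lambda> z = eigenvalue fls_const \<Lambda> z"
proof -
  define R where "R w = (\<Prod>s\<leftarrow>[t1, t2, inverse (t1 * t2)].
        (1 - fls_const (inverse s * w) / z) / (1 - fls_const (s * w) / z))" for w
  define V where "V = (\<Prod>a\<in>UNIV. (fls_const (inverse t) - fls_const (t * inverse (\<chi> a)) / z) / (1 - fls_const (inverse (\<chi> a)) / z))"
  have z0: "z \<noteq> 0" using assms by auto
  have z: "z \<noteq> fls_const c" for c using assms fls_X_neq_const by (auto dest: sym)
  have gies: "gieseker_psi fls_const t1 t2 t \<chi> \<Lambda> z = V * (\<Prod>c\<in>cells \<Lambda>. R (weight c))" for \<Lambda>
  proof -
    have "(\<Prod>a\<in>UNIV. \<Prod>b\<in>boxes (\<Lambda> a). R (box_weight t1 t2 (\<chi> a) b)) =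
        (\<Prod>c\<in>cells \<Lambda>. R (box_weight t1 t2 (\<chi> (fst c)) (snd c)))"
      unfolding cells_Sigma by (subst prod.Sigma) (auto simp: finite_boxes case_prod_unfold)
    then show ?thesis
      unfolding gieseker_psi_def V_def R_def[symmetric] by (simp add: box_weight_eq)
  qed
  have ratio: "(1 - p / z) / (1 - q / z) = (z - p) / (z - q)" for p q
  proof -
    have "1 - p / z = (z - p) / z" for p using z0 by (simp add: diff_divide_distrib)
    then show ?thesis using z0 by simp
  qed
  have R: "R w = (z - fls_const (w / t1)) * (z - fls_const (w / t2)) * (z - fls_const (w / t3)) /
      ((z - fls_const (t1 * w)) * (z - fls_const (t2 * w)) * (z - fls_const (t3 * w)))" for w
  proof -
    have "R w = (1 - fls_const (w / t1) / z) / (1 - fls_const (t1 * w) / z) *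
        ((1 - fls_const (w / t2) / z) / (1 - fls_const (t2 * w) / z) *
         ((1 - fls_const (w / t3) / z) / (1 - fls_const (t3 * w) / z)))"
      unfolding R_def t3_def[symmetric] by (simp only: list.map prod_list.Cons prod_list.Nil mult_1_right mult_1_left divide_inverse mult.commute)
    then show ?thesis unfolding ratio by (simp add: mult.assoc)
  qed
  show ?thesis
  proof (induction \<Lambda> rule: diagrams_induct)
    case empty
    have "fock_gamma fls_const t1 t2 t empty_diagram (inverse (\<chi> a)) z =
        (fls_const (inverse t) - fls_const (t * inverse (\<chi> a)) / z) / (1 - fls_const (inverse (\<chi> a)) / z)" for a
    proof -
      have row: "row empty_diagram k = 0" for k
        by (simp add: empty_diagram_def row_Abs_young is_diagram_def)
      then have "num_rows empty_diagram = 0"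
        using num_rows_le[of 0 empty_diagram] by simp
      then have "fock_gamma fls_const t1 t2 t empty_diagram (inverse (\<chi> a)) z =
          fls_const (inverse t) * ((z - fls_const (t3 * inverse (\<chi> a))) / (z - fls_const (inverse (\<chi> a))))"
        by (simp add: fock_gamma_def row t3_def power_int_minus)
      also have "\<dots> = (fls_const (inverse t) * z - fls_const (inverse t * (t3 * inverse (\<chi> a)))) / (z - fls_const (inverse (\<chi> a)))"
        by (simp add: right_diff_distrib)
      also have "inverse t * (t3 * inverse (\<chi> a)) = t * inverse (\<chi> a)"
      proof -
        have "t3 = t * t" using t_square by (simp add: t3_def power2_eq_square)
        then show ?thesis by simp
      qed
      also have "(fls_const (inverse t) * z - fls_const (t * inverse (\<chi> a))) / (z - fls_const (inverse (\<chi> a))) =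
          (fls_const (inverse t) - fls_const (t * inverse (\<chi> a)) / z) / (1 - fls_const (inverse (\<chi> a)) / z)"
      proof -
        have "fls_const (inverse t) * z - p = z * (fls_const (inverse t) - p / z)" "z - p = z * (1 - p / z)" for p
          using z0 by (simp_all add: right_diff_distrib mult.commute)
        then show ?thesis using z0 by (metis mult_divide_mult_cancel_left)
      qed
      finally show ?thesis .
    qed
    then show ?case unfolding gies V_def by (simp add: eigenvalue_def)
  next
    case (plus \<Lambda> b)
    let ?w = "weight b"
    let ?n = "(z - fls_const (?w / t1)) * (z - fls_const (?w / t2)) * (z - fls_const (?w / t3))"
    let ?d = "(z - fls_const (t1 * ?w)) * (z - fls_const (t2 * ?w)) * (z - fls_const (t3 * ?w))"
    have d: "?d \<noteq> 0" using z by (simp del: fls_const_mult_const)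
    have "gieseker_psi fls_const t1 t2 t \<chi> (plus_cell \<Lambda> b) z = eigenvalue fls_const \<Lambda> z * (?n / ?d)"
      using plus addables_notin[OF plus(1)] unfolding gies by (simp add: R mult_ac)
    also have "\<dots> = eigenvalue fls_const (plus_cell \<Lambda> b) z"
      using eigenvalue_plus[where z = z and \<epsilon> = fls_const, OF z plus(1)] d by (simp add: nonzero_divide_eq_eq)
    finally show ?case .
  qed
qed

lemma psi_coeff_eigenvalue:
  assumes "\<And>z. z = fls_X \<or> z = fls_X_inv \<Longrightarrow> f z = eigenvalue fls_const \<Lambda> z"
  shows "psi_coeff f m = (if m \<ge> 0 then psi_plus_value \<Lambda> m else psi_minus_value \<Lambda> m)"
    and "psi0_inv_coeff f = psi_minus_value \<Lambda> 0"
  using assms by (simp_all add: psi_coeff_def psi0_inv_coeff_def psi_plus_value_def psi_minus_value_def)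

lemma plus_cell_addable:
  fixes \<Lambda> :: "'r diagrams"
  shows "(l, i, j) \<in> addables \<Lambda> \<Longrightarrow> plus_cell \<Lambda> (l, i, j) = add_box_at \<Lambda> l j"
  unfolding addables_iff by (elim conjE) (simp only: plus_cell_eq)

lemma gieseker_box_module: "box_module t1 t2 t \<chi> (gieseker_action t1 t2 t \<chi>) gieseker_C gieseker_D"
proof (intro box_module.intro box_module_axioms.intro)
  show "lin (gieseker_action t1 t2 t \<chi> g)" for g
    unfolding gieseker_action_def by (rule lin_lin_ext)
  show "gieseker_action t1 t2 t \<chi> (E p) (basis_vector \<Lambda>) =
      (\<Sum>b\<in>addables \<Lambda>. Poly_Mapping.single (plus_cell \<Lambda> b) (gieseker_C \<Lambda> b * weight b powi p))" for p \<Lambda>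
    unfolding gieseker_action_def lin_ext_single scale_one gieseker_basis_action.simps sum_addables
  proof (rule sum.cong[OF refl], clarify)
    fix l i j assume b: "(l, i, j) \<in> addables \<Lambda>"
    show "Poly_Mapping.single (add_box_at \<Lambda> l j) (gieseker_e t1 t2 \<chi> p (add_box_at \<Lambda> l j) l j) =
        Poly_Mapping.single (plus_cell \<Lambda> (l, i, j)) (gieseker_C \<Lambda> (l, i, j) * weight (l, i, j) powi p)"
      by (simp only: plus_cell_addable[OF b, symmetric] gieseker_e_power[OF b])
  qed
  show "gieseker_action t1 t2 t \<chi> (F p) (basis_vector \<Lambda>) =
      (\<Sum>b\<in>removables \<Lambda>. Poly_Mapping.single (minus_cell \<Lambda> b) (gieseker_D (minus_cell \<Lambda> b) b * weight b powi p))" for p \<Lambda>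
    unfolding gieseker_action_def lin_ext_single scale_one gieseker_basis_action.simps sum_removables
  proof (rule sum.cong[OF refl], clarify)
    fix l i j assume b: "(l, i, j) \<in> removables \<Lambda>"
    then have "remove_box_at \<Lambda> l j = minus_cell \<Lambda> (l, i, j)" by (auto simp: removables_iff minus_cell_eq)
    then show "Poly_Mapping.single (remove_box_at \<Lambda> l j) (gieseker_f t1 t2 t \<chi> p (remove_box_at \<Lambda> l j) l j) =
        Poly_Mapping.single (minus_cell \<Lambda> (l, i, j)) (gieseker_D (minus_cell \<Lambda> (l, i, j)) (l, i, j) * weight (l, i, j) powi p)"
      using gieseker_f_power[OF addables_minus_cell[OF b]] by simp
  qed
  show "gieseker_action t1 t2 t \<chi> (Psi m) (basis_vector \<Lambda>) =
      Poly_Mapping.single \<Lambda> (if 0 \<le> m then psi_plus_value \<Lambda> m else psi_minus_value \<Lambda> m)" for m \<Lambda>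
    unfolding gieseker_action_def lin_ext_single scale_one gieseker_basis_action.simps
    by (subst psi_coeff_eigenvalue(1)[OF gieseker_psi_eigenvalue]) auto
  show "gieseker_action t1 t2 t \<chi> Psi0_inv (basis_vector \<Lambda>) = Poly_Mapping.single \<Lambda> (psi_minus_value \<Lambda> 0)" for \<Lambda>
    unfolding gieseker_action_def lin_ext_single scale_one gieseker_basis_action.simps
    by (subst psi_coeff_eigenvalue(2)[OF gieseker_psi_eigenvalue]) auto
qed (fact toroidal_parameters_axioms gieseker_exchange gieseker_C_nonzero gieseker_C_D)+

subsection \<open>The tensor product of Fock modules\<close>

lemma fock_box_module:
  "box_module t1 t2 t \<chi> (fock_tensor_action t1 t2 t (\<lambda>a. inverse (\<chi> a))) fock_C fock_D"
proof (intro box_module.intro box_module_axioms.intro)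
  show "lin (fock_tensor_action t1 t2 t (\<lambda>a. inverse (\<chi> a)) g)" for g
    unfolding fock_tensor_action_def by (rule lin_lin_ext)
  show "fock_tensor_action t1 t2 t (\<lambda>a. inverse (\<chi> a)) (E p) (basis_vector \<Lambda>) =
      (\<Sum>b\<in>addables \<Lambda>. Poly_Mapping.single (plus_cell \<Lambda> b) (fock_C \<Lambda> b * weight b powi p))" for p \<Lambda>
    unfolding fock_tensor_action_def lin_ext_single scale_one fock_tensor_basis_action.simps sum_addables Let_def
  proof (rule sum.cong[OF refl], clarify)
    fix l i j assume b: "(l, i, j) \<in> addables \<Lambda>"
    have x: "fock_e_supp t1 t2 (inverse (\<chi> l)) (\<Lambda> l) j = weight (l, i, j)"
      by (simp add: fock_e_supp_def weight_addable[OF b] mon_def)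
    show "Poly_Mapping.single (add_box_at \<Lambda> l j) (fock_e t1 t2 (\<Lambda> l) j *
          fock_e_supp t1 t2 (inverse (\<chi> l)) (\<Lambda> l) j powi p *
          (\<Prod>a | a < l. fock_gamma id t1 t2 t (\<Lambda> a) (inverse (\<chi> a)) (fock_e_supp t1 t2 (inverse (\<chi> l)) (\<Lambda> l) j))) =
        Poly_Mapping.single (plus_cell \<Lambda> (l, i, j)) (fock_C \<Lambda> (l, i, j) * weight (l, i, j) powi p)"
      unfolding x plus_cell_addable[OF b] by (simp add: fock_C_def mult_ac)
  qed
  show "fock_tensor_action t1 t2 t (\<lambda>a. inverse (\<chi> a)) (F p) (basis_vector \<Lambda>) =
      (\<Sum>b\<in>removables \<Lambda>. Poly_Mapping.single (minus_cell \<Lambda> b) (fock_D (minus_cell \<Lambda> b) b * weight b powi p))" for p \<Lambda>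
    unfolding fock_tensor_action_def lin_ext_single scale_one fock_tensor_basis_action.simps sum_removables Let_def
  proof (rule sum.cong[OF refl], clarify)
    fix l i j assume b: "(l, i, j) \<in> removables \<Lambda>"
    let ?M = "minus_cell \<Lambda> (l, i, j)"
    have x: "fock_f_supp t1 t2 (inverse (\<chi> l)) (\<Lambda> l) j = weight (l, i, j)"
      using b by (simp add: fock_f_supp_def weight_def removables_iff mon_def)
    have b': "(l, i, j) \<in> addables ?M" by (rule addables_minus_cell[OF b])
    have "remove_box_at \<Lambda> l j = ?M" using b by (auto simp: removables_iff minus_cell_eq)
    moreover have "(\<Prod>a | l < a. fock_gamma id t1 t2 t (?M a) (inverse (\<chi> a)) (weight (l, i, j))) =
        (\<Prod>a | l < a. fock_gamma id t1 t2 t (\<Lambda> a) (inverse (\<chi> a)) (weight (l, i, j)))"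
      using plus_cell_other[OF b'] b by (intro prod.cong) auto
    ultimately show "Poly_Mapping.single (remove_box_at \<Lambda> l j) (fock_f t1 t2 t (\<Lambda> l) j *
          fock_f_supp t1 t2 (inverse (\<chi> l)) (\<Lambda> l) j powi p *
          (\<Prod>a | l < a. fock_gamma id t1 t2 t (\<Lambda> a) (inverse (\<chi> a)) (fock_f_supp t1 t2 (inverse (\<chi> l)) (\<Lambda> l) j))) =
        Poly_Mapping.single ?M (fock_D ?M (l, i, j) * weight (l, i, j) powi p)"
      unfolding x using b by (simp add: fock_D_def mult_ac)
  qed
  show "fock_tensor_action t1 t2 t (\<lambda>a. inverse (\<chi> a)) (Psi m) (basis_vector \<Lambda>) =
      Poly_Mapping.single \<Lambda> (if 0 \<le> m then psi_plus_value \<Lambda> m else psi_minus_value \<Lambda> m)" for m \<Lambda>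
    unfolding fock_tensor_action_def lin_ext_single scale_one fock_tensor_basis_action.simps eigenvalue_def[symmetric]
    by (subst psi_coeff_eigenvalue(1)) auto
  show "fock_tensor_action t1 t2 t (\<lambda>a. inverse (\<chi> a)) Psi0_inv (basis_vector \<Lambda>) =
      Poly_Mapping.single \<Lambda> (psi_minus_value \<Lambda> 0)" for \<Lambda>
    unfolding fock_tensor_action_def lin_ext_single scale_one fock_tensor_basis_action.simps eigenvalue_def[symmetric]
    by (subst psi_coeff_eigenvalue(2)) auto
qed (fact toroidal_parameters_axioms fock_exchange fock_C_nonzero fock_C_D)+

end

subsection \<open>The parameters of the base field\<close>

text \<open>
  All that is needed of the field is that different Laurent monomials in \<open>t1\<close>, \<open>t2\<close> and the \<open>\<chi> a\<close> are different,
  and that it has characteristic zero.  Both are cases of the independence of the monomials over the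
  complex numbers.
\<close>

lemma base_field_parameters:
  fixes \<iota> :: "complex \<Rightarrow> 'k::field" and \<chi> :: "'r::{finite,linorder} \<Rightarrow> 'k"
  assumes "base_field \<iota> t1 t2 t \<chi>"
  shows "toroidal_parameters t1 t2 t \<chi>"
proof -
  have one: "\<iota> 1 = 1" and add: "\<And>x y. \<iota> (x + y) = \<iota> x + \<iota> y" and t: "t ^ 2 = inverse (t1 * t2)"
    using assms by (simp_all add: base_field_def)
  have indep: "c s = 0" if "finite S" "s \<in> S"
    "(\<Sum>(i, j, m)\<in>S. \<iota> (c (i, j, m)) * t1 ^ i * t2 ^ j * (\<Prod>a\<in>UNIV. \<chi> a ^ m a)) = 0"
    for S :: "(nat \<times> nat \<times> ('r \<Rightarrow> nat)) set" and c s
  proof -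
    have "\<forall>(S :: (nat \<times> nat \<times> ('r \<Rightarrow> nat)) set) c. finite S \<longrightarrow>
        (\<Sum>(i, j, m)\<in>S. \<iota> (c (i, j, m)) * t1 ^ i * t2 ^ j * (\<Prod>a\<in>UNIV. \<chi> a ^ m a)) = 0 \<longrightarrow> (\<forall>s\<in>S. c s = 0)"
      using assms unfolding base_field_def by (elim conjE) assumption
    then have "\<forall>s\<in>S. c s = 0" using that(1,3) by (elim allE[of _ S] allE[of _ c] impE)
    then show ?thesis using that(2) by (rule bspec)
  qed
  have zero: "\<iota> 0 = 0" using add[of 0 0] by (metis add_cancel_right_left add_0)
  have neg: "\<iota> (- 1) = - 1" using add[of 1 "-1"] one zero by (simp add: eq_neg_iff_add_eq_0 add.commute)
  have single: "t1 ^ i * t2 ^ j * (\<Prod>a\<in>UNIV. \<chi> a ^ m a) \<noteq> 0" for i j m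
  proof
    assume "t1 ^ i * t2 ^ j * (\<Prod>a\<in>UNIV. \<chi> a ^ m a) = 0"
    then have "(\<Sum>(i, j, m)\<in>{(i, j, m)}. \<iota> 1 * t1 ^ i * t2 ^ j * (\<Prod>a\<in>UNIV. \<chi> a ^ m a)) = 0"
      unfolding one by simp
    then show False using indep[of "{(i, j, m)}" "(i, j, m)" "\<lambda>_. 1"] by simp
  qed
  have delta: "(\<Prod>b\<in>UNIV. \<chi> b ^ (if b = a then 1 else 0)) = \<chi> a" for a
    by (simp add: if_distrib[of "\<lambda>n. _ ^ n"] cong: if_cong)
  have nz: "t1 \<noteq> 0" "t2 \<noteq> 0" "\<And>a. \<chi> a \<noteq> 0"
    using single[of 1 0 "\<lambda>_. 0"] single[of 0 1 "\<lambda>_. 0"] single[of 0 0 "\<lambda>b. if b = a then 1 else 0" for a]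
    by (auto simp: delta)
  show ?thesis
  proof
    show "t1 \<noteq> 0" "t2 \<noteq> 0" "\<chi> a \<noteq> 0" for a by (fact nz)+
    show "t \<noteq> 0" using t nz by auto
    show "t ^ 2 = inverse (t1 * t2)" by (rule t)
    have "\<iota> 6 = 6"
    proof -
      have "\<iota> (1 + 1 + 1 + 1 + 1 + 1) = 1 + 1 + 1 + 1 + 1 + 1" by (simp only: add one)
      then show ?thesis by simp
    qed
    then show "(6 :: 'k) \<noteq> 0"
      using indep[of "{(0, 0, \<lambda>_. 0)}" "(0, 0, \<lambda>_. 0)" "\<lambda>_. 6"] by auto
    fix i j i' j' :: int and a a' :: 'r
    assume eq: "t1 powi i * t2 powi j * inverse (\<chi> a) = t1 powi i' * t2 powi j' * inverse (\<chi> a')"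
    \<comment> \<open>Clearing denominators turns this into an equality of two monomials with nonnegative exponents.\<close>
    define K where "K = \<bar>i\<bar> + \<bar>j\<bar> + \<bar>i'\<bar> + \<bar>j'\<bar>"
    define \<delta> :: "'r \<Rightarrow> 'r \<Rightarrow> nat" where "\<delta> a = (\<lambda>b. if b = a then 1 else 0)" for a
    define s where "s = (nat (i + K), nat (j + K), \<delta> a')"
    define s' where "s' = (nat (i' + K), nat (j' + K), \<delta> a)"
    have pow: "u ^ nat (n + K) = u powi n * u powi K" if "u \<noteq> 0" "n + K \<ge> 0" for u :: 'k and n
    proof -
      have "u ^ nat (n + K) = u powi (n + K)" using that(2) by (simp add: power_int_def)
      also have "\<dots> = u powi n * u powi K" using that(1) by (intro power_int_add) simp
      finally show ?thesis .
    qed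
    have K: "i + K \<ge> 0" "j + K \<ge> 0" "i' + K \<ge> 0" "j' + K \<ge> 0" by (simp_all add: K_def)
    have "t1 ^ nat (i + K) * t2 ^ nat (j + K) * \<chi> a' = t1 ^ nat (i' + K) * t2 ^ nat (j' + K) * \<chi> a"
    proof -
      have "t1 powi i * t2 powi j * \<chi> a' = t1 powi i' * t2 powi j' * \<chi> a"
        using eq nz(3)[of a] nz(3)[of a'] by (simp add: field_simps)
      then have "(t1 powi i * t2 powi j * \<chi> a') * (t1 powi K * t2 powi K) = (t1 powi i' * t2 powi j' * \<chi> a) * (t1 powi K * t2 powi K)"
        by (simp only:)
      then show ?thesis unfolding pow[OF nz(1) K(1)] pow[OF nz(2) K(2)] pow[OF nz(1) K(3)] pow[OF nz(2) K(4)]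
        by (simp only: mult_ac)
    qed
    then have mono: "t1 ^ nat (i + K) * t2 ^ nat (j + K) * (\<Prod>b\<in>UNIV. \<chi> b ^ \<delta> a' b) =
        t1 ^ nat (i' + K) * t2 ^ nat (j' + K) * (\<Prod>b\<in>UNIV. \<chi> b ^ \<delta> a b)"
      unfolding \<delta>_def delta .
    have "s = s'"
    proof (rule ccontr)
      assume ne: "s \<noteq> s'"
      define T where "T = (\<lambda>(i, j, m). t1 ^ i * t2 ^ j * (\<Prod>a\<in>UNIV. \<chi> a ^ m a))"
      define c :: "nat \<times> nat \<times> ('r \<Rightarrow> nat) \<Rightarrow> complex" where "c = (\<lambda>x. if x = s then 1 else - 1)"
      have "T s = T s'" using mono by (simp only: T_def s_def s'_def prod.case)
      then have "(\<Sum>x\<in>{s, s'}. \<iota> (c x) * T x) = 0"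
        using ne by (simp add: c_def one neg)
      also have "(\<lambda>x. \<iota> (c x) * T x) = (\<lambda>(i, j, m). \<iota> (c (i, j, m)) * t1 ^ i * t2 ^ j * (\<Prod>a\<in>UNIV. \<chi> a ^ m a))"
        by (simp add: T_def fun_eq_iff mult.assoc)
      finally have "c s = 0" by (intro indep[of "{s, s'}" s c]) simp_all
      then show False by (simp add: c_def)
    qed
    then have "nat (i + K) = nat (i' + K)" "nat (j + K) = nat (j' + K)" "\<delta> a' = \<delta> a"
      by (simp_all add: s_def s'_def)
    moreover from this(3) have "a = a'" by (metis \<delta>_def zero_neq_one)
    ultimately show "i = i' \<and> j = j' \<and> a = a'" using K by (simp add: eq_nat_nat_iff)
  qed
qed

theorem theorem4p6:
  fixes \<iota> :: "complex \<Rightarrow> 'k::field"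
    and t1 t2 t :: 'k
    and \<chi> :: "'r::{finite,linorder} \<Rightarrow> 'k"
  assumes "base_field \<iota> t1 t2 t \<chi>"
  shows "\<exists>!c :: 'r diagrams \<Rightarrow> 'k.
           c (\<lambda>_. empty_diagram) = 1 \<and>
           toroidal_iso t1 t2 (inverse (t1 * t2))
             scale (gieseker_action t1 t2 t \<chi>)
             scale (fock_tensor_action t1 t2 t (\<lambda>a. inverse (\<chi> a)))
             (lin_ext (\<lambda>\<Lambda>. Poly_Mapping.single \<Lambda> (c \<Lambda>)))"
proof -
  interpret toroidal_parameters t1 t2 t \<chi>
    by (rule base_field_parameters[OF assms])
  show ?thesis
    using unique_isomorphism[OF gieseker_box_module fock_box_module] unfolding t3_def .
qed

end
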